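(* Assuming the BMM hypothesis, every algorithm against an adaptive adversary that maintains a maximal independent set (MIS) of an incremental graph with $n$ vertices requires total update time $\Omega(n^{\omega - o(1)})$, i.e., amortized update time at least $\Omega(n^{\omega-2-o(1)})$, where $\omega$ is the matrix multiplication exponent. For combinatorial algorithms (assuming the Combinatorial BMM hypothesis), the lower bound improves to $\Omega(n^{1-o(1)})$ amortized update time.
   Context: All graphs are undirected and unweighted. An incremental graph is an $n$-vertex graph, initially given, that undergoes a sequence of edge insertions; a dynamic algorithm must, after each update, output a maximal independent set of the current graph (an independent set $I$ such that $I\cup\{x\}$ is not independent for any vertex $x\notin I$). The total update time is the total running time over the whole update sequence; the amortized update time is the total update time divided by the number of updates. An adversary generates the updates; it is adaptive if each next update may depend on the algorithm's previous outputs (as opposed to oblivious, where the sequence is fixed in advance). BMM hypothesis: every (possibly randomized) algorithm for $n\times n$ Boolean matrix multiplication requires $\Omega(n^{\omega-o(1)})$ time. Combinatorial BMM hypothesis: every combinatorial algorithm (informally, one not using fast matrix multiplication) for Boolean matrix multiplication requires $\Omega(n^{3-o(1)})$ time. *)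

theory Defs
  imports "HOL-Probability.Probability" "HOL-Library.Landau_Symbols"
begin

section \<open>Growth rates\<close>

text \<open>\<open>T = \<Omega>(n\<^bsup>e - o(1)\<^esup>)\<close>; the exponent may depend on \<open>n\<close> through a null sequence.\<close>

definition almost_Omega :: "(nat \<Rightarrow> real) \<Rightarrow> real \<Rightarrow> bool" where
  "almost_Omega T e \<longleftrightarrow>
     (\<exists>\<delta> :: nat \<Rightarrow> real. \<delta> \<in> o(\<lambda>_. 1) \<and> T \<in> \<Omega>(\<lambda>n. real n powr (e - \<delta> n)))"


section \<open>The matrix multiplication exponent\<close>

text \<open>Straight-line programs over the rationals. Each instruction appends one value to the list of
  values computed so far; the list initially holds the entries of the two input matrices. The
  length of a program is its number of arithmetic operations (constants are counted as well, which
  does not change the exponent).\<close>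

datatype slp_instr =
  SConst rat | SAdd nat nat | SSub nat nat | SMul nat nat

text \<open>A list lookup that is 0 out of range, so that no program can depend on an unspecified value.\<close>

definition entry :: "rat list \<Rightarrow> nat \<Rightarrow> rat" where
  "entry vs i = (if i < length vs then vs ! i else 0)"

fun slp_step :: "slp_instr \<Rightarrow> rat list \<Rightarrow> rat list" where
  "slp_step (SConst q) vs = vs @ [q]"
| "slp_step (SAdd i j) vs = vs @ [entry vs i + entry vs j]"
| "slp_step (SSub i j) vs = vs @ [entry vs i - entry vs j]"
| "slp_step (SMul i j) vs = vs @ [entry vs i * entry vs j]"

definition slp_multiplies :: "nat \<Rightarrow> slp_instr list \<Rightarrow> bool" where
  "slp_multiplies n P \<longleftrightarrow>
     (\<exists>pos :: nat \<Rightarrow> nat \<Rightarrow> nat. \<forall>A B :: nat \<Rightarrow> nat \<Rightarrow> rat.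
        let vs = fold slp_step P
                   (map (\<lambda>k. A (k div n) (k mod n)) [0..<n * n] @
                    map (\<lambda>k. B (k div n) (k mod n)) [0..<n * n])
        in \<forall>i<n. \<forall>j<n. pos i j < length vs \<and> vs ! pos i j = (\<Sum>k<n. A i k * B k j))"

definition mm_ops :: "nat \<Rightarrow> nat" where
  "mm_ops n = (LEAST l. \<exists>P. length P = l \<and> slp_multiplies n P)"

definition mm_exponent :: real where
  "mm_exponent = Inf {\<tau>. (\<lambda>n. real (mm_ops n)) \<in> O(\<lambda>n. real n powr \<tau>)}"


section \<open>A randomized word RAM\<close>

text \<open>Programs are structured programs over finitely many arrays of natural numbers, a notational
  variant of the word RAM with a single memory. The semantics carries a bound \<open>M\<close> on all
  values: as soon as a value \<open>\<ge> M\<close> is read or computed the program gets stuck. On inputs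
  of dimension \<open>n\<close> we take \<open>M = (n + 2) ^ c\<close> for a constant \<open>c\<close>, i.e. words of
  \<open>O(log n)\<close> bits. Without such a bound unit-cost arithmetic would be too powerful.\<close>

datatype binop = Plus | Minus | Times | Divide | Modulo | BitAnd | BitOr | BitXor | LessThan | Equals

fun apply_op :: "binop \<Rightarrow> nat \<Rightarrow> nat \<Rightarrow> nat" where
  "apply_op Plus x y = x + y"
| "apply_op Minus x y = x - y"
| "apply_op Times x y = x * y"
| "apply_op Divide x y = x div y"
| "apply_op Modulo x y = x mod y"
| "apply_op BitAnd x y = Bit_Operations.and x y"
| "apply_op BitOr x y = Bit_Operations.or x y"
| "apply_op BitXor x y = Bit_Operations.xor x y"
| "apply_op LessThan x y = of_bool (x < y)"
| "apply_op Equals x y = of_bool (x = y)"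

datatype aexp =
  Lit nat
| Read nat aexp  \<comment> \<open>\<open>Read a e\<close> is the \<open>e\<close>-th cell of array number \<open>a\<close>\<close>
| Op binop aexp aexp

text \<open>\<open>Call\<close> only occurs in reductions, where it calls an unspecified dynamic algorithm.\<close>

datatype proc = Init | Update

datatype com =
  Skip
| Store nat aexp aexp  \<comment> \<open>\<open>Store a i e\<close> writes the value of \<open>e\<close> into cell \<open>i\<close> of array \<open>a\<close>\<close>
| Flip nat aexp        \<comment> \<open>\<open>Flip a i\<close> writes a fresh random bit into cell \<open>i\<close> of array \<open>a\<close>\<close>
| Seq com com
| Cond aexp com com
| While aexp com
| Call proc

type_synonym memory = "nat \<Rightarrow> nat \<Rightarrow> nat"

text \<open>A state consists of the memory and the coin tosses that have not yet been used.\<close>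

type_synonym state = "memory \<times> bool stream"

definition word :: "nat \<Rightarrow> nat \<Rightarrow> nat option" where
  "word M v = (if v < M then Some v else None)"

fun aval :: "nat \<Rightarrow> memory \<Rightarrow> aexp \<Rightarrow> nat option" where
  "aval M \<mu> (Lit k) = word M k"
| "aval M \<mu> (Read a e) = Option.bind (aval M \<mu> e) (\<lambda>i. word M (\<mu> a i))"
| "aval M \<mu> (Op f e1 e2) =
     Option.bind (aval M \<mu> e1) (\<lambda>x. Option.bind (aval M \<mu> e2) (\<lambda>y. word M (apply_op f x y)))"

text \<open>\<open>exec M Q c s t s'\<close>: started in \<open>s\<close>, program \<open>c\<close> halts in \<open>s'\<close> after \<open>t\<close> steps, where
  \<open>Q\<close> describes the behaviour of calls. Evaluating an expression is charged as one step;
  as expressions are part of the fixed program text this affects running times only by a constant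
  factor.\<close>

inductive exec :: "nat \<Rightarrow> (proc \<Rightarrow> state \<Rightarrow> nat \<Rightarrow> state \<Rightarrow> bool)
    \<Rightarrow> com \<Rightarrow> state \<Rightarrow> nat \<Rightarrow> state \<Rightarrow> bool" for M Q where
  Skip: "exec M Q Skip s 1 s"
| Store: "aval M \<mu> e1 = Some i \<Longrightarrow> aval M \<mu> e2 = Some v \<Longrightarrow>
    exec M Q (Store a e1 e2) (\<mu>, \<omega>) 1 (\<mu>(a := (\<mu> a)(i := v)), \<omega>)"
| Flip: "aval M \<mu> e = Some i \<Longrightarrow>
    exec M Q (Flip a e) (\<mu>, \<omega>) 1 (\<mu>(a := (\<mu> a)(i := of_bool (shd \<omega>))), stl \<omega>)"
| Seq: "exec M Q c1 s t1 s1 \<Longrightarrow> exec M Q c2 s1 t2 s2 \<Longrightarrow> exec M Q (Seq c1 c2) s (t1 + t2) s2"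
| CondTrue: "aval M (fst s) e = Some v \<Longrightarrow> v \<noteq> 0 \<Longrightarrow> exec M Q c1 s t s' \<Longrightarrow>
    exec M Q (Cond e c1 c2) s (1 + t) s'"
| CondFalse: "aval M (fst s) e = Some 0 \<Longrightarrow> exec M Q c2 s t s' \<Longrightarrow>
    exec M Q (Cond e c1 c2) s (1 + t) s'"
| WhileFalse: "aval M (fst s) e = Some 0 \<Longrightarrow> exec M Q (While e c) s 1 s"
| WhileTrue: "aval M (fst s) e = Some v \<Longrightarrow> v \<noteq> 0 \<Longrightarrow> exec M Q c s t1 s1 \<Longrightarrow>
    exec M Q (While e c) s1 t2 s2 \<Longrightarrow> exec M Q (While e c) s (1 + t1 + t2) s2"
| Call: "Q p s t s' \<Longrightarrow> exec M Q (Call p) s t s'"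

definition no_calls :: "proc \<Rightarrow> state \<Rightarrow> nat \<Rightarrow> state \<Rightarrow> bool" where
  "no_calls p s t s' \<longleftrightarrow> False"

definition word_bound :: "nat \<Rightarrow> nat \<Rightarrow> nat" where
  "word_bound c n = (n + 2) ^ c"

definition coin_prob :: "(bool stream \<Rightarrow> bool) \<Rightarrow> real" where
  "coin_prob P = (let S = stream_space (measure_pmf (bernoulli_pmf (1 / 2)))
                  in measure S {\<omega> \<in> space S. P \<omega>})"

text \<open>Arrays 0 to 3 are used for input (0: scalars, 1 and 2: row-major matrices) and output (3).\<close>

definition interface :: "nat set" where
  "interface = {0, 1, 2, 3}"


section \<open>Boolean matrix multiplication\<close>

definition bmm_input :: "nat \<Rightarrow> (nat \<Rightarrow> nat \<Rightarrow> bool) \<Rightarrow> (nat \<Rightarrow> nat \<Rightarrow> bool) \<Rightarrow> memory" where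
  "bmm_input n A B = (\<lambda>a i.
     if a = 0 \<and> i = 0 then n
     else if a = 1 \<and> i < n * n then of_bool (A (i div n) (i mod n))
     else if a = 2 \<and> i < n * n then of_bool (B (i div n) (i mod n))
     else 0)"

definition bmm_output_correct ::
    "nat \<Rightarrow> (nat \<Rightarrow> nat \<Rightarrow> bool) \<Rightarrow> (nat \<Rightarrow> nat \<Rightarrow> bool) \<Rightarrow> memory \<Rightarrow> bool" where
  "bmm_output_correct n A B \<mu> \<longleftrightarrow>
     (\<forall>i<n. \<forall>j<n. \<mu> 3 (i * n + j) = of_bool (\<exists>k<n. A i k \<and> B k j))"

text \<open>Randomized algorithms: with probability at least 2/3 over the coin tosses the algorithm halts
  within the time bound with the correct result. Up to constant factors this covers deterministic,
  Monte Carlo and (by Markov's inequality) Las Vegas algorithms.\<close>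

definition solves_BMM :: "com \<Rightarrow> (nat \<Rightarrow> real) \<Rightarrow> bool" where
  "solves_BMM p T \<longleftrightarrow>
     (\<exists>c. \<forall>n A B. coin_prob (\<lambda>\<omega>. \<exists>t s'.
        exec (word_bound c n) no_calls p (bmm_input n A B, \<omega>) t s' \<and>
        bmm_output_correct n A B (fst s') \<and> real t \<le> T n) \<ge> 2 / 3)"

definition BMM_lower_bound :: "com set \<Rightarrow> real \<Rightarrow> bool" where
  "BMM_lower_bound \<A> e \<longleftrightarrow> (\<forall>p\<in>\<A>. \<forall>T. solves_BMM p T \<longrightarrow> almost_Omega T e)"

definition BMM_hypothesis :: bool where
  "BMM_hypothesis \<longleftrightarrow> BMM_lower_bound UNIV mm_exponent"


section \<open>Incremental graphs and maximal independent sets\<close>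

text \<open>Graphs have vertex set \<open>{..<n}\<close> and are given by their set of edges.\<close>

type_synonym graph = "nat set set"

definition all_edges :: "nat \<Rightarrow> graph" where
  "all_edges n = {{u, v} | u v. u < n \<and> v < n \<and> u \<noteq> v}"

definition independent_set :: "nat \<Rightarrow> graph \<Rightarrow> nat set \<Rightarrow> bool" where
  "independent_set n E I \<longleftrightarrow> I \<subseteq> {..<n} \<and> (\<forall>u\<in>I. \<forall>v\<in>I. {u, v} \<notin> E)"

definition is_MIS :: "nat \<Rightarrow> graph \<Rightarrow> nat set \<Rightarrow> bool" where
  "is_MIS n E I \<longleftrightarrow> independent_set n E I \<and>
     (\<forall>x\<in>{..<n} - I. \<not> independent_set n E (insert x I))"

text \<open>A dynamic algorithm consists of an initialization and an update procedure sharing the memory.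
  Initially array 1 holds the adjacency matrix of the initial graph. Before each update the
  endpoints of the inserted edge are placed in cells 1 and 2 of array 0. The current MIS is kept in
  array 3, as its size followed by its elements without repetition. It persists in memory between
  updates, so that only its changes have to be paid for.\<close>

datatype dyn_alg = Dyn (init_proc: com) (update_proc: com)

definition mis_input :: "nat \<Rightarrow> graph \<Rightarrow> memory" where
  "mis_input n E = (\<lambda>a i.
     if a = 0 \<and> i = 0 then n
     else if a = 1 \<and> i < n * n then of_bool ({i div n, i mod n} \<in> E)
     else 0)"

definition present_edge :: "nat \<Rightarrow> nat \<Rightarrow> state \<Rightarrow> state" where
  "present_edge u v s = ((fst s)(0 := (fst s 0)(1 := u, 2 := v)), snd s)"

definition out_list :: "state \<Rightarrow> nat list" where
  "out_list s = map (fst s 3) [1..<Suc (fst s 3 0)]"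

definition reports_MIS :: "nat \<Rightarrow> graph \<Rightarrow> state \<Rightarrow> bool" where
  "reports_MIS n E s \<longleftrightarrow> distinct (out_list s) \<and> is_MIS n E (set (out_list s))"

text \<open>An adaptive adversary chooses the next edge depending on all sets output so far; it stops by
  returning \<open>None\<close> or a pair that is not a new edge. For randomized algorithms it
  does not see the coin tosses.\<close>

type_synonym adversary = "nat set list \<Rightarrow> (nat \<times> nat) option"

definition next_edge :: "nat \<Rightarrow> adversary \<Rightarrow> graph \<Rightarrow> nat set list \<Rightarrow> (nat \<times> nat) option" where
  "next_edge n adv E h =
     (case adv h of None \<Rightarrow> None
      | Some (u, v) \<Rightarrow> if {u, v} \<in> all_edges n - E then Some (u, v) else None)"

text \<open>\<open>serves M D n adv E h s t m\<close>: from the current graph \<open>E\<close>, history \<open>h\<close> of outputs and machine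
  state \<open>s\<close> on, algorithm \<open>D\<close> handles the remaining \<open>m\<close> updates correctly in total time \<open>t\<close>.\<close>

inductive serves :: "nat \<Rightarrow> dyn_alg \<Rightarrow> nat \<Rightarrow> adversary
    \<Rightarrow> graph \<Rightarrow> nat set list \<Rightarrow> state \<Rightarrow> nat \<Rightarrow> nat \<Rightarrow> bool" for M D n adv where
  stop: "next_edge n adv E h = None \<Longrightarrow> serves M D n adv E h s 0 0"
| insertion: "next_edge n adv E h = Some (u, v) \<Longrightarrow>
    exec M no_calls (update_proc D) (present_edge u v s) t1 s' \<Longrightarrow>
    reports_MIS n (insert {u, v} E) s' \<Longrightarrow>
    serves M D n adv (insert {u, v} E) (h @ [set (out_list s')]) s' t2 m \<Longrightarrow>
    serves M D n adv E h s (t1 + t2) (Suc m)"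

text \<open>The whole interaction on initial graph \<open>E\<close>. The total time includes the
  initialization.\<close>

definition maintains_MIS :: "nat \<Rightarrow> dyn_alg \<Rightarrow> nat \<Rightarrow> graph \<Rightarrow> adversary
    \<Rightarrow> bool stream \<Rightarrow> nat \<Rightarrow> nat \<Rightarrow> bool" where
  "maintains_MIS M D n E adv \<omega> t m \<longleftrightarrow>
     (\<exists>t0 t1 s. exec M no_calls (init_proc D) (mis_input n E, \<omega>) t0 s \<and>
        reports_MIS n E s \<and> serves M D n adv E [set (out_list s)] s t1 m \<and> t = t0 + t1)"

definition MIS_total_time :: "dyn_alg \<Rightarrow> (nat \<Rightarrow> real) \<Rightarrow> bool" where
  "MIS_total_time D T \<longleftrightarrow>
     (\<exists>c. \<forall>n E adv. E \<subseteq> all_edges n \<longrightarrow>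
        coin_prob (\<lambda>\<omega>. \<exists>t m.
          maintains_MIS (word_bound c n) D n E adv \<omega> t m \<and> real t \<le> T n) \<ge> 2 / 3)"

text \<open>\<open>T n\<close> bounds the total time divided by the number \<open>m\<close> of updates on all runs with at least
  \<open>\<kappa> n\<^sup>2\<close> updates; correctness is required on all runs. Including shorter runs, which must pay
  for the initialization with few updates, would make lower bounds trivial.\<close>

definition MIS_amortized_time :: "real \<Rightarrow> dyn_alg \<Rightarrow> (nat \<Rightarrow> real) \<Rightarrow> bool" where
  "MIS_amortized_time \<kappa> D T \<longleftrightarrow>
     (\<exists>c. \<forall>n E adv. E \<subseteq> all_edges n \<longrightarrow>
        coin_prob (\<lambda>\<omega>. \<exists>t m.
          maintains_MIS (word_bound c n) D n E adv \<omega> t m \<and>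
          (real m \<ge> \<kappa> * (real n)\<^sup>2 \<and> m > 0 \<longrightarrow> real t / real m \<le> T n)) \<ge> 2 / 3)"


section \<open>Combinatorial algorithms\<close>

text \<open>``Combinatorial'' is not a formal notion. It is represented by an arbitrary pair of classes, \<open>\<B>\<close>
  of programs and \<open>\<D>\<close> of dynamic algorithms, about which only the following is assumed: a program
  that uses a combinatorial dynamic algorithm as a black box, and apart from this runs in time linear
  in the size of its input matrices, is combinatorial.\<close>

fun link :: "dyn_alg \<Rightarrow> com \<Rightarrow> com" where
  "link D (Call Init) = init_proc D"
| "link D (Call Update) = update_proc D"
| "link D (Seq c1 c2) = Seq (link D c1) (link D c2)"
| "link D (Cond e c1 c2) = Cond e (link D c1) (link D c2)"
| "link D (While e c) = While e (link D c)"
| "link D Skip = Skip"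
| "link D (Store a e1 e2) = Store a e1 e2"
| "link D (Flip a e) = Flip a e"

fun arrays_aexp :: "aexp \<Rightarrow> nat set" where
  "arrays_aexp (Lit k) = {}"
| "arrays_aexp (Read a e) = insert a (arrays_aexp e)"
| "arrays_aexp (Op f e1 e2) = arrays_aexp e1 \<union> arrays_aexp e2"

fun arrays :: "com \<Rightarrow> nat set" where
  "arrays Skip = {}"
| "arrays (Store a e1 e2) = insert a (arrays_aexp e1 \<union> arrays_aexp e2)"
| "arrays (Flip a e) = insert a (arrays_aexp e)"
| "arrays (Seq c1 c2) = arrays c1 \<union> arrays c2"
| "arrays (Cond e c1 c2) = arrays_aexp e \<union> arrays c1 \<union> arrays c2"
| "arrays (While e c) = arrays_aexp e \<union> arrays c"
| "arrays (Call p) = {}"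

text \<open>A call that takes one step and leaves arbitrary values in the interface arrays.\<close>

definition arbitrary_calls :: "proc \<Rightarrow> state \<Rightarrow> nat \<Rightarrow> state \<Rightarrow> bool" where
  "arbitrary_calls p s t s' \<longleftrightarrow> t = 1 \<and> (\<forall>a. a \<notin> interface \<longrightarrow> fst s' a = fst s a)"

text \<open>The reduction \<open>R\<close> shares only the interface arrays with \<open>D\<close>, and its own running time is linear
  however the calls behave.\<close>

definition linear_reduction :: "dyn_alg \<Rightarrow> com \<Rightarrow> bool" where
  "linear_reduction D R \<longleftrightarrow>
     arrays R \<inter> (arrays (init_proc D) \<union> arrays (update_proc D)) \<subseteq> interface \<and>
     (\<exists>K. \<forall>M n A B \<omega> t s'.
        exec M arbitrary_calls R (bmm_input n A B, \<omega>) t s' \<longrightarrow> t \<le> K * (n + 1)\<^sup>2)"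

definition combinatorial_classes :: "com set \<Rightarrow> dyn_alg set \<Rightarrow> bool" where
  "combinatorial_classes \<B> \<D> \<longleftrightarrow>
     (\<forall>D\<in>\<D>. \<forall>R. linear_reduction D R \<longrightarrow> link D R \<in> \<B>)"

definition Combinatorial_BMM_hypothesis :: "com set \<Rightarrow> bool" where
  "Combinatorial_BMM_hypothesis \<B> \<longleftrightarrow> BMM_lower_bound \<B> 3"

end

(*
  Boolean matrices A and B are multiplied by playing against the algorithm. Insert edges into the empty
  graph until it consists of cliques I, J, K for the rows of A, the columns of B and the summation
  indices, where i in I and k in K (j in J and k in K) are adjacent iff A i k (B k j) is false. A maximal
  independent set has at most one vertex in each clique. If it contains i and j, then by maximality it
  contains some k iff (A B) i j holds; record this and insert the edge ij. If it contains i and k but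
  no vertex of J, then for every j the edge ij has been inserted or jk is an edge, so inserting ik
  destroys no witness that is still needed; likewise for j and k. If it contains a single vertex, this
  vertex dominates I, J, K and no edge inside makes progress. Therefore two copies of the graph are used: if
  both contain a single vertex, insert the edge between these; all cross edges then join vertices that dominate
  their own copies, so they never interfere. When the set misses a copy, this copy is complete and the
  product is known. Finally all missing edges are inserted, so that there are N (N - 1) / 2 updates.
  Each update takes a step, hence the quadratic overhead of the reduction is absorbed by the running
  time of the dynamic algorithm.

  With N = 6 n + r vertices for six consecutive values of r, the lower bounds cover all large N.
*)

theory Submission
  imports Defs
begin

section \<open>Executions\<close>

text \<open>The opponent is an algorithm with hidden coins, while matrix multiplication must be done
  by one fixed program on a word RAM; this shapes the proof. The reduction tosses no coins of its
  own, so on every toss sequence it succeeds whenever the algorithm survives the interaction with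
  one particular adversary, the function of the output history that the reduction itself computes;
  no probability is lost. The algorithm is known only through runs on its own memory and with its
  own word bound, hence the reduction works in arrays that the algorithm never mentions, and runs
  are transported by framing and by monotonicity in the word bound. The amortized bound speaks only
  about runs with at least \<open>\<kappa> * n^2\<close> updates, for any
  \<open>\<kappa> < 1 / 2\<close>; this is why every missing edge is inserted at the end. The
  padding \<open>r\<close> starts at a threshold that depends on \<open>\<kappa>\<close>, because a
  bound for \<open>solves_BMM\<close> must hold at every dimension, 0 included:
  \<open>N \<ge> r\<close> makes all instances large enough.\<close>

lemma exec_Flip_eq: "aval M \<mu> e = Some i \<Longrightarrow> v = of_bool (shd \<omega>) \<Longrightarrow>
    exec M Q (Flip a e) (\<mu>, \<omega>) (Suc 0) (\<mu>(a := (\<mu> a)(i := v)), stl \<omega>)"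
  using exec.Flip by fastforce

lemmas exec_simplified_intros = exec.intros(1,2,4-)[simplified] exec_Flip_eq

lemma aval_mono: "aval M \<mu> e = Some v \<Longrightarrow> M \<le> M' \<Longrightarrow> aval M' \<mu> e = Some v"
  by (induction e arbitrary: v)
    (auto simp: word_def bind_eq_Some_conv split: if_splits)

text \<open>A larger word bound only removes reasons to get stuck. This lets a run of the dynamic
  algorithm, whose word bound is computed from \<open>N\<close>, count as a run under the larger
  bound of the reduction.\<close>

lemma exec_mono:
  assumes "exec M Q c s t s'" "M \<le> M'"
    and "\<And>p s t s'. Q p s t s' \<Longrightarrow> Q' p s t s'"
  shows "exec M' Q' c s t s'"
  using assms(1)
  by induction (auto intro: exec_simplified_intros aval_mono[OF _ assms(2)] assms(3))

lemma aval_cong: "(\<And>a. a \<in> arrays_aexp e \<Longrightarrow> \<mu> a = \<nu> a) \<Longrightarrow> aval M \<mu> e = aval M \<nu> e"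
  by (induction e) auto

text \<open>Arrays below \<open>b\<close> are the world of the dynamic algorithm, those from
  \<open>b\<close> on are private to the reduction.\<close>

definition join :: "nat \<Rightarrow> memory \<Rightarrow> memory \<Rightarrow> memory" where
  "join b \<mu> \<rho> = (\<lambda>a. if a < b then \<mu> a else \<rho> a)"

lemma aval_join: "arrays_aexp e \<subseteq> {..<b} \<Longrightarrow> aval M (join b \<mu> \<rho>) e = aval M \<mu> e"
  by (rule aval_cong) (auto simp: join_def)

lemma join_update:
  "a < b \<Longrightarrow> join b (\<mu>(a := (\<mu> a)(i := v))) \<rho> = (join b \<mu> \<rho>)(a := (join b \<mu> \<rho> a)(i := v))"
  by (auto simp: join_def)

text \<open>A frame rule: a program that mentions only arrays below \<open>b\<close> neither sees
  nor changes the others. It carries the algorithm's own run over to a memory that also holds the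
  data of the reduction.\<close>

lemma exec_join:
  assumes "exec M no_calls c s t s'" "arrays c \<subseteq> {..<b}"
  shows "exec M no_calls c (join b (fst s) \<rho>, snd s) t (join b (fst s') \<rho>, snd s')"
  using assms
proof induction
  case (Store \<mu> e1 i e2 v a \<omega>)
  then have "exec M no_calls (Store a e1 e2) (join b \<mu> \<rho>, \<omega>) 1
      ((join b \<mu> \<rho>)(a := (join b \<mu> \<rho> a)(i := v)), \<omega>)"
    by (intro exec.Store) (auto simp: aval_join)
  with Store show ?case by (simp add: join_update del: One_nat_def fun_upd_apply)
next
  case (Flip \<mu> e i a \<omega>)
  then have "exec M no_calls (Flip a e) (join b \<mu> \<rho>, \<omega>) 1
      ((join b \<mu> \<rho>)(a := (join b \<mu> \<rho> a)(i := of_bool (shd \<omega>))), stl \<omega>)"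
    by (intro exec.Flip) (auto simp: aval_join)
  with Flip show ?case by (simp add: join_update del: One_nat_def fun_upd_apply)
next
  case (Call p s t s')
  then show ?case by (simp add: no_calls_def)
qed (auto intro: exec_simplified_intros simp: aval_join)

definition calls_of :: "nat \<Rightarrow> dyn_alg \<Rightarrow> proc \<Rightarrow> state \<Rightarrow> nat \<Rightarrow> state \<Rightarrow> bool" where
  "calls_of M D p = exec M no_calls (case p of Init \<Rightarrow> init_proc D | Update \<Rightarrow> update_proc D)"

lemma exec_link: "exec M (calls_of M D) c s t s' \<Longrightarrow> exec M no_calls (link D c) s t s'"
proof (induction rule: exec.induct)
  case (Call p s t s')
  then show ?case by (cases p) (auto simp: calls_of_def)
qed (auto intro: exec_simplified_intros)

lemma exec_pos: "exec M no_calls c s t s' \<Longrightarrow> 1 \<le> t"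
  by (induction rule: exec.induct) (auto simp: no_calls_def)

section \<open>Finite use of the coins and measurability\<close>

text \<open>An execution looks at a finite prefix of the coin tosses only, hence events defined by
  executions are measurable.\<close>

definition depends_on_prefix :: "nat \<Rightarrow> nat \<Rightarrow> com \<Rightarrow> state \<Rightarrow> nat \<Rightarrow> state \<Rightarrow> bool" where
  "depends_on_prefix k M c s t s' \<longleftrightarrow> snd s' = sdrop k (snd s) \<and>
     (\<forall>\<omega>. stake k \<omega> = stake k (snd s) \<longrightarrow> exec M no_calls c (fst s, \<omega>) t (fst s', sdrop k \<omega>))"

text \<open>The first run consumes its prefix, so the second one starts reading where the first
  stopped and the prefix lengths add up.\<close>

lemma depends_on_prefix_trans:
  assumes "depends_on_prefix k1 M c1 s t1 s1" "depends_on_prefix k2 M c2 s1 t2 s2"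
    and "\<And>\<omega> \<omega>' \<omega>''. exec M no_calls c1 (fst s, \<omega>) t1 (fst s1, \<omega>') \<Longrightarrow>
      exec M no_calls c2 (fst s1, \<omega>') t2 (fst s2, \<omega>'') \<Longrightarrow> exec M no_calls c (fst s, \<omega>) t (fst s2, \<omega>'')"
  shows "depends_on_prefix (k1 + k2) M c s t s2"
  unfolding depends_on_prefix_def
proof (intro conjI allI impI)
  show "snd s2 = sdrop (k1 + k2) (snd s)"
    using assms(1,2) by (simp add: depends_on_prefix_def)
next
  fix \<omega> assume "stake (k1 + k2) \<omega> = stake (k1 + k2) (snd s)"
  then have "stake k1 \<omega> @ stake k2 (sdrop k1 \<omega>) = stake k1 (snd s) @ stake k2 (sdrop k1 (snd s))"
    by (simp only: stake_add)
  then have "stake k1 \<omega> = stake k1 (snd s) \<and> stake k2 (sdrop k1 \<omega>) = stake k2 (sdrop k1 (snd s))"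
    by (subst (asm) append_eq_append_conv) simp_all
  then have "stake k1 \<omega> = stake k1 (snd s)" "stake k2 (sdrop k1 \<omega>) = stake k2 (snd s1)"
    using assms(1) unfolding depends_on_prefix_def by simp_all
  then have "exec M no_calls c1 (fst s, \<omega>) t1 (fst s1, sdrop k1 \<omega>)"
    "exec M no_calls c2 (fst s1, sdrop k1 \<omega>) t2 (fst s2, sdrop k2 (sdrop k1 \<omega>))"
    using assms(1,2) unfolding depends_on_prefix_def by blast+
  from assms(3)[OF this] show "exec M no_calls c (fst s, \<omega>) t (fst s2, sdrop (k1 + k2) \<omega>)"
    by simp
qed

lemma depends_on_prefix_imp:
  assumes "depends_on_prefix k M c s t s'"
    and "\<And>\<omega> \<omega>'. exec M no_calls c (fst s, \<omega>) t (fst s', \<omega>') \<Longrightarrow>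
      exec M no_calls c' (fst s, \<omega>) t' (fst s', \<omega>')"
  shows "depends_on_prefix k M c' s t' s'"
  using assms unfolding depends_on_prefix_def by blast

lemma depends_on_prefix_0:
  assumes "\<And>\<omega>. exec M no_calls c (\<mu>, \<omega>) t (\<mu>', \<omega>)"
  shows "depends_on_prefix 0 M c (\<mu>, \<omega>) t (\<mu>', \<omega>)"
  using assms unfolding depends_on_prefix_def fst_conv snd_conv sdrop.simps by blast

lemma exec_depends_on_prefix:
  "exec M no_calls c s t s' \<Longrightarrow> \<exists>k. depends_on_prefix k M c s t s'"
proof (induction rule: exec.induct)
  case (Skip s)
  show ?case using depends_on_prefix_0[OF exec.Skip] by (metis prod.collapse)
next
  case (Store \<mu> e1 i e2 v a \<omega>)
  show ?case using depends_on_prefix_0[OF exec.Store[OF Store]] ..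
next
  case (Flip \<mu> e i a \<omega>)
  have "exec M no_calls (Flip a e) (\<mu>, \<omega>') 1 (\<mu>(a := (\<mu> a)(i := of_bool (shd \<omega>))), stl \<omega>')"
    if "shd \<omega>' = shd \<omega>" for \<omega>'
    using exec.Flip[OF Flip, of no_calls a \<omega>'] unfolding that .
  note flip = this
  have "depends_on_prefix 1 M (Flip a e) (\<mu>, \<omega>) 1
      (\<mu>(a := (\<mu> a)(i := of_bool (shd \<omega>))), stl \<omega>)"
    unfolding depends_on_prefix_def fst_conv snd_conv
  proof (intro conjI allI impI)
    fix \<omega>' assume "stake 1 \<omega>' = stake 1 \<omega>"
    then have "shd \<omega>' = shd \<omega>" by simp
    moreover have "sdrop 1 \<omega>' = stl \<omega>'" by simp
    ultimately show "exec M no_calls (Flip a e) (\<mu>, \<omega>') 1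
        (\<mu>(a := (\<mu> a)(i := of_bool (shd \<omega>))), sdrop 1 \<omega>')"
      using flip by (simp only:)
  qed simp
  then show ?case ..
next
  case (Seq c1 s t1 s1 c2 t2 s2)
  from Seq.IH show ?case
    by (elim exE) (rule exI, erule (1) depends_on_prefix_trans, rule exec.Seq)
next
  case (CondTrue s e v c1 t s' c2)
  from CondTrue.IH obtain k where "depends_on_prefix k M c1 s t s'" ..
  then have "depends_on_prefix k M (Cond e c1 c2) s (1 + t) s'"
    by (rule depends_on_prefix_imp) (rule exec.CondTrue, use CondTrue.hyps in simp_all)
  then show ?case ..
next
  case (CondFalse s e c2 t s' c1)
  from CondFalse.IH obtain k where "depends_on_prefix k M c2 s t s'" ..
  then have "depends_on_prefix k M (Cond e c1 c2) s (1 + t) s'"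
    by (rule depends_on_prefix_imp) (rule exec.CondFalse, use CondFalse.hyps in simp_all)
  then show ?case ..
next
  case (WhileFalse s e c)
  then have "exec M no_calls (While e c) (fst s, \<omega>) 1 (fst s, \<omega>)" for \<omega>
    by (intro exec.WhileFalse) simp
  from depends_on_prefix_0[OF this] show ?case by (metis prod.collapse)
next
  case (WhileTrue s e v c t1 s1 t2 s2)
  from WhileTrue.IH obtain k1 k2 where "depends_on_prefix k1 M c s t1 s1"
    "depends_on_prefix k2 M (While e c) s1 t2 s2" by (elim exE)
  then have "depends_on_prefix (k1 + k2) M (While e c) s (1 + t1 + t2) s2"
    by (rule depends_on_prefix_trans) (rule exec.WhileTrue, use WhileTrue.hyps in simp_all)
  then show ?case ..
next
  case (Call p s t s')
  then show ?case by (simp add: no_calls_def)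
qed

text \<open>Monotonicity of a finite measure asks only for measurability of the larger event, so
  \<open>P\<close> may be any predicate. The larger event is a countable union, over the prefix
  length, of preimages under \<open>stake\<close>.\<close>

lemma coin_prob_exec_mono:
  assumes "\<And>\<omega>. P \<omega> \<Longrightarrow> \<exists>t s'. exec M no_calls c (\<mu>, \<omega>) t s' \<and> R t (fst s')"
  shows "coin_prob P \<le> coin_prob (\<lambda>\<omega>. \<exists>t s'. exec M no_calls c (\<mu>, \<omega>) t s' \<and> R t (fst s'))"
proof -
  let ?S = "stream_space (measure_pmf (bernoulli_pmf (1 / 2)))"
  let ?R = "\<lambda>\<omega>. \<exists>t s'. exec M no_calls c (\<mu>, \<omega>) t s' \<and> R t (fst s')"
  \<comment> \<open>The finite toss sequences that already force the event, whatever tosses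
    follow.\<close>
  define L where "L = {xs. \<forall>\<omega>. stake (length xs) \<omega> = xs \<longrightarrow> ?R \<omega>}"
  have R_iff: "?R \<omega> \<longleftrightarrow> (\<exists>k. stake k \<omega> \<in> L)" for \<omega>
  proof
    assume "?R \<omega>"
    then obtain t s' where "exec M no_calls c (\<mu>, \<omega>) t s'" "R t (fst s')" by blast
    moreover from this(1)[THEN exec_depends_on_prefix] obtain k where
      "depends_on_prefix k M c (\<mu>, \<omega>) t s'" ..
    then have "\<And>\<omega>'. stake k \<omega>' = stake k \<omega> \<Longrightarrow> exec M no_calls c (\<mu>, \<omega>') t (fst s', sdrop k \<omega>')"
      by (simp add: depends_on_prefix_def)
    ultimately have "?R \<omega>'" if "stake k \<omega>' = stake k \<omega>" for \<omega>'
      using that by fastforce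
    then have "stake k \<omega> \<in> L" by (auto simp: L_def)
    then show "\<exists>k. stake k \<omega> \<in> L" ..
  next
    assume "\<exists>k. stake k \<omega> \<in> L"
    then obtain k where "stake k \<omega> \<in> L" ..
    then have "stake (length (stake k \<omega>)) \<omega> = stake k \<omega> \<longrightarrow> ?R \<omega>"
      unfolding L_def by blast
    then show "?R \<omega>" by simp
  qed
  have "{\<omega> \<in> space ?S. ?R \<omega>} = (\<Union>k. stake k -` L \<inter> space ?S)"
    unfolding R_iff by auto
  also have "\<dots> \<in> sets ?S"
  proof (intro sets.countable_UN)
    have "stake k -` L \<inter> space ?S \<in> sets ?S" for k
      by (rule measurable_sets[of _ _ "count_space UNIV"])
         (auto intro!: measurable_stake)
    then show "range (\<lambda>k. stake k -` L \<inter> space ?S) \<subseteq> sets ?S" by auto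
  qed
  finally have meas: "{\<omega> \<in> space ?S. ?R \<omega>} \<in> sets ?S" .
  interpret prob_space ?S
    by (rule prob_space.prob_space_stream_space) (rule measure_pmf.prob_space_axioms)
  show ?thesis unfolding coin_prob_def Let_def
    by (rule finite_measure_mono[OF _ meas]) (use assms in auto)
qed

section \<open>Running times that hold however calls behave\<close>

fun writes :: "com \<Rightarrow> nat set" where
  "writes (Store a e1 e2) = {a}"
| "writes (Flip a e) = {a}"
| "writes (Seq c1 c2) = writes c1 \<union> writes c2"
| "writes (Cond e c1 c2) = writes c1 \<union> writes c2"
| "writes (While e c) = writes c"
| "writes _ = {}"

lemma exec_unchanged:
  assumes "exec M arbitrary_calls c s t s'" "a \<notin> writes c" "a \<notin> interface"
  shows "fst s' a = fst s a"
  using assms by induction (auto simp: arbitrary_calls_def)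

fun loop_free :: "com \<Rightarrow> bool" where
  "loop_free (Seq c1 c2) \<longleftrightarrow> loop_free c1 \<and> loop_free c2"
| "loop_free (Cond e c1 c2) \<longleftrightarrow> loop_free c1 \<and> loop_free c2"
| "loop_free (While e c) \<longleftrightarrow> False"
| "loop_free _ \<longleftrightarrow> True"

text \<open>Adding both branches of a conditional is a crude bound for their maximum. A call counts
  as one step, as in \<open>arbitrary_calls\<close>; the value for \<open>While\<close> is a
  dummy.\<close>

fun cost :: "com \<Rightarrow> nat" where
  "cost (Seq c1 c2) = cost c1 + cost c2"
| "cost (Cond e c1 c2) = 1 + cost c1 + cost c2"
| "cost _ = 1"

lemma exec_cost: "exec M arbitrary_calls c s t s' \<Longrightarrow> loop_free c \<Longrightarrow> t \<le> cost c"
  by (induction rule: exec.induct) (auto simp: arbitrary_calls_def)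

text \<open>The state \<open>s0\<close> pins down every cell of array \<open>b\<close> except the
  counter. As the body does not write to \<open>b\<close> and calls cannot reach it, the loop bound
  stays at most \<open>X\<close> and the counter grows by one per round. A round costs the body, the
  test and the increment, hence \<open>cost c + 2\<close>.\<close>

lemma counting_loop_cost:
  assumes "exec M arbitrary_calls (While (Op LessThan (Read b (Lit 0)) e)
      (Seq c (Store b (Lit 0) (Op Plus (Read b (Lit 0)) (Lit 1))))) s t s'"
    and e: "\<And>s k v. fst s b = (fst s0 b)(0 := k) \<Longrightarrow> aval M (fst s) e = Some v \<Longrightarrow> v \<le> X"
    and c: "loop_free c" "b \<notin> writes c" "b \<notin> interface"
    and "\<exists>k. fst s b = (fst s0 b)(0 := k)"
  shows "t \<le> (X - fst s b 0) * (cost c + 2) + 1 \<and> (\<exists>k. fst s' b = (fst s0 b)(0 := k))"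
  using assms(1) assms(6)
proof (induction "While (Op LessThan (Read b (Lit 0)) e)
      (Seq c (Store b (Lit 0) (Op Plus (Read b (Lit 0)) (Lit 1))))" s t s' rule: exec.induct)
  case (WhileFalse s)
  then show ?case by simp
next
  case (WhileTrue s v t1 s1 t2 s2)
  from WhileTrue.hyps(3) obtain ta sa where 1: "exec M arbitrary_calls c s ta sa"
    and 2: "fst s1 b = (fst sa b)(0 := Suc (fst sa b 0))" "t1 = ta + 1"
    by (fastforce elim!: exec.cases[of _ _ "Seq _ _"] exec.cases[of _ _ "Store _ _ _"]
      simp: word_def bind_eq_Some_conv split: if_splits)
  have 3: "fst sa b = fst s b" using exec_unchanged[OF 1 c(2,3)] .
  have 4: "ta \<le> cost c" using exec_cost[OF 1 c(1)] .
  obtain k where k: "fst s b = (fst s0 b)(0 := k)" using WhileTrue.prems by blast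
  from WhileTrue.hyps(1,2) obtain x where "aval M (fst s) e = Some x" "fst s b 0 < x"
    by (auto simp: word_def bind_eq_Some_conv split: if_splits)
  with e k have lt: "fst s b 0 < X" by fastforce
  have "\<exists>k. fst s1 b = (fst s0 b)(0 := k)" using 2 3 k by auto
  with WhileTrue.hyps(5) have
    IH: "t2 \<le> (X - fst s1 b 0) * (cost c + 2) + 1" "\<exists>k. fst s2 b = (fst s0 b)(0 := k)"
    by auto
  have "X - fst s b 0 = Suc (X - fst s1 b 0)" using lt 2 3 by simp
  then show ?case using IH 2 4 by simp
qed

section \<open>The game against a maximal independent set\<close>

type_synonym bool_matrix = "nat \<Rightarrow> nat \<Rightarrow> bool"

text \<open>Vertex \<open>x\<close> belongs to part \<open>x mod 3\<close> of side \<open>x mod 6 div 3\<close> and stands for the index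
  \<open>x div 6\<close>; parts 0, 1, 2 are the rows of \<open>A\<close>, the columns of \<open>B\<close> and the
  summation indices.\<close>

definition side :: "nat \<Rightarrow> nat" where "side x = x mod 6 div 3"

definition part :: "nat \<Rightarrow> nat" where "part x = x mod 3"

text \<open>Deliberately asymmetric between the parts: all ordered pairs will be visited, so an edge
  is inserted as soon as one orientation is wanted.\<close>

definition wanted :: "bool_matrix \<Rightarrow> bool_matrix \<Rightarrow> nat \<Rightarrow> nat \<Rightarrow> bool" where
  "wanted A B u v \<longleftrightarrow> side u = side v \<and>
     (part u = part v \<or> part u = 0 \<and> part v = 2 \<and> \<not> A (u div 6) (v div 6)
       \<or> part u = 1 \<and> part v = 2 \<and> \<not> B (v div 6) (u div 6))"

text \<open>The slots describe a set with at most one vertex in each of the six classes modulo 6: the slot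
  is the successor of that vertex, and 0 if there is none.\<close>

definition slot :: "nat set \<Rightarrow> nat \<Rightarrow> nat" where
  "slot I p = (\<Sum>x\<in>I. if x mod 6 = p then Suc x else 0)"

text \<open>The order of the tests matters: a pair with a summation vertex is taken only if the set
  misses the rows or the columns of this side. Slots of present vertices are positive, so
  \<open>(0, 0)\<close> unambiguously means that there is no pair.\<close>

definition side_pick :: "(nat \<Rightarrow> nat) \<Rightarrow> nat \<Rightarrow> nat \<times> nat" where
  "side_pick f s = (if f s \<noteq> 0 \<and> f (s + 1) \<noteq> 0 then (f s, f (s + 1))
     else if f s \<noteq> 0 \<and> f (s + 2) \<noteq> 0 then (f s, f (s + 2))
     else if f (s + 1) \<noteq> 0 \<and> f (s + 2) \<noteq> 0 then (f (s + 1), f (s + 2)) else (0, 0))"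

text \<open>Once no side supplies a pair, each side has at most one nonzero slot, so the sum of its
  three slots is the slot of its only vertex, or 0 if the side is missed.\<close>

definition slots_pick :: "(nat \<Rightarrow> nat) \<Rightarrow> nat \<times> nat" where
  "slots_pick f = (if fst (side_pick f 0) \<noteq> 0 then side_pick f 0
     else if fst (side_pick f 3) \<noteq> 0 then side_pick f 3
     else if f 0 + f 1 + f 2 \<noteq> 0 \<and> f 3 + f 4 + f 5 \<noteq> 0 then (f 0 + f 1 + f 2, f 3 + f 4 + f 5)
     else (0, 0))"

definition found :: "(nat \<Rightarrow> nat) \<Rightarrow> (nat \<times> nat) set" where
  "found f = {((f s - 1) div 6, (f (s + 1) - 1) div 6) | s.
     (s = 0 \<or> s = 3) \<and> f s \<noteq> 0 \<and> f (s + 1) \<noteq> 0 \<and> f (s + 2) \<noteq> 0}"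

text \<open>Truncated subtraction leaves \<open>(0, 0)\<close> as it is. Equal components thus
  signal that no edge is to be inserted, a convention shared by all phases.\<close>

definition game_pick :: "nat set \<Rightarrow> nat \<times> nat" where
  "game_pick I = (fst (slots_pick (slot I)) - 1, snd (slots_pick (slot I)) - 1)"

section \<open>The pairs that the strategy chooses\<close>

lemma slot_eq_0: "finite I \<Longrightarrow> slot I p = 0 \<longleftrightarrow> (\<forall>x\<in>I. x mod 6 \<noteq> p)"
  by (simp add: slot_def)

lemma slot_eq_Suc:
  assumes "finite I" "inj_on (\<lambda>x. x mod 6) I"
    and "slot I p \<noteq> 0"
  shows "\<exists>x\<in>I. x mod 6 = p \<and> slot I p = Suc x"
proof -
  obtain x where x: "x \<in> I" "x mod 6 = p"
    using assms(3) slot_eq_0[OF assms(1), of p] by auto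
  have "y mod 6 = p \<longleftrightarrow> y = x" if "y \<in> I" for y
    using inj_onD[OF assms(2) _ that x(1)] x(2) by metis
  then have "slot I p = (\<Sum>y\<in>I. if y = x then Suc y else 0)"
    unfolding slot_def by (intro sum.cong refl) (simp only:)
  also have "\<dots> = Suc x" using x assms(1) by (subst sum.delta) simp_all
  finally show ?thesis using x by blast
qed

lemma mod6_eq: "x mod 6 = 3 * side x + part x"
proof -
  have "x mod 6 mod 3 = x mod 3" by (rule mod_mod_cancel) simp
  then show ?thesis unfolding side_def part_def by (metis mult_div_mod_eq)
qed

lemma part_less3: "part x < 3"
  by (simp add: part_def)

lemma side_less2: "side x < 2"
proof -
  have "x mod 6 < 6" by simp
  then show ?thesis unfolding mod6_eq by linarith
qed

lemma side_less: "side x = 0 \<or> side x = 1"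
  using side_less2[of x] by linarith

lemma part_less: "part x = 0 \<or> part x = 1 \<or> part x = 2"
  using part_less3[of x] by linarith

lemma mod6_eqI: "p < 3 \<Longrightarrow> x mod 6 = 3 * s + p \<longleftrightarrow> side x = s \<and> part x = p"
proof -
  assume p: "p < 3"
  have "a = s \<and> b = p" if "3 * a + b = 3 * s + p" "b < 3" for a b :: nat
  proof -
    have "\<not> a < s" "\<not> s < a" using that p by linarith+
    then have "a = s" by simp
    then show ?thesis using that(1) by simp
  qed
  from this[of "side x" "part x"] show ?thesis using mod6_eq[of x] part_less3[of x] by metis
qed

lemma mod6_eq_iff: "x mod 6 = y mod 6 \<longleftrightarrow> side x = side y \<and> part x = part y"
  unfolding mod6_eq[of y] by (rule mod6_eqI) (rule part_less3)

text \<open>What the invariant proof needs to know about a chosen pair, freed from slot arithmetic.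
  The row-column case carries no condition on the summation vertices: if one is present, the entry
  is recorded in the same step.\<close>

definition game_case :: "nat set \<Rightarrow> nat \<Rightarrow> nat \<Rightarrow> bool" where
  "game_case I u v \<longleftrightarrow>
     u \<in> I \<and> v \<in> I \<and> u \<noteq> v \<and>
       (side u = side v \<and> part u = 0 \<and> part v = 1 \<or>
        side u = side v \<and> part u = 0 \<and> part v = 2 \<and> (\<forall>x\<in>I. side x = side u \<longrightarrow> part x \<noteq> 1) \<or>
        side u = side v \<and> part u = 1 \<and> part v = 2 \<and> (\<forall>x\<in>I. side x = side u \<longrightarrow> part x \<noteq> 0) \<or>
        side u = 0 \<and> side v = 1 \<and> (\<forall>x\<in>I. x = u \<or> x = v))"

lemma slot_vertex:
  assumes "finite I" "inj_on (\<lambda>x. x mod 6) I"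
    and "s < 2" "p < 3"
  shows "slot I (3 * s + p) = 0 \<and> (\<forall>x\<in>I. \<not> (side x = s \<and> part x = p)) \<or>
    (\<exists>x\<in>I. side x = s \<and> part x = p \<and> slot I (3 * s + p) = Suc x)"
proof -
  note mod6 = mod6_eqI[OF assms(4)]
  show ?thesis
  proof (cases "slot I (3 * s + p) = 0")
    case True
    with slot_eq_0[OF assms(1), of "3 * s + p", unfolded mod6] show ?thesis by blast
  next
    case False
    have "\<exists>x\<in>I. x mod 6 = 3 * s + p \<and> slot I (3 * s + p) = Suc x"
      by (rule slot_eq_Suc[OF assms(1,2)]) (rule False)
    then show ?thesis unfolding mod6 by blast
  qed
qed

text \<open>Two nonzero slots give a pair; otherwise the side has at most one vertex, by injectivity
  modulo 6, and the sum of the slots reveals it. The proof runs through the patterns of empty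
  slots.\<close>

lemma side_pick_cases:
  assumes "finite I" "inj_on (\<lambda>x. x mod 6) I" and s: "s < 2"
  shows "(\<exists>u v. side_pick (slot I) (3 * s) = (Suc u, Suc v) \<and> game_case I u v) \<or>
    side_pick (slot I) (3 * s) = (0, 0) \<and>
      ((\<forall>x\<in>I. side x \<noteq> s) \<and> slot I (3 * s) + slot I (3 * s + 1) + slot I (3 * s + 2) = 0 \<or>
       (\<exists>u\<in>I. side u = s \<and> (\<forall>x\<in>I. side x = s \<longrightarrow> x = u) \<and>
          slot I (3 * s) + slot I (3 * s + 1) + slot I (3 * s + 2) = Suc u))"
proof -
  have unique: "x = y" if "x \<in> I" "y \<in> I" "side x = side y" "part x = part y" for x y
  proof -
    have "x mod 6 = y mod 6" unfolding mod6_eq_iff using that(3,4) by (rule conjI)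
    from inj_onD[OF assms(2) this that(1,2)] show ?thesis .
  qed
  define a b c where "a = slot I (3 * s)" and "b = slot I (3 * s + 1)" and "c = slot I (3 * s + 2)"
  note defs = a_def[symmetric] b_def[symmetric] c_def[symmetric]
  note V = slot_vertex[OF assms(1,2) s]
  have a: "(a = 0 \<and> (\<forall>x\<in>I. \<not> (side x = s \<and> part x = 0))) \<or>
      (\<exists>x\<in>I. side x = s \<and> part x = 0 \<and> a = Suc x)"
    using V[of 0] unfolding a_def add_0_right by simp
  have b: "(b = 0 \<and> (\<forall>x\<in>I. \<not> (side x = s \<and> part x = 1))) \<or>
      (\<exists>x\<in>I. side x = s \<and> part x = 1 \<and> b = Suc x)"
    unfolding b_def by (rule V) simp
  have c: "(c = 0 \<and> (\<forall>x\<in>I. \<not> (side x = s \<and> part x = 2))) \<or>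
      (\<exists>x\<in>I. side x = s \<and> part x = 2 \<and> c = Suc x)"
    unfolding c_def by (rule V) simp
  define p where "p = (if a \<noteq> 0 \<and> b \<noteq> 0 then (a, b)
     else if a \<noteq> 0 \<and> c \<noteq> 0 then (a, c) else if b \<noteq> 0 \<and> c \<noteq> 0 then (b, c) else (0, 0))"
  have pick: "side_pick (slot I) (3 * s) = p"
    unfolding side_pick_def defs p_def ..
  let ?goal = "(\<exists>u v. p = (Suc u, Suc v) \<and> game_case I u v) \<or>
    p = (0, 0) \<and> ((\<forall>x\<in>I. side x \<noteq> s) \<and> a + b + c = 0 \<or>
      (\<exists>u\<in>I. side u = s \<and> (\<forall>x\<in>I. side x = s \<longrightarrow> x = u) \<and> a + b + c = Suc u))"
  have a0: "part y \<noteq> 0" if "a = 0" "y \<in> I" "side y = s" for y using a that by auto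
  have b0: "part y \<noteq> 1" if "b = 0" "y \<in> I" "side y = s" for y using b that by auto
  have c0: "part y \<noteq> 2" if "c = 0" "y \<in> I" "side y = s" for y using c that by auto
  \<comment> \<open>Covers both patterns with a row and a column, whether or not the third slot is
    empty.\<close>
  have ab: ?goal if 0: "a \<noteq> 0" "b \<noteq> 0"
  proof -
    from 0 obtain x y where x: "x \<in> I" "side x = s" "part x = 0" "a = Suc x"
      and y: "y \<in> I" "side y = s" "part y = 1" "b = Suc y" using a b by auto
    have "game_case I x y" using x y by (auto simp: game_case_def)
    then show ?goal using 0 x(4) y(4) by (simp add: p_def)
  qed
  have ?goal
  proof (cases "a = 0"; cases "b = 0"; cases "c = 0")
    assume 0: "a = 0" "b = 0" "c = 0"
    have "side x \<noteq> s" if "x \<in> I" for x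
      using part_less[of x] a0[OF 0(1) that] b0[OF 0(2) that] c0[OF 0(3) that] by auto
    then show ?goal using 0 by (simp add: p_def)
  next
    assume 0: "a = 0" "b = 0" "c \<noteq> 0"
    then obtain x where x: "x \<in> I" "side x = s" "part x = 2" "c = Suc x" using c by auto
    have "y = x" if "y \<in> I" "side y = s" for y
      using part_less[of y] a0[OF 0(1) that] b0[OF 0(2) that] unique[OF that(1) x(1)] that(2) x by simp
    then have "\<forall>y\<in>I. side y = s \<longrightarrow> y = x" by blast
    moreover have "a + b + c = Suc x" using 0 x(4) by simp
    ultimately have "\<exists>u\<in>I. side u = s \<and> (\<forall>x\<in>I. side x = s \<longrightarrow> x = u) \<and> a + b + c = Suc u"
      using x(1,2) by blast
    then show ?goal using 0 by (simp add: p_def)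
  next
    assume 0: "a = 0" "b \<noteq> 0" "c = 0"
    then obtain x where x: "x \<in> I" "side x = s" "part x = 1" "b = Suc x" using b by auto
    have "y = x" if "y \<in> I" "side y = s" for y
      using part_less[of y] a0[OF 0(1) that] c0[OF 0(3) that] unique[OF that(1) x(1)] that(2) x by simp
    then have "\<forall>y\<in>I. side y = s \<longrightarrow> y = x" by blast
    moreover have "a + b + c = Suc x" using 0 x(4) by simp
    ultimately have "\<exists>u\<in>I. side u = s \<and> (\<forall>x\<in>I. side x = s \<longrightarrow> x = u) \<and> a + b + c = Suc u"
      using x(1,2) by blast
    then show ?goal using 0 by (simp add: p_def)
  next
    assume 0: "a \<noteq> 0" "b = 0" "c = 0"
    then obtain x where x: "x \<in> I" "side x = s" "part x = 0" "a = Suc x" using a by auto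
    have "y = x" if "y \<in> I" "side y = s" for y
      using part_less[of y] b0[OF 0(2) that] c0[OF 0(3) that] unique[OF that(1) x(1)] that(2) x by simp
    then have "\<forall>y\<in>I. side y = s \<longrightarrow> y = x" by blast
    moreover have "a + b + c = Suc x" using 0 x(4) by simp
    ultimately have "\<exists>u\<in>I. side u = s \<and> (\<forall>x\<in>I. side x = s \<longrightarrow> x = u) \<and> a + b + c = Suc u"
      using x(1,2) by blast
    then show ?goal using 0 by (simp add: p_def)
  next
    assume 0: "a = 0" "b \<noteq> 0" "c \<noteq> 0"
    then obtain x y where x: "x \<in> I" "side x = s" "part x = 1" "b = Suc x"
      and y: "y \<in> I" "side y = s" "part y = 2" "c = Suc y" using b c by auto
    have "game_case I x y" using x y 0 a by (auto simp: game_case_def)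
    then show ?goal using 0 x(4) y(4) by (simp add: p_def)
  next
    assume 0: "a \<noteq> 0" "b = 0" "c \<noteq> 0"
    then obtain x y where x: "x \<in> I" "side x = s" "part x = 0" "a = Suc x"
      and y: "y \<in> I" "side y = s" "part y = 2" "c = Suc y" using a c by auto
    have "game_case I x y" using x y 0 b by (auto simp: game_case_def)
    then show ?goal using 0 x(4) y(4) by (simp add: p_def)
  qed (rule ab; assumption)+
  then show ?thesis unfolding pick defs .
qed

text \<open>If neither side supplies a pair and neither is missed, each has exactly one vertex, and
  these two form the cross pair of the last kind in \<open>game_case\<close>. So a refusal to choose
  exposes a missed side.\<close>

lemma game_pick_cases:
  assumes "finite I" "inj_on (\<lambda>x. x mod 6) I"
  shows "(\<exists>u v. game_pick I = (u, v) \<and> game_case I u v) \<or>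
    game_pick I = (0, 0) \<and> (\<exists>s<2. \<forall>x\<in>I. side x \<noteq> s)"
proof -
  let ?f = "slot I"
  note defs = game_pick_def slots_pick_def
  have s0: "(\<exists>u v. side_pick ?f 0 = (Suc u, Suc v) \<and> game_case I u v) \<or>
    side_pick ?f 0 = (0, 0) \<and>
      ((\<forall>x\<in>I. side x \<noteq> 0) \<and> ?f 0 + ?f 1 + ?f 2 = 0 \<or>
       (\<exists>u\<in>I. side u = 0 \<and> (\<forall>x\<in>I. side x = 0 \<longrightarrow> x = u) \<and> ?f 0 + ?f 1 + ?f 2 = Suc u))"
    using side_pick_cases[OF assms, of 0] by (simp add: numeral_2_eq_2)
  have s1: "(\<exists>u v. side_pick ?f 3 = (Suc u, Suc v) \<and> game_case I u v) \<or>
    side_pick ?f 3 = (0, 0) \<and>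
      ((\<forall>x\<in>I. side x \<noteq> 1) \<and> ?f 3 + ?f 4 + ?f 5 = 0 \<or>
       (\<exists>u\<in>I. side u = 1 \<and> (\<forall>x\<in>I. side x = 1 \<longrightarrow> x = u) \<and> ?f 3 + ?f 4 + ?f 5 = Suc u))"
    using side_pick_cases[OF assms, of 1] by simp
  show ?thesis
  proof (cases "\<exists>u v. side_pick ?f 0 = (Suc u, Suc v) \<and> game_case I u v")
    case True
    then obtain u v where "side_pick ?f 0 = (Suc u, Suc v)" "game_case I u v" by blast
    then show ?thesis by (simp add: defs)
  next
    case no0: False
    then have p0: "side_pick ?f 0 = (0, 0)" using s0 by argo
    show ?thesis
    proof (cases "\<exists>u v. side_pick ?f 3 = (Suc u, Suc v) \<and> game_case I u v")
      case True
      then obtain u v where "side_pick ?f 3 = (Suc u, Suc v)" "game_case I u v" by blast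
      then show ?thesis using p0 by (simp add: defs)
    next
      case no1: False
      then have p1: "side_pick ?f 3 = (0, 0)" using s1 by argo
      show ?thesis
      proof (cases "(\<forall>x\<in>I. side x \<noteq> 0) \<and> ?f 0 + ?f 1 + ?f 2 = 0 \<or>
          (\<forall>x\<in>I. side x \<noteq> 1) \<and> ?f 3 + ?f 4 + ?f 5 = 0")
        case True
        then have "game_pick I = (0, 0)" using p0 p1 by (auto simp: defs)
        moreover have "\<exists>s<2. \<forall>x\<in>I. side x \<noteq> s"
          using True by (metis pos2 one_less_numeral_iff semiring_norm(76))
        ultimately show ?thesis by blast
      next
        case False
        have "\<exists>u\<in>I. side u = 0 \<and> (\<forall>x\<in>I. side x = 0 \<longrightarrow> x = u) \<and> ?f 0 + ?f 1 + ?f 2 = Suc u"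
          using s0 no0 False by argo
        then obtain u where u: "u \<in> I" "side u = 0" "\<forall>x\<in>I. side x = 0 \<longrightarrow> x = u"
          "?f 0 + ?f 1 + ?f 2 = Suc u" by blast
        have "\<exists>u\<in>I. side u = 1 \<and> (\<forall>x\<in>I. side x = 1 \<longrightarrow> x = u) \<and> ?f 3 + ?f 4 + ?f 5 = Suc u"
          using s1 no1 False by argo
        then obtain v where v: "v \<in> I" "side v = 1" "\<forall>x\<in>I. side x = 1 \<longrightarrow> x = v"
          "?f 3 + ?f 4 + ?f 5 = Suc v" by blast
        have uv: "x = u \<or> x = v" if "x \<in> I" for x
          using side_less[of x] bspec[OF u(3) that] bspec[OF v(3) that] by argo
        have ne: "u \<noteq> v" using u(2) v(2) by auto
        from uv have "\<forall>x\<in>I. x = u \<or> x = v" by (rule ballI)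
        then have "game_case I u v" unfolding game_case_def
          by (simp only: u(1,2) v(1,2) ne simp_thms) (intro disjI2)
        then show ?thesis using u(4) v(4) p0 p1 by (simp add: defs)
      qed
    qed
  qed
qed

section \<open>The invariant of the game and its preservation\<close>

definition true_pair :: "bool_matrix \<Rightarrow> bool_matrix \<Rightarrow> nat \<Rightarrow> nat \<Rightarrow> bool" where
  "true_pair A B i j \<longleftrightarrow> (\<exists>k. A i k \<and> B k j)"

definition dominates :: "nat \<Rightarrow> graph \<Rightarrow> nat \<Rightarrow> bool" where
  "dominates N G x \<longleftrightarrow> (\<forall>y<N. side y = side x \<longrightarrow> y \<noteq> x \<longrightarrow> {x, y} \<in> G)"

definition witnessed :: "nat \<Rightarrow> graph \<Rightarrow> nat \<Rightarrow> nat \<Rightarrow> bool" where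
  "witnessed N G u v \<longleftrightarrow>
     (\<exists>w<N. side w = side u \<and> part w = 2 \<and> {u, w} \<notin> G \<and> {v, w} \<notin> G)"

definition clique_parts :: "nat \<Rightarrow> graph \<Rightarrow> bool" where
  "clique_parts N G \<longleftrightarrow>
     (\<forall>u<N. \<forall>v<N. u \<noteq> v \<longrightarrow> side u = side v \<longrightarrow> part u = part v \<longrightarrow> {u, v} \<in> G)"

text \<open>One-sided, so that insertions preserve it: a missing edge proves a true matrix entry,
  while a present edge may be either original or inserted by the game.\<close>

definition sound_edges :: "nat \<Rightarrow> bool_matrix \<Rightarrow> bool_matrix \<Rightarrow> graph \<Rightarrow> bool" where
  "sound_edges N A B G \<longleftrightarrow>
     (\<forall>u<N. \<forall>w<N. side u = side w \<longrightarrow> part w = 2 \<longrightarrow> {u, w} \<notin> G \<longrightarrow>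
        (part u = 0 \<longrightarrow> A (u div 6) (w div 6)) \<and> (part u = 1 \<longrightarrow> B (w div 6) (u div 6)))"

text \<open>Since \<open>x\<close> and \<open>y\<close> may be exchanged, both ends of a cross edge
  dominate their own sides.\<close>

definition cross_dominating :: "nat \<Rightarrow> graph \<Rightarrow> bool" where
  "cross_dominating N G \<longleftrightarrow> (\<forall>x y. {x, y} \<in> G \<longrightarrow> side x \<noteq> side y \<longrightarrow> dominates N G x)"

text \<open>Guarantees that no entry gets lost: as long as an entry has not been found, its row and
  column are nonadjacent and have a common non-neighbour, on either side. A side that has become a
  clique therefore leaves nothing pending.\<close>

definition pending_witnessed ::
  "nat \<Rightarrow> bool_matrix \<Rightarrow> bool_matrix \<Rightarrow> graph \<Rightarrow> (nat \<times> nat) set \<Rightarrow> bool" where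
  "pending_witnessed N A B G R \<longleftrightarrow>
     (\<forall>u<N. \<forall>v<N. side u = side v \<longrightarrow> part u = 0 \<longrightarrow> part v = 1 \<longrightarrow>
        true_pair A B (u div 6) (v div 6) \<longrightarrow> (u div 6, v div 6) \<notin> R \<longrightarrow>
        {u, v} \<notin> G \<and> witnessed N G u v)"

definition complete :: "nat \<Rightarrow> bool_matrix \<Rightarrow> bool_matrix \<Rightarrow> (nat \<times> nat) set \<Rightarrow> bool" where
  "complete n A B R \<longleftrightarrow> (\<forall>i<n. \<forall>j<n. true_pair A B i j \<longrightarrow> (i, j) \<in> R)"

definition game_inv ::
  "nat \<Rightarrow> bool_matrix \<Rightarrow> bool_matrix \<Rightarrow> graph \<Rightarrow> (nat \<times> nat) set \<Rightarrow> bool" where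
  "game_inv N A B G R \<longleftrightarrow> G \<subseteq> all_edges N \<and> clique_parts N G \<and> sound_edges N A B G \<and>
     cross_dominating N G \<and> pending_witnessed N A B G R"

lemma MIS_lessD: "is_MIS N G I \<Longrightarrow> x \<in> I \<Longrightarrow> x < N"
  by (auto simp: is_MIS_def independent_set_def)

lemma MIS_indep: "is_MIS N G I \<Longrightarrow> x \<in> I \<Longrightarrow> y \<in> I \<Longrightarrow> {x, y} \<notin> G"
  by (auto simp: is_MIS_def independent_set_def)

lemma MIS_finite: "is_MIS N G I \<Longrightarrow> finite I"
  using MIS_lessD by (meson bounded_nat_set_is_finite)

lemma all_edges_less: "{x, y} \<in> all_edges N \<Longrightarrow> x < N \<and> y < N \<and> x \<noteq> y"
  by (auto simp: all_edges_def doubleton_eq_iff)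

lemma all_edgesI: "x < N \<Longrightarrow> y < N \<Longrightarrow> x \<noteq> y \<Longrightarrow> {x, y} \<in> all_edges N"
  by (auto simp: all_edges_def)

lemma MIS_neighbour:
  assumes "is_MIS N G I" "G \<subseteq> all_edges N" "x < N" "x \<notin> I"
  obtains y where "y \<in> I" "{x, y} \<in> G"
proof -
  from assms have "\<not> independent_set N G (insert x I)" "independent_set N G I"
    by (auto simp: is_MIS_def)
  then obtain u v where uv: "u \<in> insert x I" "v \<in> insert x I" "{u, v} \<in> G" "\<not> (u \<in> I \<and> v \<in> I)"
    using assms(3) unfolding independent_set_def by blast
  \<comment> \<open>Excludes a loop at \<open>x\<close> as the only obstacle to independence; a
    genuine neighbour in \<open>I\<close> is wanted.\<close>
  moreover have "u \<noteq> v" using uv(3) assms(2) all_edges_less by blast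
  ultimately have "u = x \<and> v \<in> I \<or> v = x \<and> u \<in> I" by auto
  then show thesis using uv(3) that by (auto simp: insert_commute)
qed

lemma dominates_mono: "dominates N G x \<Longrightarrow> G \<subseteq> G' \<Longrightarrow> dominates N G' x"
  by (auto simp: dominates_def)

lemma game_MIS_inj:
  assumes "game_inv N A B G R" "is_MIS N G I"
  shows "inj_on (\<lambda>x. x mod 6) I"
proof (rule inj_onI)
  fix x y assume "x \<in> I" "y \<in> I" "x mod 6 = y mod 6"
  then show "x = y"
    using assms(1) MIS_indep[OF assms(2), of x y] MIS_lessD[OF assms(2)] mod6_eq_iff[of x y]
    unfolding game_inv_def clique_parts_def by metis
qed

text \<open>If the neighbour in the independent set lies on the other side, then \<open>x\<close> dominates its own
  side and is thus adjacent to \<open>z\<close>.\<close>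

lemma same_side_neighbour:
  assumes inv: "game_inv N A B G R" and mis: "is_MIS N G I" and x: "x < N" "x \<notin> I"
    and z: "z \<in> I" "side z = side x"
  obtains y where "y \<in> I" "{x, y} \<in> G" "side y = side x"
proof -
  from inv have G: "G \<subseteq> all_edges N" by (simp add: game_inv_def)
  obtain y where y: "y \<in> I" "{x, y} \<in> G" using MIS_neighbour[OF mis G x] .
  show thesis
  proof (cases "side y = side x")
    case True
    with y that show thesis by blast
  next
    case False
    then have "dominates N G x" using inv y by (metis game_inv_def cross_dominating_def)
    moreover have "z < N" "z \<noteq> x" using MIS_lessD[OF mis] x z by auto
    ultimately have "{x, z} \<in> G" using z by (simp add: dominates_def)
    with z that show thesis by blast
  qed
qed

lemma found_iff:
  assumes "finite I" "inj_on (\<lambda>x. x mod 6) I"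
  shows "(i, j) \<in> found (slot I) \<longleftrightarrow>
    (\<exists>u\<in>I. \<exists>v\<in>I. \<exists>w\<in>I. side u = side v \<and> side u = side w \<and> part u = 0 \<and> part v = 1 \<and> part w = 2 \<and>
       i = u div 6 \<and> j = v div 6)"
proof
  assume "(i, j) \<in> found (slot I)"
  then obtain s where s: "s = 0 \<or> s = 3" "slot I s \<noteq> 0" "slot I (s + 1) \<noteq> 0" "slot I (s + 2) \<noteq> 0"
    "i = (slot I s - 1) div 6" "j = (slot I (s + 1) - 1) div 6"
    by (auto simp: found_def)
  obtain u v w where "u \<in> I" "u mod 6 = s" "slot I s = Suc u"
    "v \<in> I" "v mod 6 = s + 1" "slot I (s + 1) = Suc v" "w \<in> I" "w mod 6 = s + 2"
    using s(2-4)[THEN slot_eq_Suc[OF assms]] by blast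
  moreover from this have "side u = side v \<and> side u = side w \<and> part u = 0 \<and> part v = 1 \<and> part w = 2"
  proof -
    obtain t where "s = 3 * t" using s(1) by force
    then show ?thesis
      using calculation mod6_eqI[of 0 u t] mod6_eqI[of 1 v t] mod6_eqI[of 2 w t] by simp
  qed
  ultimately show "\<exists>u\<in>I. \<exists>v\<in>I. \<exists>w\<in>I. side u = side v \<and> side u = side w \<and> part u = 0 \<and>
      part v = 1 \<and> part w = 2 \<and> i = u div 6 \<and> j = v div 6"
    using s(5,6) by (metis diff_Suc_1)
next
  assume "\<exists>u\<in>I. \<exists>v\<in>I. \<exists>w\<in>I. side u = side v \<and> side u = side w \<and> part u = 0 \<and>
      part v = 1 \<and> part w = 2 \<and> i = u div 6 \<and> j = v div 6"
  then obtain u v w where I: "u \<in> I" "v \<in> I" "w \<in> I" and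
    p: "side u = side v" "side u = side w" "part u = 0" "part v = 1" "part w = 2" and
    ij: "i = u div 6" "j = v div 6" by blast
  define s where "s = u mod 6"
  have s: "s = 0 \<or> s = 3" "v mod 6 = s + 1" "w mod 6 = s + 2"
    using p side_less[of u] mod6_eq[of u] mod6_eq[of v] mod6_eq[of w] unfolding s_def by auto
  have ne: "slot I s \<noteq> 0" "slot I (s + 1) \<noteq> 0" "slot I (s + 2) \<noteq> 0"
    unfolding slot_eq_0[OF assms(1)] using I s(2,3) s_def by blast+
  obtain u' where u': "u' \<in> I" "u' mod 6 = s" "slot I s = Suc u'"
    using slot_eq_Suc[OF assms ne(1)] by blast
  obtain v' where v': "v' \<in> I" "v' mod 6 = s + 1" "slot I (s + 1) = Suc v'"
    using slot_eq_Suc[OF assms ne(2)] by blast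
  have "u' = u" by (rule inj_onD[OF assms(2) _ u'(1) I(1)]) (simp only: u'(2) s_def)
  moreover have "v' = v" by (rule inj_onD[OF assms(2) _ v'(1) I(2)]) (simp only: v'(2) s(2))
  ultimately have "(i, j) = ((slot I s - 1) div 6, (slot I (s + 1) - 1) div 6)"
    unfolding u'(3) v'(3) ij by simp
  then show "(i, j) \<in> found (slot I)"
    unfolding found_def using s(1) ne by blast
qed

lemma doubleton_eqD: "{a, b} = {c, d} \<Longrightarrow> a = c \<and> b = d \<or> a = d \<and> b = c"
  by (simp add: doubleton_eq_iff)

text \<open>Let \<open>w\<close> be the old witness of a pending pair \<open>u'\<close>,
  \<open>v'\<close>. The new edge must not join two of these three vertices. If it did, the third
  would lie outside \<open>I\<close>, hence would have a neighbour in \<open>I\<close> on its side.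
  The only members of \<open>I\<close> there are the ends of the new edge, so the third vertex would
  be adjacent to one of the other two, although the three are pairwise nonadjacent. A cross edge
  joins no two of them, as they share a side.\<close>

lemma game_step_pending:
  assumes inv: "game_inv N A B G R" and mis: "is_MIS N G I" and "game_case I u v"
    and R': "R' = R \<union> found (slot I)"
  shows "pending_witnessed N A B (insert {u, v} G) R'"
  unfolding pending_witnessed_def
proof (intro allI impI)
  fix u' v' assume uv': "u' < N" "v' < N" "side u' = side v'" "part u' = 0" "part v' = 1"
    "true_pair A B (u' div 6) (v' div 6)" "(u' div 6, v' div 6) \<notin> R'"
  have inj: "inj_on (\<lambda>x. x mod 6) I" by (rule game_MIS_inj[OF inv mis])
  have unique: "x = y" if "x \<in> I" "y \<in> I" "side x = side y" "part x = part y" for x y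
  proof -
    have "x mod 6 = y mod 6" unfolding mod6_eq_iff using that(3,4) by (rule conjI)
    from inj_onD[OF inj this that(1,2)] show ?thesis .
  qed
  have "(u' div 6, v' div 6) \<notin> R" using uv'(7) R' by simp
  with inv uv' have old: "{u', v'} \<notin> G" "witnessed N G u' v'"
    unfolding game_inv_def pending_witnessed_def by blast+
  then obtain w where w: "w < N" "side w = side u'" "part w = 2" "{u', w} \<notin> G" "{v', w} \<notin> G"
    unfolding witnessed_def by blast
  note nb = same_side_neighbour[OF inv mis]
  have I: "u \<in> I" "v \<in> I" "u \<noteq> v" and cs: "side u = side v \<and> part u = 0 \<and> part v = 1 \<or>
        side u = side v \<and> part u = 0 \<and> part v = 2 \<and> (\<forall>x\<in>I. side x = side u \<longrightarrow> part x \<noteq> 1) \<or>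
        side u = side v \<and> part u = 1 \<and> part v = 2 \<and> (\<forall>x\<in>I. side x = side u \<longrightarrow> part x \<noteq> 0) \<or>
        side u = 0 \<and> side v = 1 \<and> (\<forall>x\<in>I. x = u \<or> x = v)"
    using assms(3) unfolding game_case_def by blast+
  have "{u', v'} \<noteq> {u, v} \<and> {u', w} \<noteq> {u, v} \<and> {v', w} \<noteq> {u, v}"
    using cs
  proof (elim disjE conjE)
    assume c: "side u = side v" "part u = 0" "part v = 1"
    have "{u', v'} \<noteq> {u, v}"
    proof
      assume "{u', v'} = {u, v}"
      then have eq: "u' = u" "v' = v" using uv'(4,5) c doubleton_eqD[of u' v' u v] by auto
      \<comment> \<open>A summation vertex in \<open>I\<close> next to \<open>u\<close> and
        \<open>v\<close> would have put the entry into \<open>R'\<close>, so the pair would not be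
        pending.\<close>
      have no2: "part x \<noteq> 2" if "x \<in> I" "side x = side u" for x
      proof
        assume "part x = 2"
        then have "(u' div 6, v' div 6) \<in> found (slot I)"
          unfolding found_iff[OF MIS_finite[OF mis] inj]
          using I(1,2) c that eq by (intro bexI[of _ u] bexI[of _ v] bexI[of _ x] conjI) simp_all
        with uv'(7) R' show False by simp
      qed
      have "w \<notin> I" using no2[of w] w(2,3) eq(1) by auto
      moreover have "side u = side w" using w(2) eq(1) by simp
      ultimately obtain y where y: "y \<in> I" "{w, y} \<in> G" "side y = side w"
        using nb[OF w(1) _ I(1)] by blast
      have "part y \<noteq> 2" by (rule no2[OF y(1)]) (simp add: y(3) w(2) eq(1))
      then have "y = u \<or> y = v"
        using part_less[of y] unique[OF y(1) I(1)] unique[OF y(1) I(2)] c y(3) w(2) eq(1) by auto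
      then show False using y(2) w(4,5) eq by (auto simp: insert_commute)
    qed
    moreover have "w \<noteq> u" "w \<noteq> v" using w(3) c by auto
    ultimately show ?thesis using doubleton_eqD[of u' w u v] doubleton_eqD[of v' w u v] by blast
  next
    assume c: "side u = side v" "part u = 0" "part v = 2" "\<forall>x\<in>I. side x = side u \<longrightarrow> part x \<noteq> 1"
    have ne: "v' \<noteq> u" "v' \<noteq> v" "u' \<noteq> v" using c uv'(4,5) by auto
    have "{u', w} \<noteq> {u, v}"
    proof
      assume "{u', w} = {u, v}"
      then have eq: "u' = u" "w = v" using doubleton_eqD[of u' w u v] ne by auto
      have "v' \<notin> I" using bspec[OF c(4), of v'] uv'(3,5) eq by auto
      moreover have "side u = side v'" using uv'(3) eq by simp
      ultimately obtain y where y: "y \<in> I" "{v', y} \<in> G" "side y = side v'"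
        using nb[OF uv'(2) _ I(1)] by blast
      have "part y \<noteq> 1" using bspec[OF c(4) y(1)] y(3) uv'(3) eq by simp
      then have "y = u \<or> y = v"
        using part_less[of y] unique[OF y(1) I(1)] unique[OF y(1) I(2)] c(1-3) y(3) uv'(3) eq by auto
      then show False using y(2) w(5) old(1) eq by (auto simp: insert_commute)
    qed
    then show ?thesis using ne doubleton_eqD[of u' v' u v] doubleton_eqD[of v' w u v] by blast
  next
    assume c: "side u = side v" "part u = 1" "part v = 2" "\<forall>x\<in>I. side x = side u \<longrightarrow> part x \<noteq> 0"
    have ne: "u' \<noteq> u" "u' \<noteq> v" "v' \<noteq> v" using c uv'(4,5) by auto
    have "{v', w} \<noteq> {u, v}"
    proof
      assume "{v', w} = {u, v}"
      then have eq: "v' = u" "w = v" using doubleton_eqD[of v' w u v] ne by auto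
      have "u' \<notin> I" using bspec[OF c(4), of u'] uv'(3,4) eq by auto
      moreover have "side u = side u'" using uv'(3) eq by simp
      ultimately obtain y where y: "y \<in> I" "{u', y} \<in> G" "side y = side u'"
        using nb[OF uv'(1) _ I(1)] by blast
      have "part y \<noteq> 0" using bspec[OF c(4) y(1)] y(3) uv'(3) eq by simp
      then have "y = u \<or> y = v"
        using part_less[of y] unique[OF y(1) I(1)] unique[OF y(1) I(2)] c(1-3) y(3) uv'(3) eq by auto
      then show False using y(2) w(4) old(1) eq by (auto simp: insert_commute)
    qed
    then show ?thesis using ne doubleton_eqD[of u' v' u v] doubleton_eqD[of u' w u v] by blast
  next
    assume c: "side u = 0" "side v = 1"
    have "{a, b} \<noteq> {u, v}" if "side a = side b" for a b
    proof
      assume "{a, b} = {u, v}"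
      then show False using doubleton_eqD[of a b u v] c that by auto
    qed
    then show ?thesis using uv'(3) w(2) by (intro conjI) simp_all
  qed
  then show "{u', v'} \<notin> insert {u, v} G \<and> witnessed N (insert {u, v} G) u' v'"
    using old(1) w unfolding witnessed_def by blast
qed

text \<open>A new cross edge is inserted only if its ends \<open>x\<close>, \<open>y\<close> exhaust
  \<open>I\<close>. Any other vertex on the side of \<open>x\<close> has a neighbour in
  \<open>I\<close> on that side, and this can only be \<open>x\<close>.\<close>

lemma game_step_cross:
  assumes inv: "game_inv N A B G R" and mis: "is_MIS N G I" and "game_case I u v"
  shows "cross_dominating N (insert {u, v} G)"
  unfolding cross_dominating_def
proof (intro allI impI)
  fix x y assume xy: "{x, y} \<in> insert {u, v} G" "side x \<noteq> side y"
  have I: "u \<in> I" "v \<in> I" and cs: "side u = side v \<or> (\<forall>x\<in>I. x = u \<or> x = v)"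
    using assms(3) unfolding game_case_def by blast+
  show "dominates N (insert {u, v} G) x"
  proof (cases "{x, y} \<in> G")
    case True
    then have "dominates N G x" using inv xy(2) unfolding game_inv_def cross_dominating_def by blast
    then show ?thesis by (rule dominates_mono) blast
  next
    case False
    then have eq: "{x, y} = {u, v}" using xy(1) by blast
    then have or: "x = u \<and> y = v \<or> x = v \<and> y = u" by (rule doubleton_eqD)
    then have Ixy: "x \<in> I" "y \<in> I" using I by auto
    from or cs xy(2) have all: "\<forall>z\<in>I. z = x \<or> z = y" by metis
    have "{x, z} \<in> G" if z: "z < N" "side z = side x" "z \<noteq> x" for z
    proof -
      have "z \<notin> I" using bspec[OF all, of z] z(2,3) xy(2) by auto
      then obtain q where q: "q \<in> I" "{z, q} \<in> G" "side q = side z"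
        using same_side_neighbour[OF inv mis z(1) _ Ixy(1)] z(2) by metis
      then have "q = x" using bspec[OF all q(1)] xy(2) z(2) by auto
      then show ?thesis using q(2) by (simp add: insert_commute)
    qed
    then show ?thesis unfolding dominates_def by blast
  qed
qed

lemma game_inv_mono_R: "game_inv N A B G R \<Longrightarrow> R \<subseteq> R' \<Longrightarrow> game_inv N A B G R'"
  unfolding game_inv_def pending_witnessed_def by blast

text \<open>If the set misses a side, every vertex there has its neighbour in the set across, so
  \<open>cross_dominating\<close> makes it adjacent to its whole side. Hence a step without a new
  edge certifies that one side is a clique.\<close>

lemma game_step:
  assumes inv: "game_inv N A B G R" and mis: "is_MIS N G I" and pick: "game_pick I = (u, v)"
    and R': "R' = R \<union> found (slot I)"
  shows "u \<noteq> v \<and> {u, v} \<in> all_edges N - G \<and> game_inv N A B (insert {u, v} G) R' \<or>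
    u = v \<and> game_inv N A B G R' \<and> (\<exists>s<2. \<forall>x<N. side x = s \<longrightarrow> dominates N G x)"
proof (cases "game_case I u v")
  case True
  then have I: "u \<in> I" "v \<in> I" "u \<noteq> v" unfolding game_case_def by blast+
  have e: "{u, v} \<in> all_edges N - G"
    using MIS_indep[OF mis I(1,2)] all_edgesI[OF MIS_lessD[OF mis I(1)] MIS_lessD[OF mis I(2)] I(3)]
    by blast
  moreover have "clique_parts N (insert {u, v} G)"
    using inv unfolding game_inv_def clique_parts_def by blast
  moreover have "sound_edges N A B (insert {u, v} G)"
    using inv unfolding game_inv_def sound_edges_def by blast
  ultimately have "game_inv N A B (insert {u, v} G) R'"
    using game_step_pending[OF inv mis True R'] game_step_cross[OF inv mis True] inv
    unfolding game_inv_def by blast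
  with e I(3) show ?thesis by blast
next
  case False
  note fin = MIS_finite[OF mis]
  have "(\<exists>u v. game_pick I = (u, v) \<and> game_case I u v) \<or>
      game_pick I = (0, 0) \<and> (\<exists>s<2. \<forall>x\<in>I. side x \<noteq> s)"
    by (rule game_pick_cases[OF fin game_MIS_inj[OF inv mis]])
  with False pick have "u = v" and "\<exists>s<2. \<forall>x\<in>I. side x \<noteq> s" by auto
  then obtain s where s: "s < 2" "\<forall>x\<in>I. side x \<noteq> s" by blast
  have "dominates N G x" if x: "x < N" "side x = s" for x
  proof -
    have "x \<notin> I" using s(2) x(2) by blast
    moreover have "G \<subseteq> all_edges N" using inv by (simp add: game_inv_def)
    ultimately obtain y where "y \<in> I" "{x, y} \<in> G" using MIS_neighbour[OF mis _ x(1)] by metis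
    moreover from this(1) have "side x \<noteq> side y" using s(2) x(2) by auto
    ultimately show ?thesis using inv unfolding game_inv_def cross_dominating_def by metis
  qed
  with s(1) \<open>u = v\<close> show ?thesis using game_inv_mono_R[OF inv, of R'] R' by blast
qed

lemma side_part_of:
  assumes "s < 2" "p < 3"
  shows "side (6 * i + 3 * s + p) = s" "part (6 * i + 3 * s + p) = p" "(6 * i + 3 * s + p) div 6 = i"
proof -
  have lt: "3 * s + p < 6" using assms by linarith
  have "(6 * i + 3 * s + p) mod 6 = 3 * s + p" using lt by (simp add: add.assoc)
  then show "side (6 * i + 3 * s + p) = s" "part (6 * i + 3 * s + p) = p"
    using mod6_eqI[OF assms(2)] by blast+
  show "(6 * i + 3 * s + p) div 6 = i" using lt by (simp add: add.assoc)
qed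

text \<open>\<open>6 * n \<le> N\<close> puts a vertex for every row and column on each side. On a
  clique side no row is nonadjacent to a column, as a pending entry would require.\<close>

lemma dominated_side_complete:
  assumes inv: "game_inv N A B G R" and s: "s < 2" "\<forall>x<N. side x = s \<longrightarrow> dominates N G x"
    and n: "6 * n \<le> N"
  shows "complete n A B R"
  unfolding complete_def
proof (intro allI impI, rule ccontr)
  fix i j assume ij: "i < n" "j < n" "true_pair A B i j" "(i, j) \<notin> R"
  let ?u = "6 * i + 3 * s + 0" and ?v = "6 * j + 3 * s + 1"
  have lt: "?u < N" "?v < N" using ij n s(1) by linarith+
  note u = side_part_of[OF s(1), of 0 i] and v = side_part_of[OF s(1), of 1 j]
  have u3: "side ?u = s" "part ?u = 0" "?u div 6 = i" using u by simp_all
  have v3: "side ?v = s" "part ?v = 1" "?v div 6 = j" using v by simp_all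
  have "{?u, ?v} \<notin> G"
    using inv lt ij(3,4) u3 v3 unfolding game_inv_def pending_witnessed_def by metis
  moreover have "?u \<noteq> ?v" using u3 v3 by auto
  ultimately show False using s(2) lt u3(1) v3(1) unfolding dominates_def by metis
qed

section \<open>The schedule of all insertions\<close>

definition loop_pair :: "nat \<Rightarrow> nat \<Rightarrow> nat \<times> nat" where
  "loop_pair N \<tau> = (\<tau> mod (N * N) div N, \<tau> mod N)"

text \<open>Three phases of \<open>N * N\<close> rounds: the first and the last visit all ordered
  pairs, the second plays the game. A fixed number of rounds, instead of a test for the end of the
  game, keeps the program a plain counting loop.\<close>

definition pick :: "nat \<Rightarrow> bool_matrix \<Rightarrow> bool_matrix \<Rightarrow> nat \<Rightarrow> nat set \<Rightarrow> nat \<times> nat" where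
  "pick N A B \<tau> I = (if \<tau> < N * N then
       (if wanted A B (fst (loop_pair N \<tau>)) (snd (loop_pair N \<tau>)) then loop_pair N \<tau> else (0, 0))
     else if \<tau> < 2 * (N * N) then game_pick I else loop_pair N \<tau>)"

definition next_graph :: "nat \<times> nat \<Rightarrow> graph \<Rightarrow> graph" where
  "next_graph p G = (if fst p \<noteq> snd p then insert {fst p, snd p} G else G)"

definition next_found :: "nat \<Rightarrow> nat \<Rightarrow> nat set \<Rightarrow> (nat \<times> nat) set \<Rightarrow> (nat \<times> nat) set" where
  "next_found N \<tau> I R = (if N * N \<le> \<tau> \<and> \<tau> < 2 * (N * N) then R \<union> found (slot I) else R)"

definition sound :: "bool_matrix \<Rightarrow> bool_matrix \<Rightarrow> (nat \<times> nat) set \<Rightarrow> bool" where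
  "sound A B R \<longleftrightarrow> (\<forall>(i, j)\<in>R. true_pair A B i j)"

definition wanted_edges :: "nat \<Rightarrow> bool_matrix \<Rightarrow> bool_matrix \<Rightarrow> nat \<Rightarrow> graph" where
  "wanted_edges N A B \<tau> =
     {{u, v} | u v. u < N \<and> v < N \<and> u \<noteq> v \<and> wanted A B u v \<and> u * N + v < \<tau>}"

text \<open>In the second phase \<open>card G\<close> measures progress: while the product is
  incomplete, each of its \<open>\<tau> - N * N\<close> rounds has added an edge. In the third phase
  all pairs already visited are edges.\<close>

definition play_inv :: "nat \<Rightarrow> nat \<Rightarrow> bool_matrix \<Rightarrow> bool_matrix \<Rightarrow> nat \<Rightarrow> graph
    \<Rightarrow> (nat \<times> nat) set \<Rightarrow> bool" where
  "play_inv N n A B \<tau> G R \<longleftrightarrow>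
     (if \<tau> < N * N then G = wanted_edges N A B \<tau> \<and> R = {}
      else if \<tau> < 2 * (N * N) then game_inv N A B G R \<and> sound A B R \<and>
        (complete n A B R \<or> \<tau> \<le> card G + N * N)
      else G \<subseteq> all_edges N \<and> sound A B R \<and> complete n A B R \<and>
        (\<forall>u<N. \<forall>v<N. u \<noteq> v \<longrightarrow> u * N + v + 2 * (N * N) < \<tau> \<longrightarrow> {u, v} \<in> G))"

lemma all_edges_eq: "all_edges N = {e. e \<subseteq> {..<N} \<and> card e = 2}"
  by (auto simp: all_edges_def card_2_iff)

lemma finite_all_edges: "finite (all_edges N)"
  unfolding all_edges_eq by (rule finite_subset[of _ "Pow {..<N}"]) auto

lemma card_all_edges: "2 * card (all_edges N) = N * (N - 1)"
proof -
  have "card (all_edges N) = N choose 2"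
    unfolding all_edges_eq by (subst n_subsets) simp_all
  moreover have "even (N * (N - 1))" by (cases N) auto
  ultimately show ?thesis by (simp only: choose_two dvd_mult_div_cancel)
qed

lemma index_pair_less:
  assumes "(u::nat) < N" "v < N" shows "u * N + v < N * N"
proof -
  have "u * N + v < Suc u * N" using assms by simp
  also have "\<dots> \<le> N * N" using assms by (intro mult_right_mono) simp_all
  finally show ?thesis .
qed

lemma index_pair_eqD:
  assumes "(v::nat) < N" "u * N + v = \<tau>" shows "u = \<tau> div N" "v = \<tau> mod N"
  using assms by auto

lemma loop_pair_props:
  assumes "0 < N"
  shows "fst (loop_pair N \<tau>) < N" "snd (loop_pair N \<tau>) < N"
    "fst (loop_pair N \<tau>) * N + snd (loop_pair N \<tau>) = \<tau> mod (N * N)"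
proof -
  have "\<tau> mod (N * N) < N * N" using assms by simp
  then show "fst (loop_pair N \<tau>) < N" by (simp add: loop_pair_def less_mult_imp_div_less)
  show "snd (loop_pair N \<tau>) < N" using assms by (simp add: loop_pair_def)
  have "\<tau> mod (N * N) mod N = \<tau> mod N" by (rule mod_mod_cancel) simp
  then show "fst (loop_pair N \<tau>) * N + snd (loop_pair N \<tau>) = \<tau> mod (N * N)"
    using div_mult_mod_eq[of "\<tau> mod (N * N)" N] by (simp add: loop_pair_def)
qed

lemma wanted_edges_subset: "wanted_edges N A B \<tau> \<subseteq> all_edges N"
  unfolding wanted_edges_def all_edges_def by blast

lemma wanted_edges_0: "wanted_edges N A B 0 = {}"
  by (simp add: wanted_edges_def)

lemma wanted_edges_iff:
  assumes "x < N" "y < N" "x \<noteq> y"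
  shows "{x, y} \<in> wanted_edges N A B (N * N) \<longleftrightarrow> wanted A B x y \<or> wanted A B y x"
proof
  assume "{x, y} \<in> wanted_edges N A B (N * N)"
  then obtain u v where "{x, y} = {u, v}" "wanted A B u v" unfolding wanted_edges_def by blast
  then show "wanted A B x y \<or> wanted A B y x" using doubleton_eqD[of x y u v] by blast
next
  assume "wanted A B x y \<or> wanted A B y x"
  moreover have "{x, y} \<in> wanted_edges N A B (N * N)" if "wanted A B x y"
    unfolding wanted_edges_def using that assms index_pair_less[of x N y] by blast
  moreover have "{y, x} \<in> wanted_edges N A B (N * N)" if "wanted A B y x"
    unfolding wanted_edges_def using that assms index_pair_less[of y N x] by blast
  ultimately show "{x, y} \<in> wanted_edges N A B (N * N)" by (auto simp: insert_commute)
qed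

lemma wanted_edges_Suc:
  assumes "\<tau> < N * N"
  shows "wanted_edges N A B (Suc \<tau>) = next_graph (pick N A B \<tau> I) (wanted_edges N A B \<tau>)"
proof -
  have N: "0 < N" using assms by (cases N) auto
  obtain u v where p: "loop_pair N \<tau> = (u, v)" by fastforce
  have uv: "u < N" "v < N" "u * N + v = \<tau>"
    using loop_pair_props[OF N, of \<tau>] assms by (simp_all add: p)
  have less_Suc: "a * N + b < Suc \<tau> \<longleftrightarrow> a * N + b < \<tau> \<or> a = u \<and> b = v" if "b < N" for a b
    using that uv index_pair_eqD[of b N a \<tau>] index_pair_eqD[of v N u \<tau>] by (metis less_Suc_eq)
  have "wanted_edges N A B (Suc \<tau>) = wanted_edges N A B \<tau> \<union>
      {{a, b} | a b. a \<noteq> b \<and> wanted A B a b \<and> a = u \<and> b = v}"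
    unfolding wanted_edges_def using less_Suc uv(1,2) by blast
  also have "\<dots> = next_graph (pick N A B \<tau> I) (wanted_edges N A B \<tau>)"
    using assms by (auto simp: pick_def p next_graph_def)
  finally show ?thesis .
qed

text \<open>Wanted edges stay within a side, so \<open>cross_dominating\<close> holds vacuously. For
  a true entry with index \<open>k\<close> the witness is the summation vertex of index
  \<open>k\<close> on the side at hand; it is at most \<open>6 * k + 5\<close>, hence the
  hypothesis.\<close>

lemma wanted_edges_game_inv:
  assumes fits: "\<forall>i k. A i k \<longrightarrow> 6 * k + 5 < N"
  shows "game_inv N A B (wanted_edges N A B (N * N)) {}"
  unfolding game_inv_def
proof (intro conjI)
  let ?G = "wanted_edges N A B (N * N)"
  show "?G \<subseteq> all_edges N" by (rule wanted_edges_subset)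
  show "clique_parts N ?G" unfolding clique_parts_def
    using wanted_edges_iff wanted_def by metis
  show "cross_dominating N ?G" unfolding cross_dominating_def
  proof (intro allI impI)
    fix x y assume xy: "{x, y} \<in> ?G" "side x \<noteq> side y"
    then have "x < N" "y < N" "x \<noteq> y" using wanted_edges_subset[of N A B "N * N"] all_edges_less[of x y N] by blast+
    with xy have "wanted A B x y \<or> wanted A B y x" using wanted_edges_iff[of x N y A B] by blast
    with xy(2) show "dominates N ?G x" by (auto simp: wanted_def)
  qed
  show "sound_edges N A B ?G" unfolding sound_edges_def
  proof (intro allI impI)
    fix u w assume uw: "u < N" "w < N" "side u = side w" "part w = 2" "{u, w} \<notin> ?G"
    show "(part u = 0 \<longrightarrow> A (u div 6) (w div 6)) \<and> (part u = 1 \<longrightarrow> B (w div 6) (u div 6))"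
    proof (cases "u = w")
      case False
      with uw wanted_edges_iff[of u N w A B] have "\<not> wanted A B u w" by blast
      with uw(3,4) show ?thesis unfolding wanted_def by auto
    qed (use uw(4) in auto)
  qed
  show "pending_witnessed N A B ?G {}" unfolding pending_witnessed_def
  proof (intro allI impI)
    fix u v assume uv: "u < N" "v < N" "side u = side v" "part u = 0" "part v = 1"
      "true_pair A B (u div 6) (v div 6)"
    then obtain k where k: "A (u div 6) k" "B k (v div 6)" unfolding true_pair_def by blast
    let ?w = "6 * k + 3 * side u + 2"
    have w: "side ?w = side u" "part ?w = 2" "?w div 6 = k"
      using side_part_of[OF side_less2, of 2 k u] by simp_all
    have lt: "?w < N" using fits[rule_format, OF k(1)] side_less2[of u] by linarith
    have "u \<noteq> v" "u \<noteq> ?w" "v \<noteq> ?w" using uv w by auto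
    moreover have "\<not> wanted A B u v" "\<not> wanted A B v u"
      "\<not> wanted A B u ?w" "\<not> wanted A B ?w u" "\<not> wanted A B v ?w" "\<not> wanted A B ?w v"
      using uv(3-5) w k by (simp_all add: wanted_def del: add_2_eq_Suc')
    ultimately have "{u, v} \<notin> ?G" "{u, ?w} \<notin> ?G" "{v, ?w} \<notin> ?G"
      using wanted_edges_iff[of u N v A B] wanted_edges_iff[of u N ?w A B]
        wanted_edges_iff[of v N ?w A B] uv(1,2) lt by blast+
    then show "{u, v} \<notin> ?G \<and> witnessed N ?G u v" unfolding witnessed_def
      using lt w(1,2) by blast
  qed
qed

lemma found_sound:
  assumes inv: "game_inv N A B G R" and mis: "is_MIS N G I"
  shows "sound A B (found (slot I))"
proof -
  have "true_pair A B i j" if f: "(i, j) \<in> found (slot I)" for i j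
  proof -
    obtain u v w where I: "u \<in> I" "v \<in> I" "w \<in> I" and
      p: "side u = side v" "side u = side w" "part u = 0" "part v = 1" "part w = 2" and
      ij: "i = u div 6" "j = v div 6"
      using f unfolding found_iff[OF MIS_finite[OF mis] game_MIS_inj[OF inv mis]] by blast
    have "sound_edges N A B G" using inv by (simp add: game_inv_def)
    then have "A (u div 6) (w div 6)" "B (w div 6) (v div 6)"
      using p MIS_indep[OF mis I(1,3)] MIS_indep[OF mis I(2,3)] I[THEN MIS_lessD[OF mis]]
      unfolding sound_edges_def by metis+
    then show ?thesis unfolding true_pair_def ij by blast
  qed
  then show ?thesis unfolding sound_def by blast
qed

text \<open>Contains the passage to the third phase: an incomplete product at
  \<open>\<tau> = 2 * (N * N)\<close> would require at least \<open>N * N\<close> edges, more than a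
  graph on \<open>N\<close> vertices has.\<close>

lemma play_invI1:
  assumes "game_inv N A B G R" "sound A B R" "complete n A B R \<or> \<tau> \<le> card G + N * N"
    "6 * n \<le> N" "N * N \<le> \<tau>" "\<tau> \<le> 2 * (N * N)"
  shows "play_inv N n A B \<tau> G R"
proof (cases "\<tau> < 2 * (N * N)")
  case True
  then show ?thesis using assms by (simp add: play_inv_def)
next
  case False
  then have \<tau>: "\<tau> = 2 * (N * N)" using assms by simp
  have G: "G \<subseteq> all_edges N" using assms(1) by (simp add: game_inv_def)
  have "complete n A B R"
  \<comment> \<open>With \<open>N = 0\<close> the count gives no contradiction, but then
    \<open>n = 0\<close> and there is nothing to find.\<close>
  proof (cases "N = 0")
    case True
    with assms(4) show ?thesis by (simp add: complete_def)
  next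
    case False
    have "card G \<le> card (all_edges N)" using G finite_all_edges card_mono by blast
    moreover have "2 * card (all_edges N) = N * (N - 1)" by (rule card_all_edges)
    moreover have "N * (N - 1) < 2 * (N * N)" using False by (cases N) auto
    ultimately have "\<not> \<tau> \<le> card G + N * N" using \<tau> by linarith
    with assms(3) show ?thesis by blast
  qed
  with G assms(2) \<tau> show ?thesis by (simp add: play_inv_def)
qed

lemma play_invI0:
  assumes "\<forall>i k. A i k \<longrightarrow> 6 * k + 5 < N" "6 * n \<le> N" "\<tau> \<le> N * N"
  shows "play_inv N n A B \<tau> (wanted_edges N A B \<tau>) {}"
proof (cases "\<tau> < N * N")
  case False
  with assms(3) have \<tau>: "\<tau> = N * N" by simp
  show ?thesis unfolding \<tau>
    by (rule play_invI1) (use wanted_edges_game_inv[OF assms(1)] assms(2) in \<open>auto simp: sound_def\<close>)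
qed (simp add: play_inv_def)

lemma play_inv_step:
  assumes inv: "play_inv N n A B \<tau> G R" and mis: "is_MIS N G I" and \<tau>: "\<tau> < 3 * (N * N)"
    and fits: "\<forall>i k. A i k \<longrightarrow> 6 * k + 5 < N" "6 * n \<le> N"
  shows "play_inv N n A B (Suc \<tau>) (next_graph (pick N A B \<tau> I) G) (next_found N \<tau> I R)"
    and "next_graph (pick N A B \<tau> I) G \<subseteq> all_edges N"
proof -
  have N: "0 < N" using \<tau> by (cases N) auto
  let ?P = "play_inv N n A B (Suc \<tau>) (next_graph (pick N A B \<tau> I) G) (next_found N \<tau> I R) \<and>
    next_graph (pick N A B \<tau> I) G \<subseteq> all_edges N"
  consider "\<tau> < N * N" | "N * N \<le> \<tau>" "\<tau> < 2 * (N * N)" | "2 * (N * N) \<le> \<tau>" by linarith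
  then have ?P
  proof cases
    case 1
    then have G: "G = wanted_edges N A B \<tau>" "R = {}" using inv by (simp_all add: play_inv_def)
    have "next_graph (pick N A B \<tau> I) G = wanted_edges N A B (Suc \<tau>)"
      unfolding G(1) by (rule wanted_edges_Suc[OF 1, symmetric])
    moreover have "next_found N \<tau> I R = {}" using 1 G by (simp add: next_found_def)
    ultimately show ?P using play_invI0[OF fits, where \<tau> = "Suc \<tau>" and B = B] 1 wanted_edges_subset by simp
  next
    case 2
    then have G: "game_inv N A B G R" "sound A B R" "complete n A B R \<or> \<tau> \<le> card G + N * N"
      using inv by (simp_all add: play_inv_def)
    define R' where "R' = R \<union> found (slot I)"
    have R': "next_found N \<tau> I R = R'" using 2 by (simp add: next_found_def R'_def)
    have pick: "pick N A B \<tau> I = game_pick I" using 2 by (simp add: pick_def)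
    obtain u v where uv: "game_pick I = (u, v)" by fastforce
    have snd: "sound A B R'" using G(2) found_sound[OF G(1) mis] unfolding sound_def R'_def by blast
    have compl: "complete n A B R'" if "complete n A B R"
      using that unfolding complete_def R'_def by blast
    from game_step[OF G(1) mis uv R'_def] show ?P
    proof (elim disjE conjE)
      assume s: "u \<noteq> v" "{u, v} \<in> all_edges N - G" "game_inv N A B (insert {u, v} G) R'"
      have ng: "next_graph (pick N A B \<tau> I) G = insert {u, v} G"
        using s(1) by (simp add: pick uv next_graph_def)
      have sub: "insert {u, v} G \<subseteq> all_edges N" using s(3) by (simp add: game_inv_def)
      then have "finite G" using finite_subset[OF _ finite_all_edges, of G N] by simp
      then have "card (insert {u, v} G) = Suc (card G)" using s(2) by simp
      then have "complete n A B R' \<or> Suc \<tau> \<le> card (insert {u, v} G) + N * N"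
        using G(3) compl by auto
      from play_invI1[OF s(3) snd this fits(2)] sub show ?P unfolding ng R' using 2 by simp
    next
      assume s: "u = v" "game_inv N A B G R'" "\<exists>s<2. \<forall>x<N. side x = s \<longrightarrow> dominates N G x"
      have ng: "next_graph (pick N A B \<tau> I) G = G"
        using s(1) by (simp add: pick uv next_graph_def)
      have "complete n A B R'" using s(3) dominated_side_complete[OF s(2) _ _ fits(2)] by blast
      with play_invI1[OF s(2) snd _ fits(2), where \<tau> = "Suc \<tau>"] s(2) show ?P
        unfolding ng R' using 2 by (simp add: game_inv_def)
    qed
  next
    case 3
    then have G: "G \<subseteq> all_edges N" "sound A B R" "complete n A B R" and
      old: "\<And>u v. u < N \<Longrightarrow> v < N \<Longrightarrow> u \<noteq> v \<Longrightarrow> u * N + v + 2 * (N * N) < \<tau> \<Longrightarrow> {u, v} \<in> G"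
      using inv by (simp_all add: play_inv_def)
    obtain u v where uv: "loop_pair N \<tau> = (u, v)" by fastforce
    have "\<tau> mod (N * N) = \<tau> - 2 * (N * N)"
    proof -
      have "\<tau> = (\<tau> - 2 * (N * N)) + 2 * (N * N)" using 3 by simp
      then have "\<tau> mod (N * N) = (\<tau> - 2 * (N * N)) mod (N * N)" by (metis mod_mult_self3 add.commute)
      moreover have "\<tau> - 2 * (N * N) < N * N" using 3 \<tau> by linarith
      ultimately show ?thesis by simp
    qed
    then have idx: "u < N" "v < N" "u * N + v + 2 * (N * N) = \<tau>"
      using loop_pair_props[OF N, of \<tau>] 3 by (simp_all add: uv)
    define G' where "G' = next_graph (pick N A B \<tau> I) G"
    have G': "G' = (if u \<noteq> v then insert {u, v} G else G)"
      using 3 by (simp add: G'_def pick_def next_graph_def uv)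
    have "{a, b} \<in> G'" if ab: "a < N" "b < N" "a \<noteq> b" "a * N + b + 2 * (N * N) < Suc \<tau>" for a b
    proof (cases "a * N + b + 2 * (N * N) < \<tau>")
      case True
      then show ?thesis using old[OF ab(1-3)] G' by simp
    next
      case False
      then have "a * N + b = u * N + v" using ab(4) idx(3) by linarith
      then have "a = u" "b = v"
        using index_pair_eqD[of b N a "u * N + v"] index_pair_eqD[of v N u "u * N + v"] ab(2) idx(2) by simp_all
      then show ?thesis using G' ab(3) by simp
    qed
    moreover have "G' \<subseteq> all_edges N" using G(1) G' all_edgesI[OF idx(1,2)] by simp
    moreover have "next_found N \<tau> I R = R" using 3 by (simp add: next_found_def)
    ultimately show ?P using 3 G(2,3) by (simp add: play_inv_def G'_def[symmetric])
  qed
  then show "play_inv N n A B (Suc \<tau>) (next_graph (pick N A B \<tau> I) G) (next_found N \<tau> I R)"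
    "next_graph (pick N A B \<tau> I) G \<subseteq> all_edges N" by blast+
qed

lemma play_inv_final:
  assumes "play_inv N n A B (3 * (N * N)) G R"
  shows "G = all_edges N" "sound A B R" "complete n A B R"
proof -
  have inv: "G \<subseteq> all_edges N" "sound A B R" "complete n A B R" and
    all: "\<And>u v. u < N \<Longrightarrow> v < N \<Longrightarrow> u \<noteq> v \<Longrightarrow> u * N + v < N * N \<Longrightarrow> {u, v} \<in> G"
    using assms by (simp_all add: play_inv_def)
  then show "sound A B R" "complete n A B R" by blast+
  show "G = all_edges N" using inv(1) all index_pair_less unfolding all_edges_def by blast
qed

text \<open>The adversary is the simulation of the remaining iterations, given the sets output so far.\<close>

fun play :: "nat \<Rightarrow> bool_matrix \<Rightarrow> bool_matrix \<Rightarrow> nat \<Rightarrow> graph \<Rightarrow> adversary" where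
  "play N A B 0 G h = None"
| "play N A B (Suc f) G h = (case h of [] \<Rightarrow> None | I # h' \<Rightarrow>
     (let p = pick N A B (3 * (N * N) - Suc f) I; G' = next_graph p G in
      if G' = G then play N A B f G h
      else if h' = [] then Some p else play N A B f G' h'))"

section \<open>Running loop-free programs\<close>

text \<open>Values without the word bound. Programs are followed in this total semantics, and
  overflow is excluded separately.\<close>

fun tval :: "memory \<Rightarrow> aexp \<Rightarrow> nat" where
  "tval \<mu> (Lit k) = k"
| "tval \<mu> (Read a e) = \<mu> a (tval \<mu> e)"
| "tval \<mu> (Op f e1 e2) = apply_op f (tval \<mu> e1) (tval \<mu> e2)"

text \<open>Values read from memory and literals are at most \<open>W\<close>; then the weight of an
  expression is an exponent such that all intermediate values are at most \<open>W ^ weight e\<close>.\<close>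

fun small :: "nat \<Rightarrow> memory \<Rightarrow> aexp \<Rightarrow> bool" where
  "small W \<mu> (Lit k) \<longleftrightarrow> k \<le> W"
| "small W \<mu> (Read a e) \<longleftrightarrow> small W \<mu> e \<and> \<mu> a (tval \<mu> e) \<le> W"
| "small W \<mu> (Op f e1 e2) \<longleftrightarrow> f \<notin> {BitAnd, BitOr, BitXor} \<and> small W \<mu> e1 \<and> small W \<mu> e2"

fun weight :: "aexp \<Rightarrow> nat" where
  "weight (Lit k) = 1"
| "weight (Read a e) = weight e"
| "weight (Op f e1 e2) = weight e1 + weight e2"

lemma weight_pos: "1 \<le> weight e"
  by (induction e) auto

text \<open>For bounds of at least 2 the product dominates the sum, so one multiplicative bound
  serves all these operations and exponents simply add up along an expression.\<close>

lemma apply_op_le: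
  assumes "f \<notin> {BitAnd, BitOr, BitXor}" "x \<le> X" "y \<le> Y" "2 \<le> X" "2 \<le> (Y::nat)"
  shows "apply_op f x y \<le> X * Y"
proof -
  have "X + Y \<le> X * Y"
  proof -
    obtain p q where "X = 2 + p" "Y = 2 + q" using assms(4,5) le_Suc_ex by blast
    then show ?thesis by (simp add: algebra_simps)
  qed
  then have "x + y \<le> X * Y" "x * y \<le> X * Y" "1 \<le> X * Y" "x \<le> X * Y"
    using assms mult_le_mono[OF assms(2,3)] by linarith+
  moreover from this(4) have "x div y \<le> X * Y" "x mod y \<le> X * Y"
    by (meson div_le_dividend mod_less_eq_dividend order.trans)+
  ultimately show ?thesis using assms(1) by (cases f) auto
qed

lemma aval_tval:
  assumes "small W \<mu> e" "2 \<le> W" "W ^ weight e < M"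
  shows "aval M \<mu> e = Some (tval \<mu> e) \<and> tval \<mu> e \<le> W ^ weight e"
  using assms
proof (induction e)
  case (Lit k)
  then show ?case by (simp add: word_def)
next
  case (Read a e)
  have "W ^ 1 \<le> W ^ weight e" using Read.prems(2) weight_pos by (intro power_increasing) simp_all
  then have "\<mu> a (tval \<mu> e) \<le> W ^ weight e" using Read.prems(1) by simp
  then show ?case using Read by (simp add: word_def)
next
  case (Op f e1 e2)
  have le: "W ^ weight e1 \<le> W ^ weight (Op f e1 e2)" "W ^ weight e2 \<le> W ^ weight (Op f e1 e2)"
    using Op.prems(2) by (intro power_increasing; simp)+
  have W: "2 \<le> W ^ weight e" for e
    using Op.prems(2) self_le_power[of W "weight e"] weight_pos[of e] by linarith
  have "apply_op f (tval \<mu> e1) (tval \<mu> e2) \<le> W ^ weight e1 * W ^ weight e2"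
    using Op le by (intro apply_op_le W) auto
  then have "tval \<mu> (Op f e1 e2) \<le> W ^ weight (Op f e1 e2)" by (simp add: power_add)
  then show ?case using Op le by (simp add: word_def)
qed

text \<open>For \<open>Flip\<close>, \<open>While\<close> and \<open>Call\<close> the last equation
  is only a dummy; \<open>safe\<close> rejects these commands.\<close>

fun run :: "com \<Rightarrow> memory \<Rightarrow> memory" where
  "run (Store a e1 e2) \<mu> = \<mu>(a := (\<mu> a)(tval \<mu> e1 := tval \<mu> e2))"
| "run (Seq c1 c2) \<mu> = run c2 (run c1 \<mu>)"
| "run (Cond e c1 c2) \<mu> = (if tval \<mu> e \<noteq> 0 then run c1 \<mu> else run c2 \<mu>)"
| "run _ \<mu> = \<mu>"

fun safe :: "nat \<Rightarrow> com \<Rightarrow> memory \<Rightarrow> bool" where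
  "safe W Skip \<mu> \<longleftrightarrow> True"
| "safe W (Store a e1 e2) \<mu> \<longleftrightarrow> small W \<mu> e1 \<and> small W \<mu> e2"
| "safe W (Seq c1 c2) \<mu> \<longleftrightarrow> safe W c1 \<mu> \<and> safe W c2 (run c1 \<mu>)"
| "safe W (Cond e c1 c2) \<mu> \<longleftrightarrow> small W \<mu> e \<and> (if tval \<mu> e \<noteq> 0 then safe W c1 \<mu> else safe W c2 \<mu>)"
| "safe W _ \<mu> \<longleftrightarrow> False"

text \<open>Only an upper bound on the weights of all expressions in the program matters; a sum
  passes to subprograms without case distinctions.\<close>

fun com_weight :: "com \<Rightarrow> nat" where
  "com_weight (Store a e1 e2) = weight e1 + weight e2"
| "com_weight (Seq c1 c2) = com_weight c1 + com_weight c2"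
| "com_weight (Cond e c1 c2) = weight e + com_weight c1 + com_weight c2"
| "com_weight (While e c) = weight e + com_weight c"
| "com_weight _ = 0"

lemma weight_bound:
  assumes "W ^ k < M" "2 \<le> W" "j \<le> k" shows "W ^ j < (M::nat)"
  using assms power_increasing[of j k W] by linarith

lemma exec_run:
  assumes "safe W c \<mu>" "com_weight c \<le> k" "W ^ k < M" "2 \<le> W"
  shows "\<exists>t\<le>cost c. exec M Q c (\<mu>, \<omega>) t (run c \<mu>, \<omega>)"
  using assms(1,2)
proof (induction c arbitrary: \<mu>)
  case Skip
  show ?case using exec.Skip[of M Q "(\<mu>, \<omega>)"] by (intro exI[of _ 1]) simp
next
  case (Store a e1 e2)
  have "aval M \<mu> e1 = Some (tval \<mu> e1)" "aval M \<mu> e2 = Some (tval \<mu> e2)"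
    using Store aval_tval[of W \<mu> e1 M] aval_tval[of W \<mu> e2 M]
      weight_bound[OF assms(3,4), of "weight e1"] weight_bound[OF assms(3,4), of "weight e2"] assms(4)
    by simp_all
  from exec.Store[OF this, of Q a \<omega>] show ?case by (intro exI[of _ 1]) (simp del: fun_upd_apply One_nat_def)
next
  case (Seq c1 c2)
  obtain t1 where t1: "t1 \<le> cost c1" "exec M Q c1 (\<mu>, \<omega>) t1 (run c1 \<mu>, \<omega>)"
    using Seq.IH(1)[of \<mu>] Seq.prems by auto
  obtain t2 where t2: "t2 \<le> cost c2" "exec M Q c2 (run c1 \<mu>, \<omega>) t2 (run c2 (run c1 \<mu>), \<omega>)"
    using Seq.IH(2)[of "run c1 \<mu>"] Seq.prems by auto
  from exec.Seq[OF t1(2) t2(2)] t1(1) t2(1) show ?case by (intro exI[of _ "t1 + t2"]) simp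
next
  case (Cond e c1 c2)
  have e: "aval M \<mu> e = Some (tval \<mu> e)"
    using Cond aval_tval[of W \<mu> e M] weight_bound[OF assms(3,4), of "weight e"] assms(4) by simp
  show ?case
  proof (cases "tval \<mu> e = 0")
    case True
    obtain t where t: "t \<le> cost c2" "exec M Q c2 (\<mu>, \<omega>) t (run c2 \<mu>, \<omega>)"
      using Cond.IH(2)[of \<mu>] Cond.prems True by auto
    have "exec M Q (Cond e c1 c2) (\<mu>, \<omega>) (1 + t) (run c2 \<mu>, \<omega>)"
      by (rule exec.CondFalse[OF _ t(2)]) (simp add: e True)
    with t(1) True show ?thesis by (intro exI[of _ "1 + t"]) simp
  next
    case False
    obtain t where t: "t \<le> cost c1" "exec M Q c1 (\<mu>, \<omega>) t (run c1 \<mu>, \<omega>)"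
      using Cond.IH(1)[of \<mu>] Cond.prems False by auto
    have "exec M Q (Cond e c1 c2) (\<mu>, \<omega>) (1 + t) (run c1 \<mu>, \<omega>)"
      by (rule exec.CondTrue[OF _ False t(2)]) (simp add: e)
    with t(1) False show ?thesis by (intro exI[of _ "1 + t"]) simp
  qed
qed simp_all

text \<open>An amortized loop rule. The number \<open>d\<close> is a budget, later the time that the
  dynamic algorithm has yet to spend; a round may use any part of it besides its own cost
  \<open>K\<close>. The additional 1 per round pays for the test.\<close>

lemma exec_counting_loop:
  fixes P :: "nat \<Rightarrow> nat \<Rightarrow> state \<Rightarrow> bool"
  assumes step: "\<And>i d s. i < X \<Longrightarrow> P i d s \<Longrightarrow> \<exists>t s' d'. exec M Q c s t s' \<and> P (Suc i) d' s' \<and>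
      t + d' \<le> d + K"
    and cond: "\<And>i d s. P i d s \<Longrightarrow> i \<le> X \<Longrightarrow> aval M (fst s) e = Some (of_bool (i < X))"
    and "P i d s" "i \<le> X"
  shows "\<exists>t s' d'. exec M Q (While e c) s t s' \<and> P X d' s' \<and> t + d' \<le> d + (X - i) * (K + 1) + 1"
  using assms(3,4)
proof (induction "X - i" arbitrary: i d s)
  case 0
  then have "i = X" by simp
  then have "exec M Q (While e c) s 1 s" using cond[OF 0(2,3)] by (intro exec.WhileFalse) simp
  with 0 \<open>i = X\<close> show ?case by (intro exI[of _ 1] exI[of _ s] exI[of _ d]) simp
next
  case (Suc k)
  then have i: "i < X" by simp
  obtain t1 s1 d1 where 1: "exec M Q c s t1 s1" "P (Suc i) d1 s1" "t1 + d1 \<le> d + K"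
    using step[OF i Suc.prems(1)] by blast
  have "k = X - Suc i" "Suc i \<le> X" using Suc.hyps(2) by simp_all
  from Suc.hyps(1)[OF this(1) 1(2) this(2)] obtain t2 s2 d2 where
    2: "exec M Q (While e c) s1 t2 s2" "P X d2 s2" "t2 + d2 \<le> d1 + (X - Suc i) * (K + 1) + 1" by blast
  have "aval M (fst s) e = Some 1" using cond[OF Suc.prems] i by simp
  from exec.WhileTrue[OF this _ 1(1) 2(1)] have "exec M Q (While e c) s (1 + t1 + t2) s2" by simp
  moreover have "1 + t1 + t2 + d2 \<le> d + (X - i) * (K + 1) + 1"
  proof -
    have "X - i = Suc (X - Suc i)" using i by simp
    then have "(X - i) * (K + 1) = (X - Suc i) * (K + 1) + K + 1" by simp
    with 1(3) 2(3) show ?thesis by linarith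
  qed
  ultimately show ?case using 2(2) by blast
qed

section \<open>The reduction\<close>

text \<open>Private arrays of the reduction, starting with number \<open>b\<close>: scalars (loop counter, number of
  vertices, dimension), copies of the two matrices, the adjacency matrix of the current graph, the slots,
  the product found so far, and the chosen pair of vertices.\<close>

abbreviation (input) "counter b \<equiv> Read b (Lit 0)"
abbreviation (input) "order_N b \<equiv> Read b (Lit 1)"
abbreviation (input) "dim_n b \<equiv> Read b (Lit 2)"
abbreviation (input) "increment b \<equiv> Store b (Lit 0) (Op Plus (counter b) (Lit 1))"
abbreviation (input) "square e \<equiv> Op Times e e"
abbreviation (input) "pair_u b \<equiv> Read (b + 6) (Lit 0)"
abbreviation (input) "pair_v b \<equiv> Read (b + 6) (Lit 1)"
abbreviation (input) "side_expr e \<equiv> Op Divide (Op Modulo e (Lit 6)) (Lit 3)"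
abbreviation (input) "part_expr e \<equiv> Op Modulo e (Lit 3)"
abbreviation (input) "not_expr e \<equiv> Op Equals e (Lit 0)"
abbreviation (input) "index_expr e1 e2 k \<equiv> Op Plus (Op Times e1 k) e2"

text \<open>Padding vertices have indices beyond the dimension. A column out of range would run into
  the next row of the array, hence the guard; a row out of range leads beyond cell
  \<open>n * n - 1\<close>, where the array is 0.\<close>

definition matrix_expr :: "nat \<Rightarrow> nat \<Rightarrow> aexp \<Rightarrow> aexp \<Rightarrow> aexp" where
  "matrix_expr b a e1 e2 = Op Times (Op LessThan e2 (dim_n b)) (Read a (index_expr e1 e2 (dim_n b)))"

text \<open>Products act as conjunctions and sums as disjunctions; nonzero means true.\<close>

definition wanted_expr :: "nat \<Rightarrow> aexp" where
  "wanted_expr b = (let u = pair_u b; v = pair_v b; i = Op Divide u (Lit 6); j = Op Divide v (Lit 6) in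
     Op Times (Op Equals (side_expr u) (side_expr v))
      (Op Plus (Op Equals (part_expr u) (part_expr v))
      (Op Plus (Op Times (Op Times (Op Equals (part_expr u) (Lit 0)) (Op Equals (part_expr v) (Lit 2)))
         (not_expr (matrix_expr b (b + 1) i j)))
       (Op Times (Op Times (Op Equals (part_expr u) (Lit 1)) (Op Equals (part_expr v) (Lit 2)))
         (not_expr (matrix_expr b (b + 2) j i))))))"

definition set_pair :: "nat \<Rightarrow> aexp \<Rightarrow> aexp \<Rightarrow> com" where
  "set_pair b e1 e2 = Seq (Store (b + 6) (Lit 0) e1) (Store (b + 6) (Lit 1) e2)"

definition set_pred_pair :: "nat \<Rightarrow> aexp \<Rightarrow> aexp \<Rightarrow> com" where
  "set_pred_pair b e1 e2 = set_pair b (Op Minus e1 (Lit 1)) (Op Minus e2 (Lit 1))"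

fun clear_slots :: "nat \<Rightarrow> nat \<Rightarrow> com" where
  "clear_slots b 0 = Skip"
| "clear_slots b (Suc p) = Seq (clear_slots b p) (Store (b + 4) (Lit p) (Lit 0))"

text \<open>Adds to the slot instead of overwriting it, in accordance with the sum in
  \<open>slot\<close>.\<close>

definition load_slot :: "nat \<Rightarrow> nat \<Rightarrow> com" where
  "load_slot b l = Cond (Op LessThan (Read 3 (Lit 0)) (Lit l)) Skip
     (Store (b + 4) (Op Modulo (Read 3 (Lit l)) (Lit 6))
        (Op Plus (Read (b + 4) (Op Modulo (Read 3 (Lit l)) (Lit 6))) (Op Plus (Read 3 (Lit l)) (Lit 1))))"

text \<open>An unrolled loop. During the game the set has at most one vertex in each of six classes,
  so six entries are the whole output and a choice takes constant time.\<close>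

fun load_slots :: "nat \<Rightarrow> nat \<Rightarrow> com" where
  "load_slots b 0 = clear_slots b 6"
| "load_slots b (Suc l) = Seq (load_slots b l) (load_slot b (Suc l))"

abbreviation (input) "slot_expr b p \<equiv> Read (b + 4) (Lit p)"

definition record_found :: "nat \<Rightarrow> nat \<Rightarrow> com" where
  "record_found b s = Cond (Op Times (slot_expr b s) (Op Times (slot_expr b (s + 1)) (slot_expr b (s + 2))))
     (Store (b + 5) (index_expr (Op Divide (Op Minus (slot_expr b s) (Lit 1)) (Lit 6))
         (Op Divide (Op Minus (slot_expr b (s + 1)) (Lit 1)) (Lit 6)) (order_N b)) (Lit 1)) Skip"

definition side_pick_com :: "nat \<Rightarrow> nat \<Rightarrow> com \<Rightarrow> com" where
  "side_pick_com b s c =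
     Cond (Op Times (slot_expr b s) (slot_expr b (s + 1))) (set_pred_pair b (slot_expr b s) (slot_expr b (s + 1)))
    (Cond (Op Times (slot_expr b s) (slot_expr b (s + 2))) (set_pred_pair b (slot_expr b s) (slot_expr b (s + 2)))
    (Cond (Op Times (slot_expr b (s + 1)) (slot_expr b (s + 2)))
        (set_pred_pair b (slot_expr b (s + 1)) (slot_expr b (s + 2))) c))"

abbreviation (input) "slots_sum b p q r \<equiv> Op Plus (Op Plus (slot_expr b p) (slot_expr b q)) (slot_expr b r)"

definition slots_pick_com :: "nat \<Rightarrow> com" where
  "slots_pick_com b = side_pick_com b 0 (side_pick_com b 3
     (Cond (Op Times (slots_sum b 0 1 2) (slots_sum b 3 4 5))
        (set_pred_pair b (slots_sum b 0 1 2) (slots_sum b 3 4 5)) (set_pair b (Lit 0) (Lit 0))))"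

definition game_com :: "nat \<Rightarrow> com" where
  "game_com b = Seq (load_slots b 6) (Seq (record_found b 0) (Seq (record_found b 3) (slots_pick_com b)))"

text \<open>The pair belonging to the counter is stored first and overwritten when the phase calls
  for another one.\<close>

definition choose_com :: "nat \<Rightarrow> com" where
  "choose_com b = Seq (set_pair b
       (Op Divide (Op Modulo (counter b) (square (order_N b))) (order_N b)) (Op Modulo (counter b) (order_N b)))
     (Cond (Op LessThan (counter b) (square (order_N b)))
        (Cond (wanted_expr b) Skip (set_pair b (Lit 0) (Lit 0)))
     (Cond (Op LessThan (counter b) (Op Times (Lit 2) (square (order_N b)))) (game_com b) Skip))"

definition present_com :: "nat \<Rightarrow> com" where
  "present_com b =
     Seq (Store (b + 3) (index_expr (pair_u b) (pair_v b) (order_N b)) (Lit 1))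
    (Seq (Store (b + 3) (index_expr (pair_v b) (pair_u b) (order_N b)) (Lit 1))
    (Seq (Store 0 (Lit 1) (pair_u b)) (Store 0 (Lit 2) (pair_v b))))"

text \<open>The reduction consults its own adjacency matrix, since the algorithm may have
  overwritten the one in array 1.\<close>

definition new_edge_expr :: "nat \<Rightarrow> aexp" where
  "new_edge_expr b = Op Times (not_expr (Op Equals (pair_u b) (pair_v b)))
     (not_expr (Read (b + 3) (index_expr (pair_u b) (pair_v b) (order_N b))))"

definition play_com :: "nat \<Rightarrow> com" where
  "play_com b = Seq (choose_com b) (Cond (new_edge_expr b) (Seq (present_com b) (Call Update)) Skip)"

definition counting_loop :: "nat \<Rightarrow> aexp \<Rightarrow> com \<Rightarrow> com" where
  "counting_loop b e c = While (Op LessThan (counter b) e)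
      (Seq c (Store b (Lit 0) (Op Plus (counter b) (Lit 1))))"

definition setup_com :: "nat \<Rightarrow> nat \<Rightarrow> com" where
  "setup_com r b = Seq (Store b (Lit 0) (Lit 0))
     (Seq (Store b (Lit 1) (Op Plus (Op Times (Lit 6) (Read 0 (Lit 0))) (Lit r)))
          (Store b (Lit 2) (Read 0 (Lit 0))))"

text \<open>Erasing the input matrices turns array 1 into the adjacency matrix of the empty graph,
  so that \<open>Init\<close> finds precisely its expected input.\<close>

definition copy_com :: "nat \<Rightarrow> com" where
  "copy_com b = Seq (Store (b + 1) (counter b) (Read 1 (counter b)))
    (Seq (Store (b + 2) (counter b) (Read 2 (counter b)))
    (Seq (Store 1 (counter b) (Lit 0)) (Store 2 (counter b) (Lit 0))))"

definition output_com :: "nat \<Rightarrow> com" where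
  "output_com b = Store 3 (counter b) (Read (b + 5)
     (index_expr (Op Divide (counter b) (dim_n b)) (Op Modulo (counter b) (dim_n b)) (order_N b)))"

definition reset_com :: "nat \<Rightarrow> com" where
  "reset_com b = Store b (Lit 0) (Lit 0)"

definition reduction :: "nat \<Rightarrow> nat \<Rightarrow> com" where
  "reduction r b = Seq (setup_com r b)
     (Seq (counting_loop b (square (dim_n b)) (copy_com b))
     (Seq (Store 0 (Lit 0) (order_N b))
     (Seq (Call Init)
     (Seq (reset_com b)
     (Seq (counting_loop b (Op Times (Lit 3) (square (order_N b))) (play_com b))
     (Seq (reset_com b)
          (counting_loop b (square (dim_n b)) (output_com b))))))))"

section \<open>Effect of the commands on the private arrays\<close>

definition mat_array :: "nat \<Rightarrow> bool_matrix \<Rightarrow> nat \<Rightarrow> nat" where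
  "mat_array n A i = (if i < n * n then of_bool (A (i div n) (i mod n)) else 0)"

text \<open>Makes the padding vertices stand for zero rows and columns, so they never contribute to
  the product.\<close>

definition mat_restrict :: "nat \<Rightarrow> bool_matrix \<Rightarrow> nat \<Rightarrow> nat \<Rightarrow> bool" where
  "mat_restrict n A i k \<longleftrightarrow> i < n \<and> k < n \<and> A i k"

lemma mat_array_index:
  assumes "k < n" shows "mat_array n A (i * n + k) = of_bool (mat_restrict n A i k)"
proof (cases "i < n")
  case True
  then show ?thesis using assms index_pair_less[of i n k]
    by (simp add: mat_array_def mat_restrict_def)
next
  case False
  then have "n * n \<le> i * n + k" by (simp add: trans_le_add1)
  then show ?thesis using False by (simp add: mat_array_def mat_restrict_def)
qed

lemma mat_array_le: "mat_array n A i \<le> 1"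
  by (simp add: mat_array_def)

text \<open>Nothing can be demanded below \<open>b\<close>, where the algorithm may leave whatever
  its own word bound admits.\<close>

definition small_memory :: "nat \<Rightarrow> nat \<Rightarrow> memory \<Rightarrow> bool" where
  "small_memory W b \<mu> \<longleftrightarrow> (\<forall>a\<ge>b. \<forall>i. \<mu> a i \<le> W)"

lemma small_memoryD: "small_memory W b \<mu> \<Longrightarrow> b \<le> a \<Longrightarrow> \<mu> a i \<le> W"
  by (simp add: small_memory_def)

lemma small_memory_upd:
  "small_memory W b \<mu> \<Longrightarrow> (\<And>i. f i \<le> W) \<Longrightarrow> small_memory W b (\<mu>(a := f))"
  by (simp add: small_memory_def)

lemma run_clear_slots:
  "run (clear_slots b k) \<mu> = \<mu>(b + 4 := (\<lambda>p. if p < k then 0 else \<mu> (b + 4) p))"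
  by (induction k) (auto simp: fun_eq_iff less_Suc_eq)

lemma safe_clear_slots: "k \<le> W \<Longrightarrow> safe W (clear_slots b k) \<mu>"
  by (induction k) auto

definition partial_slots :: "nat list \<Rightarrow> (nat \<Rightarrow> nat) \<Rightarrow> nat \<Rightarrow> nat" where
  "partial_slots xs f p = (if p < 6 then sum_list (map (\<lambda>x. if x mod 6 = p then Suc x else 0) xs) else f p)"

lemma run_load_slots:
  assumes b: "4 \<le> b" and L: "out_list (\<mu>, \<omega>) = L"
  shows "run (load_slots b l) \<mu> = \<mu>(b + 4 := partial_slots (take l L) (\<mu> (b + 4)))"
proof (induction l)
  case 0
  show ?case by (simp add: run_clear_slots partial_slots_def fun_eq_iff)
next
  case (Suc l)
  have len: "length L = \<mu> 3 0" using L by (auto simp: out_list_def)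
  let ?f = "partial_slots (take l L) (\<mu> (b + 4))"
  have b3: "(3 :: nat) \<noteq> b + 4" by simp
  show ?case
  proof (cases "\<mu> 3 0 < Suc l")
    case True
    then have "take (Suc l) L = take l L" using len by simp
    with True show ?thesis using b3 by (simp add: Suc load_slot_def del: fun_upd_apply add: fun_upd_other)
  next
    case False
    then have l: "l < length L" using len by simp
    have nth: "L ! l = \<mu> 3 (Suc l)"
      using l len L by (auto simp: out_list_def simp del: upt_Suc)
    have t: "take (Suc l) L = take l L @ [\<mu> 3 (Suc l)]" using l nth by (simp add: take_Suc_conv_app_nth)
    have "run (load_slots b (Suc l)) \<mu> =
      \<mu>(b + 4 := ?f(\<mu> 3 (Suc l) mod 6 := ?f (\<mu> 3 (Suc l) mod 6) + (\<mu> 3 (Suc l) + 1)))"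
      using b3 False by (simp add: Suc load_slot_def fun_eq_iff)
    also have "?f(\<mu> 3 (Suc l) mod 6 := ?f (\<mu> 3 (Suc l) mod 6) + (\<mu> 3 (Suc l) + 1)) =
      partial_slots (take (Suc l) L) (\<mu> (b + 4))"
      unfolding t by (auto simp: partial_slots_def fun_eq_iff)
    finally show ?thesis .
  qed
qed

text \<open>Array 3 is not private, so its cells are known to be small only within the reported
  list; the length test in \<open>load_slot\<close> keeps the reads there.\<close>

lemma safe_load_slots:
  assumes b: "4 \<le> b" and L: "out_list (\<mu>, \<omega>) = L" "\<And>x. x \<in> set L \<Longrightarrow> x \<le> W"
    and W: "l \<le> W" "6 \<le> W" "length L \<le> W"
    and S: "\<And>p k. partial_slots (take k L) (\<mu> (b + 4)) p \<le> W"
  shows "safe W (load_slots b l) \<mu>"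
  using W(1)
proof (induction l)
  case 0
  show ?case unfolding load_slots.simps by (rule safe_clear_slots) (rule W(2))
next
  case (Suc l)
  have len: "length L = \<mu> 3 0" using L by (auto simp: out_list_def)
  have b3: "(3 :: nat) \<noteq> b + 4" by simp
  have nth: "\<mu> 3 (Suc l) \<le> W" if "l < \<mu> 3 0"
  proof -
    have "\<mu> 3 (Suc l) \<in> set L" using that L(1) by (auto simp: out_list_def simp del: upt_Suc)
    then show ?thesis by (rule L(2))
  qed
  have "safe W (load_slots b l) \<mu>" using Suc by simp
  moreover have "safe W (load_slot b (Suc l)) (run (load_slots b l) \<mu>)"
    unfolding run_load_slots[OF b L(1)] load_slot_def
    using Suc.prems W len nth S b3 by auto
  ultimately show ?case by simp
qed

lemma tval_matrix_expr:
  assumes "\<mu> b 2 = n" "\<mu> a = mat_array n A"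
  shows "tval \<mu> (matrix_expr b a e1 e2) = of_bool (mat_restrict n A (tval \<mu> e1) (tval \<mu> e2))"
  using assms mat_array_index[of "tval \<mu> e2" n A "tval \<mu> e1"]
  by (cases "tval \<mu> e2 < n") (simp_all add: matrix_expr_def mat_restrict_def)

lemma tval_wanted_expr:
  assumes "\<mu> b 2 = n" "\<mu> (b + 1) = mat_array n A" "\<mu> (b + 2) = mat_array n B"
  shows "tval \<mu> (wanted_expr b) \<noteq> 0 \<longleftrightarrow>
    wanted (mat_restrict n A) (mat_restrict n B) (\<mu> (b + 6) 0) (\<mu> (b + 6) 1)"
  unfolding wanted_expr_def Let_def wanted_def side_def part_def
  by (simp only: tval.simps apply_op.simps tval_matrix_expr[OF assms(1,2)]
      tval_matrix_expr[OF assms(1,3)] mult_eq_0_iff add_eq_0_iff_both_eq_0 of_bool_eq_0_iff of_bool_eq_1_iff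
      de_Morgan_conj de_Morgan_disj not_not conj_assoc simp_thms)

lemma small_wanted_expr:
  assumes "small_memory W b \<mu>" "6 \<le> W"
  shows "small W \<mu> (wanted_expr b)"
  using assms(2) small_memoryD[OF assms(1)] by (simp add: wanted_expr_def Let_def matrix_expr_def)

lemma run_set_pred_pair:
  assumes "\<And>f. tval (\<mu>(b + 6 := f)) e2 = tval \<mu> e2"
  shows "run (set_pred_pair b e1 e2) \<mu> =
    \<mu>(b + 6 := (\<mu> (b + 6))(0 := tval \<mu> e1 - 1, 1 := tval \<mu> e2 - 1))"
  using assms by (simp add: set_pred_pair_def set_pair_def fun_eq_iff)

lemma run_side_pick_com:
  "run (side_pick_com b s c) \<mu> = (let p = side_pick (\<mu> (b + 4)) s in
     if fst p \<noteq> 0 then \<mu>(b + 6 := (\<mu> (b + 6))(0 := fst p - 1, 1 := snd p - 1)) else run c \<mu>)"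
  unfolding side_pick_com_def side_pick_def Let_def
  by (simp add: run_set_pred_pair)

lemma run_slots_pick_com:
  "run (slots_pick_com b) \<mu> = \<mu>(b + 6 := (\<mu> (b + 6))
     (0 := fst (slots_pick (\<mu> (b + 4))) - 1, 1 := snd (slots_pick (\<mu> (b + 4))) - 1))"
  unfolding slots_pick_com_def slots_pick_def run_side_pick_com Let_def
  by (simp add: run_set_pred_pair set_pair_def fun_eq_iff) auto

lemma safe_set_pred_pair:
  assumes "small W \<mu> e1" "small W \<mu> e2" "1 \<le> W"
    "\<And>f. small W (\<mu>(b + 6 := f)) e2 = small W \<mu> e2"
  shows "safe W (set_pred_pair b e1 e2) \<mu>"
  using assms by (simp add: set_pred_pair_def set_pair_def)

lemma safe_slots_pick_com:
  assumes "small_memory W b \<mu>" "6 \<le> W"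
  shows "safe W (slots_pick_com b) \<mu>"
  using assms(2) small_memoryD[OF assms(1)]
  unfolding slots_pick_com_def side_pick_com_def
  by (simp add: safe_set_pred_pair set_pair_def)

definition found_index :: "nat \<Rightarrow> (nat \<Rightarrow> nat) \<Rightarrow> nat \<Rightarrow> nat" where
  "found_index N f s = (f s - 1) div 6 * N + (f (s + 1) - 1) div 6"

lemma run_record_found:
  assumes "\<mu> b 1 = N"
  shows "run (record_found b s) \<mu> = \<mu>(b + 5 :=
    (if \<mu> (b + 4) s \<noteq> 0 \<and> \<mu> (b + 4) (s + 1) \<noteq> 0 \<and> \<mu> (b + 4) (s + 2) \<noteq> 0
     then (\<mu> (b + 5))(found_index N (\<mu> (b + 4)) s := 1) else \<mu> (b + 5)))"
  using assms by (simp add: record_found_def found_index_def)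

lemma safe_record_found:
  assumes "small_memory W b \<mu>" "6 \<le> W" "s \<le> 3"
  shows "safe W (record_found b s) \<mu>"
  using assms(2,3) small_memoryD[OF assms(1)] by (simp add: record_found_def)

lemma slot_le:
  assumes "finite I" "inj_on (\<lambda>x. x mod 6) I" "I \<subseteq> {..<N}" shows "slot I p \<le> N"
proof (cases "slot I p = 0")
  case False
  then obtain x where "x \<in> I" "slot I p = Suc x" using slot_eq_Suc[OF assms(1,2)] by blast
  then show ?thesis using assms(3) by auto
qed simp

lemma card_mod6: "inj_on (\<lambda>x. x mod 6) I \<Longrightarrow> card (I :: nat set) \<le> 6"
proof -
  assume "inj_on (\<lambda>x. x mod 6) I"
  then have "card I = card ((\<lambda>x. x mod 6) ` I)" by (simp add: card_image)
  also have "\<dots> \<le> card {..<6::nat}" by (intro card_mono) auto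
  finally show ?thesis by simp
qed

lemma partial_slots_eq_slot:
  assumes "distinct L" "set L = I" "p < 6"
  shows "partial_slots L f p = slot I p"
  using assms by (simp add: partial_slots_def slot_def sum_list_distinct_conv_sum_set)

lemma partial_slots_le:
  assumes "\<And>x. x \<in> set L \<Longrightarrow> x < N" "f p \<le> W" "length L * N \<le> W"
  shows "partial_slots L f p \<le> W"
proof -
  have "sum_list (map (\<lambda>x. if x mod 6 = p then Suc x else 0) L) \<le> length L * N"
    using assms(1) by (induction L) (auto simp: Suc_le_eq add_le_mono less_imp_le)
  then show ?thesis using assms(2,3) by (simp add: partial_slots_def)
qed

text \<open>The slot array agrees with \<open>slot I\<close> in its first six cells only; the choice
  depends on no others.\<close>

lemma slots_pick_cong:
  assumes "\<And>p. p < 6 \<Longrightarrow> f p = g p" shows "slots_pick f = slots_pick g"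
proof -
  have side: "side_pick f s = side_pick g s" if "s \<le> 3" for s
    unfolding side_pick_def using assms[of s] assms[of "s + 1"] assms[of "s + 2"] that by simp
  have eqs: "f 0 = g 0" "f 1 = g 1" "f 2 = g 2" "f 3 = g 3" "f 4 = g 4" "f 5 = g 5"
    by (rule assms; simp)+
  show ?thesis unfolding slots_pick_def side[of 0, simplified] side[of 3, simplified] eqs ..
qed

lemma slots_pick_le:
  assumes "\<forall>p<6. f p \<le> N"
  shows "fst (slots_pick f) \<le> 3 * N" "snd (slots_pick f) \<le> 3 * N"
proof -
  have side: "fst (side_pick f s) \<le> N \<and> snd (side_pick f s) \<le> N" if "s \<le> 3" for s
    unfolding side_pick_def using assms[rule_format, of s] assms[rule_format, of "s + 1"] assms[rule_format, of "s + 2"] that by simp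
  have "f 0 + f 1 + f 2 \<le> 3 * N" "f 3 + f 4 + f 5 \<le> 3 * N"
    using assms[rule_format, of 0] assms[rule_format, of 1] assms[rule_format, of 2] assms[rule_format, of 3] assms[rule_format, of 4] assms[rule_format, of 5] by linarith+
  moreover have "fst (side_pick f 0) \<le> 3 * N" "snd (side_pick f 0) \<le> 3 * N"
    "fst (side_pick f 3) \<le> 3 * N" "snd (side_pick f 3) \<le> 3 * N"
    using side[of 0] side[of 3] by linarith+
  ultimately show "fst (slots_pick f) \<le> 3 * N" "snd (slots_pick f) \<le> 3 * N"
    unfolding slots_pick_def by (simp_all only: fst_conv snd_conv split: if_split) blast+
qed

definition found_at :: "(nat \<Rightarrow> nat) \<Rightarrow> nat \<Rightarrow> bool" where
  "found_at f s \<longleftrightarrow> f s \<noteq> 0 \<and> f (s + 1) \<noteq> 0 \<and> f (s + 2) \<noteq> 0"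

lemma found_eq: "found f = (if found_at f 0 then {((f 0 - 1) div 6, (f 1 - 1) div 6)} else {}) \<union>
    (if found_at f 3 then {((f 3 - 1) div 6, (f 4 - 1) div 6)} else {})"
proof -
  let ?p = "\<lambda>s. ((f s - 1) div 6, (f (s + 1) - 1) div 6)"
  have "found f = {p. \<exists>s. (s = 0 \<or> s = 3) \<and> found_at f s \<and> p = ?p s}"
    unfolding found_def found_at_def by blast
  also have "\<dots> = {p. found_at f 0 \<and> p = ?p 0} \<union> {p. found_at f 3 \<and> p = ?p 3}" by blast
  finally show ?thesis by simp
qed

definition encodes_found :: "nat \<Rightarrow> (nat \<Rightarrow> nat) \<Rightarrow> (nat \<times> nat) set \<Rightarrow> bool" where
  "encodes_found N c R \<longleftrightarrow> (\<forall>i<N. \<forall>j<N. c (i * N + j) = of_bool ((i, j) \<in> R))"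

text \<open>\<open>j0 < N\<close> makes the row-major index determine the pair. An \<open>i0\<close>
  of \<open>N\<close> or more touches only cells that encode no pair.\<close>

lemma encodes_found_insert:
  assumes "encodes_found N c R" "j0 < N"
  shows "encodes_found N (c(i0 * N + j0 := 1)) (R \<union> {(i0, j0)})"
  unfolding encodes_found_def
proof (intro allI impI)
  fix i j assume ij: "i < N" "j < N"
  have "i * N + j = i0 * N + j0 \<longleftrightarrow> i = i0 \<and> j = j0"
    using index_pair_eqD[of j N i "i0 * N + j0"] index_pair_eqD[of j0 N i0 "i0 * N + j0"] ij assms(2)
    by metis
  then show "(c(i0 * N + j0 := 1)) (i * N + j) = of_bool ((i, j) \<in> R \<union> {(i0, j0)})"
    using assms(1) ij unfolding encodes_found_def by auto
qed

text \<open>In the bound for \<open>W\<close>, the term \<open>6 * N\<close> covers partial slot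
  sums, to which at most six vertices contribute at most \<open>N\<close> each; the summand 6 covers
  the literals.\<close>

lemma run_game_com:
  assumes b: "4 \<le> b" and N: "\<mu> b 1 = N" "0 < N"
    and sm: "small_memory W b \<mu>" and W: "6 * N + 6 \<le> W"
    and L: "out_list (\<mu>, \<omega>) = L" "distinct L" "set L = I"
    and I: "inj_on (\<lambda>x. x mod 6) I" "I \<subseteq> {..<N}"
    and C: "encodes_found N (\<mu> (b + 5)) R"
  shows "safe W (game_com b) \<mu>"
    and "\<forall>a. a \<notin> {b + 4, b + 5, b + 6} \<longrightarrow> run (game_com b) \<mu> a = \<mu> a"
    and "(run (game_com b) \<mu> (b + 6) 0, run (game_com b) \<mu> (b + 6) 1) = game_pick I"
    and "encodes_found N (run (game_com b) \<mu> (b + 5)) (R \<union> found (slot I))"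
    and "small_memory W b (run (game_com b) \<mu>)"
proof -
  have fin: "finite I" using I(2) finite_subset by blast
  have len: "length L \<le> 6" using card_mod6[OF I(1)] L(2,3) distinct_card by fastforce
  then have t6: "take 6 L = L" by simp
  define f where "f = partial_slots L (\<mu> (b + 4))"
  have LN: "x < N" if "x \<in> set L" for x using that L(3) I(2) by blast
  have f_slot: "f p = slot I p" if "p < 6" for p
    unfolding f_def by (rule partial_slots_eq_slot[OF L(2,3) that])
  have ps: "partial_slots (take k L) (\<mu> (b + 4)) p \<le> W" for k p
  proof (rule partial_slots_le)
    show "x < N" if "x \<in> set (take k L)" for x using that LN in_set_takeD by fast
    show "\<mu> (b + 4) p \<le> W" by (rule small_memoryD[OF sm]) simp
    have "length (take k L) * N \<le> 6 * N" using len by (intro mult_right_mono) simp_all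
    then show "length (take k L) * N \<le> W" using W by linarith
  qed
  define \<mu>1 where "\<mu>1 = \<mu>(b + 4 := f)"
  have r1: "run (load_slots b 6) \<mu> = \<mu>1"
    unfolding run_load_slots[OF b L(1)] t6 \<mu>1_def f_def ..
  have s1: "safe W (load_slots b 6) \<mu>"
  proof (rule safe_load_slots[OF b L(1)])
    show "x \<le> W" if "x \<in> set L" for x using LN[OF that] W by simp
  qed (use W len ps in simp_all)
  have sm1: "small_memory W b \<mu>1" unfolding \<mu>1_def f_def
    using ps[of 6] t6 by (intro small_memory_upd[OF sm]) simp
  define c1 where "c1 = (if found_at f 0 then (\<mu> (b + 5))(found_index N f 0 := 1) else \<mu> (b + 5))"
  define c2 where "c2 = (if found_at f 3 then c1(found_index N f 3 := 1) else c1)"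
  define \<mu>2 where "\<mu>2 = \<mu>1(b + 5 := c1)"
  define \<mu>3 where "\<mu>3 = \<mu>1(b + 5 := c2)"
  have mem1: "\<mu>1 b 1 = N" "\<mu>1 (b + 4) = f" "\<mu>1 (b + 5) = \<mu> (b + 5)" "\<mu>2 b 1 = N" "\<mu>2 (b + 4) = f"
    "\<mu>2 (b + 5) = c1" "\<mu>3 (b + 4) = f"
    using N(1) by (simp_all add: \<mu>1_def \<mu>2_def \<mu>3_def)
  have r2: "run (record_found b 0) \<mu>1 = \<mu>2"
    unfolding run_record_found[where \<mu> = \<mu>1 and b = b and N = N, OF mem1(1)] mem1 \<mu>2_def c1_def found_at_def ..
  have r3: "run (record_found b 3) \<mu>2 = \<mu>3"
    unfolding run_record_found[where \<mu> = \<mu>2 and b = b and N = N, OF mem1(4)] mem1 unfolding \<mu>3_def \<mu>2_def c2_def found_at_def by simp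
  have W1: "1 \<le> W" "6 \<le> W" using W by simp_all
  have c1W: "c1 i \<le> W" for i
    using small_memoryD[OF sm, of "b + 5" i] W1 by (simp add: c1_def)
  have c2W: "c2 i \<le> W" for i using c1W[of i] W1 by (simp add: c2_def)
  have sm2: "small_memory W b \<mu>2" unfolding \<mu>2_def by (rule small_memory_upd[OF sm1 c1W])
  have sm3: "small_memory W b \<mu>3" unfolding \<mu>3_def by (rule small_memory_upd[OF sm1 c2W])
  have run: "run (game_com b) \<mu> = \<mu>3(b + 6 := (\<mu>3 (b + 6))
     (0 := fst (slots_pick f) - 1, 1 := snd (slots_pick f) - 1))"
    unfolding game_com_def run.simps r1 r2 r3 run_slots_pick_com mem1 ..
  show "safe W (game_com b) \<mu>"
    unfolding game_com_def safe.simps r1 r2 r3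
    using s1 safe_record_found[OF sm1 W1(2)] safe_record_found[OF sm2 W1(2)]
      safe_slots_pick_com[OF sm3 W1(2)] by simp
  show "\<forall>a. a \<notin> {b + 4, b + 5, b + 6} \<longrightarrow> run (game_com b) \<mu> a = \<mu> a"
    unfolding run \<mu>3_def \<mu>1_def by simp
  have fs: "slots_pick f = slots_pick (slot I)" by (rule slots_pick_cong[OF f_slot])
  show "(run (game_com b) \<mu> (b + 6) 0, run (game_com b) \<mu> (b + 6) 1) = game_pick I"
    unfolding run game_pick_def fs by simp
  have f_le: "f p \<le> N" if "p < 6" for p unfolding f_slot[OF that] by (rule slot_le[OF fin I])
  have pick_le: "fst (slots_pick f) - 1 \<le> W" "snd (slots_pick f) - 1 \<le> W"
    using slots_pick_le[of f N] f_le W by fastforce+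
  then show "small_memory W b (run (game_com b) \<mu>)"
    unfolding run using small_memoryD[OF sm3, of "b + 6"] by (intro small_memory_upd[OF sm3]) simp
  have j: "(f 1 - 1) div 6 < N" "(f 4 - 1) div 6 < N"
    using f_le[of 1] f_le[of 4] N(2) by (simp_all add: less_mult_imp_div_less)
  have "encodes_found N c1 (R \<union> (if found_at f 0 then {((f 0 - 1) div 6, (f 1 - 1) div 6)} else {}))"
    using encodes_found_insert[OF C j(1), of "(f 0 - 1) div 6"] C by (simp add: c1_def found_index_def)
  from encodes_found_insert[OF this j(2), of "(f 3 - 1) div 6"] this
  have "encodes_found N c2 (R \<union> found f)"
    unfolding found_eq[of f] by (auto simp: c2_def found_index_def Un_assoc)
  moreover have "found f = found (slot I)"
    unfolding found_eq found_at_def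
    by (simp add: f_slot del: One_nat_def)
  ultimately show "encodes_found N (run (game_com b) \<mu> (b + 5)) (R \<union> found (slot I))"
    unfolding run \<mu>3_def by simp
qed

text \<open>Injectivity modulo 6 is assumed for the game phase only: before it the parts are not yet
  cliques, and the output may contain many vertices of one class.\<close>

lemma run_choose_com:
  assumes b: "4 \<le> b" and mem: "\<mu> b 0 = \<tau>" "\<mu> b 1 = N" "\<mu> b 2 = n"
      "\<mu> (b + 1) = mat_array n A" "\<mu> (b + 2) = mat_array n B"
    and N: "0 < N" and sm: "small_memory W b \<mu>" and W: "3 * (N * N) + 6 * N + 6 \<le> W"
    and L: "out_list (\<mu>, \<omega>) = L" "distinct L" "set L = I" "I \<subseteq> {..<N}"
    and I: "N * N \<le> \<tau> \<and> \<tau> < 2 * (N * N) \<longrightarrow> inj_on (\<lambda>x. x mod 6) I"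
    and C: "encodes_found N (\<mu> (b + 5)) R"
  shows "safe W (choose_com b) \<mu>"
    and "\<forall>a. a \<notin> {b + 4, b + 5, b + 6} \<longrightarrow> run (choose_com b) \<mu> a = \<mu> a"
    and "(run (choose_com b) \<mu> (b + 6) 0, run (choose_com b) \<mu> (b + 6) 1) =
      pick N (mat_restrict n A) (mat_restrict n B) \<tau> I"
    and "encodes_found N (run (choose_com b) \<mu> (b + 5)) (next_found N \<tau> I R)"
    and "small_memory W b (run (choose_com b) \<mu>)"
proof -
  let ?A = "mat_restrict n A" and ?B = "mat_restrict n B"
  obtain u v where uv: "loop_pair N \<tau> = (u, v)" by fastforce
  have uvN: "u < N" "v < N" using loop_pair_props(1,2)[OF N, of \<tau>] by (simp_all add: uv)
  define \<mu>1 where "\<mu>1 = \<mu>(b + 6 := (\<mu> (b + 6))(0 := u, 1 := v))"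
  let ?set = "set_pair b (Op Divide (Op Modulo (counter b) (square (order_N b))) (order_N b))
      (Op Modulo (counter b) (order_N b))"
  have set: "run ?set \<mu> = \<mu>1"
    using uv mem by (simp add: set_pair_def \<mu>1_def loop_pair_def fun_eq_iff)
  have safe_set: "safe W ?set \<mu>"
    using small_memoryD[OF sm] W by (simp add: set_pair_def)
  have mem1: "\<mu>1 b 0 = \<tau>" "\<mu>1 b 1 = N" "\<mu>1 b 2 = n"
      "\<mu>1 (b + 1) = mat_array n A" "\<mu>1 (b + 2) = mat_array n B" "\<mu>1 (b + 5) = \<mu> (b + 5)"
      "\<mu>1 (b + 6) 0 = u" "\<mu>1 (b + 6) 1 = v"
    using mem by (simp_all add: \<mu>1_def)
  have NN: "N \<le> W" using W by simp
  have sm1: "small_memory W b \<mu>1" unfolding \<mu>1_def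
    using small_memoryD[OF sm, of "b + 6"] uvN NN by (intro small_memory_upd[OF sm]) auto
  have L1: "out_list (\<mu>1, \<omega>) = L" using L(1) b by (simp add: out_list_def \<mu>1_def)
  have safe_c: "small W \<mu>1 (Op LessThan (counter b) (square (order_N b)))"
      "small W \<mu>1 (Op LessThan (counter b) (Op Times (Lit 2) (square (order_N b))))"
    using small_memoryD[OF sm1] W by simp_all
  have test: "tval \<mu>1 (Op LessThan (counter b) (square (order_N b))) = of_bool (\<tau> < N * N)"
    "tval \<mu>1 (Op LessThan (counter b) (Op Times (Lit 2) (square (order_N b)))) = of_bool (\<tau> < 2 * (N * N))"
    using mem1 by simp_all
  have sw: "small W \<mu>1 (wanted_expr b)" by (rule small_wanted_expr[OF sm1]) (use W in simp)
  have run_c: "run (choose_com b) \<mu> = (if \<tau> < N * N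
      then if tval \<mu>1 (wanted_expr b) \<noteq> 0 then \<mu>1 else run (set_pair b (Lit 0) (Lit 0)) \<mu>1
      else if \<tau> < 2 * (N * N) then run (game_com b) \<mu>1 else \<mu>1)"
    unfolding choose_com_def run.simps set test by simp
  have safe_ch: "safe W (choose_com b) \<mu> = (if \<tau> < N * N
      then tval \<mu>1 (wanted_expr b) \<noteq> 0 \<or> safe W (set_pair b (Lit 0) (Lit 0)) \<mu>1
      else \<tau> < 2 * (N * N) \<longrightarrow> safe W (game_com b) \<mu>1)"
    unfolding choose_com_def safe.simps set test by (simp only: safe_set safe_c sw) simp
  let ?g = "safe W (choose_com b) \<mu> \<and>
    (\<forall>a. a \<notin> {b + 4, b + 5, b + 6} \<longrightarrow> run (choose_com b) \<mu> a = \<mu> a) \<and>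
    (run (choose_com b) \<mu> (b + 6) 0, run (choose_com b) \<mu> (b + 6) 1) = pick N ?A ?B \<tau> I \<and>
    encodes_found N (run (choose_com b) \<mu> (b + 5)) (next_found N \<tau> I R) \<and>
    small_memory W b (run (choose_com b) \<mu>)"
  consider (0) "\<tau> < N * N" | (1) "N * N \<le> \<tau>" "\<tau> < 2 * (N * N)" | (2) "2 * (N * N) \<le> \<tau>" by linarith
  then have ?g
  proof cases
    case 0
    have w: "tval \<mu>1 (wanted_expr b) \<noteq> 0 \<longleftrightarrow> wanted ?A ?B u v"
      using tval_wanted_expr[of \<mu>1 b n A B] mem1 by simp
    show ?g
    proof (cases "wanted ?A ?B u v")
      case True
      have run: "run (choose_com b) \<mu> = \<mu>1" using 0 w True by (simp add: run_c)
      have "safe W (choose_com b) \<mu>"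
        using 0 w True by (simp add: safe_ch)
      moreover have "pick N ?A ?B \<tau> I = (u, v)" using 0 True by (simp add: pick_def uv)
      ultimately show ?g unfolding run using sm1 C 0 mem1
        by (simp add: next_found_def) (simp add: \<mu>1_def)
    next
      case False
      define \<mu>2 where "\<mu>2 = \<mu>1(b + 6 := (\<mu>1 (b + 6))(0 := 0, 1 := 0))"
      have run: "run (choose_com b) \<mu> = \<mu>2"
        using 0 w False by (simp add: run_c set_pair_def \<mu>2_def fun_eq_iff)
      have "safe W (choose_com b) \<mu>"
        using 0 w False W by (simp add: safe_ch set_pair_def)
      moreover have "pick N ?A ?B \<tau> I = (0, 0)" using 0 False by (simp add: pick_def uv)
      moreover have "small_memory W b \<mu>2" unfolding \<mu>2_def
        using small_memoryD[OF sm1, of "b + 6"] by (intro small_memory_upd[OF sm1]) auto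
      ultimately show ?g unfolding run using C 0 mem1
        by (simp add: next_found_def \<mu>2_def) (simp add: \<mu>1_def)
    qed
  next
    case 1
    have run: "run (choose_com b) \<mu> = run (game_com b) \<mu>1" using 1 by (simp add: run_c)
    have inj: "inj_on (\<lambda>x. x mod 6) I" using I 1 by blast
    have W6: "6 * N + 6 \<le> W" using W by simp
    have C1: "encodes_found N (\<mu>1 (b + 5)) R" using C mem1 by simp
    note game = run_game_com[where \<mu> = \<mu>1 and \<omega> = \<omega>, OF b mem1(2) N sm1 W6 L1 L(2,3) inj L(4) C1]
    have "safe W (choose_com b) \<mu>"
      using 1 game(1) by (simp add: safe_ch)
    moreover have "pick N ?A ?B \<tau> I = game_pick I" using 1 by (simp add: pick_def)
    moreover have "next_found N \<tau> I R = R \<union> found (slot I)" using 1 by (simp add: next_found_def)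
    moreover have "\<mu>1 a = \<mu> a" if "a \<notin> {b + 4, b + 5, b + 6}" for a using that by (simp add: \<mu>1_def)
    ultimately show ?g unfolding run using game(2-5) by metis
  next
    case 2
    have run: "run (choose_com b) \<mu> = \<mu>1" using 2 N by (simp add: run_c)
    have "safe W (choose_com b) \<mu>" using 2 N by (simp add: safe_ch)
    moreover have "pick N ?A ?B \<tau> I = (u, v)" using 2 N by (simp add: pick_def uv)
    ultimately show ?g unfolding run using sm1 C 2 mem1
      by (simp add: next_found_def) (simp add: \<mu>1_def)
  qed
  then show "safe W (choose_com b) \<mu>"
    and "\<forall>a. a \<notin> {b + 4, b + 5, b + 6} \<longrightarrow> run (choose_com b) \<mu> a = \<mu> a"
    and "(run (choose_com b) \<mu> (b + 6) 0, run (choose_com b) \<mu> (b + 6) 1) = pick N ?A ?B \<tau> I"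
    and "encodes_found N (run (choose_com b) \<mu> (b + 5)) (next_found N \<tau> I R)"
    and "small_memory W b (run (choose_com b) \<mu>)" by blast+
qed

section \<open>One round of the main loop\<close>

definition edge_pairs :: "graph \<Rightarrow> (nat \<times> nat) set" where
  "edge_pairs G = {(u, v). {u, v} \<in> G}"

definition private_inv where
  "private_inv W b N n A B \<tau> G R \<mu> \<longleftrightarrow> \<mu> b 0 = \<tau> \<and> \<mu> b 1 = N \<and> \<mu> b 2 = n \<and>
     \<mu> (b + 1) = mat_array n A \<and> \<mu> (b + 2) = mat_array n B \<and>
     encodes_found N (\<mu> (b + 3)) (edge_pairs G) \<and> encodes_found N (\<mu> (b + 5)) R \<and> small_memory W b \<mu>"

text \<open>The invariant depends on arrays from \<open>b\<close> on alone and therefore survives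
  every call of the algorithm.\<close>

lemma private_inv_cong:
  assumes "private_inv W b N n A B \<tau> G R \<mu>" "\<And>a. b \<le> a \<Longrightarrow> \<mu>' a = \<mu> a"
  shows "private_inv W b N n A B \<tau> G R \<mu>'"
  using assms by (simp add: private_inv_def small_memory_def)

lemma exec_cond_run:
  assumes "small W \<mu> e" "weight e \<le> k" "W ^ k < M" "2 \<le> W"
    and "exec M Q (if tval \<mu> e \<noteq> 0 then c1 else c2) (\<mu>, \<omega>) t s'"
  shows "exec M Q (Cond e c1 c2) (\<mu>, \<omega>) (1 + t) s'"
proof -
  have e: "aval M \<mu> e = Some (tval \<mu> e)"
    using assms aval_tval[of W \<mu> e M] weight_bound[OF assms(3,4,2)] by simp
  show ?thesis
  proof (cases "tval \<mu> e = 0")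
    case True
    then show ?thesis using assms(5) e by (intro exec.CondFalse) simp_all
  next
    case False
    then show ?thesis using assms(5) e by (intro exec.CondTrue[of _ _ _ "tval \<mu> e"]) simp_all
  qed
qed

lemma run_present_com:
  assumes b: "4 \<le> b" and pr: "private_inv W b N n A B \<tau> G R \<mu>" and uv: "\<mu> (b + 6) 0 = u" "\<mu> (b + 6) 1 = v"
    "u < N" "v < N" and W: "6 * N + 6 \<le> W" and s: "\<forall>a<b. \<mu> a = fst s a"
  shows "safe W (present_com b) \<mu>"
    "private_inv W b N n A B \<tau> (insert {u, v} G) R (run (present_com b) \<mu>)"
    "\<forall>a<b. run (present_com b) \<mu> a = fst (present_edge u v s) a"
proof -
  have sm: "small_memory W b \<mu>" and N: "\<mu> b 1 = N" and G: "encodes_found N (\<mu> (b + 3)) (edge_pairs G)"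
    using pr by (simp_all add: private_inv_def)
  show "safe W (present_com b) \<mu>"
    using small_memoryD[OF sm] W b by (simp add: present_com_def)
  define g where "g = (\<mu> (b + 3))(u * N + v := 1, v * N + u := 1)"
  have run: "run (present_com b) \<mu> = \<mu>(b + 3 := g, 0 := (\<mu> 0)(1 := u, 2 := v))"
    using uv(1,2) N b by (simp add: present_com_def g_def fun_eq_iff)
  have "edge_pairs (insert {u, v} G) = edge_pairs G \<union> {(u, v)} \<union> {(v, u)}"
    by (auto simp: edge_pairs_def doubleton_eq_iff)
  then have "encodes_found N g (edge_pairs (insert {u, v} G))"
    unfolding g_def using encodes_found_insert[OF encodes_found_insert[OF G uv(4), of u] uv(3), of v] by simp
  moreover have "g i \<le> W" for i
    using small_memoryD[OF sm, of "b + 3" i] W by (simp add: g_def)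
  ultimately show "private_inv W b N n A B \<tau> (insert {u, v} G) R (run (present_com b) \<mu>)"
    using pr b unfolding run private_inv_def by (simp add: small_memory_def)
  show "\<forall>a<b. run (present_com b) \<mu> a = fst (present_edge u v s) a"
    using s b unfolding run present_edge_def by simp
qed

lemma tval_new_edge_expr:
  assumes "private_inv W b N n A B \<tau> G R \<mu>" "\<mu> (b + 6) 0 = u" "\<mu> (b + 6) 1 = v"
    and "u \<noteq> v \<Longrightarrow> u < N \<and> v < N"
  shows "tval \<mu> (new_edge_expr b) \<noteq> 0 \<longleftrightarrow> u \<noteq> v \<and> {u, v} \<notin> G"
proof (cases "u = v")
  case False
  then have "\<mu> (b + 3) (u * N + v) = of_bool ({u, v} \<in> G)"
    using assms(1,4) by (simp add: private_inv_def encodes_found_def edge_pairs_def)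
  then show ?thesis using assms(1-3) False by (simp add: new_edge_expr_def private_inv_def)
qed (use assms(2,3) in \<open>simp add: new_edge_expr_def\<close>)

lemma next_graph_eq_iff: "next_graph (u, v) G = G \<longleftrightarrow> \<not> (u \<noteq> v \<and> {u, v} \<notin> G)"
  by (auto simp: next_graph_def)

text \<open>Here \<open>s\<close> is the state of the algorithm run on its own, and
  \<open>\<mu>\<close> agrees with it below \<open>b\<close>. A round either leaves that part alone
  or performs exactly one update, whose time \<open>t1\<close> is kept apart from the round's own
  cost.\<close>

lemma exec_play_com:
  fixes \<tau> :: nat and \<mu> :: memory
  assumes b: "4 \<le> b" "arrays (update_proc D) \<subseteq> {..<b}"
    and M: "MD \<le> M" "com_weight (play_com b) \<le> k" "W ^ k < M" "3 * (N * N) + 6 * N + 6 \<le> W"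
    and N: "6 * n \<le> N" "\<tau> < 3 * (N * N)" "\<forall>i k. A' i k \<longrightarrow> 6 * k + 5 < N"
    and A': "A' = mat_restrict n A" "B' = mat_restrict n B"
    and pr: "private_inv W b N n A B \<tau> G R \<mu>" and s: "\<forall>a<b. \<mu> a = fst s a"
    and inv: "play_inv N n A' B' \<tau> G R" and rep: "reports_MIS N G s"
    and uv: "pick N A' B' \<tau> (set (out_list s)) = (u, v)"
  defines "G' \<equiv> next_graph (u, v) G" and "R' \<equiv> next_found N \<tau> (set (out_list s)) R"
  shows "G' = G \<Longrightarrow> \<exists>t \<mu>'. t \<le> cost (play_com b) \<and>
      exec M (calls_of M D) (play_com b) (\<mu>, snd s) t (\<mu>', snd s) \<and>
      private_inv W b N n A B \<tau> G' R' \<mu>' \<and> (\<forall>a<b. \<mu>' a = fst s a)"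
    and "G' \<noteq> G \<Longrightarrow> exec MD no_calls (update_proc D) (present_edge u v s) t1 s' \<Longrightarrow>
      \<exists>t \<mu>'. t \<le> cost (play_com b) \<and>
      exec M (calls_of M D) (play_com b) (\<mu>, snd s) (t + t1) (\<mu>', snd s') \<and>
      private_inv W b N n A B \<tau> G' R' \<mu>' \<and> (\<forall>a<b. \<mu>' a = fst s' a)"
proof -
  let ?I = "set (out_list s)"
  have N0: "0 < N" using N(2) by (cases N) auto
  have W2: "2 \<le> W" and W6: "6 * N + 6 \<le> W" using M(4) by simp_all
  have mis: "is_MIS N G ?I" and dist: "distinct (out_list s)" using rep by (simp_all add: reports_MIS_def)
  have IN: "?I \<subseteq> {..<N}" using mis by (simp add: is_MIS_def independent_set_def)
  have inj: "N * N \<le> \<tau> \<and> \<tau> < 2 * (N * N) \<longrightarrow> inj_on (\<lambda>x. x mod 6) ?I"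
  proof
    assume "N * N \<le> \<tau> \<and> \<tau> < 2 * (N * N)"
    then have "game_inv N A' B' G R" using inv by (simp add: play_inv_def)
    from game_MIS_inj[OF this mis] show "inj_on (\<lambda>x. x mod 6) ?I" .
  qed
  have L: "out_list (\<mu>, snd s) = out_list s" using s b(1) by (simp add: out_list_def)
  have mem: "\<mu> b 0 = \<tau>" "\<mu> b 1 = N" "\<mu> b 2 = n" "\<mu> (b + 1) = mat_array n A" "\<mu> (b + 2) = mat_array n B"
    "small_memory W b \<mu>" "encodes_found N (\<mu> (b + 5)) R" "encodes_found N (\<mu> (b + 3)) (edge_pairs G)"
    using pr by (simp_all add: private_inv_def)
  note ch = run_choose_com[where \<mu> = \<mu> and \<omega> = "snd s", OF b(1) mem(1-5) N0 mem(6) M(4) L dist refl IN inj mem(7)]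
  define \<mu>1 where "\<mu>1 = run (choose_com b) \<mu>"
  have uv1: "\<mu>1 (b + 6) 0 = u" "\<mu>1 (b + 6) 1 = v"
    using ch(3) uv unfolding \<mu>1_def A' by simp_all
  have keep: "\<mu>1 a = \<mu> a" if "a \<notin> {b + 4, b + 5, b + 6}" for a
    using ch(2) that unfolding \<mu>1_def by blast
  have pr1: "private_inv W b N n A B \<tau> G R' \<mu>1"
    unfolding private_inv_def using ch(4,5) mem keep by (simp add: \<mu>1_def[symmetric] R'_def)
  have s1: "\<forall>a<b. \<mu>1 a = fst s a" using s keep by simp
  have k: "com_weight (choose_com b) \<le> k" "weight (new_edge_expr b) \<le> k" "com_weight (present_com b) \<le> k"
    using M(2) by (simp_all add: play_com_def)
  obtain tc where tc: "tc \<le> cost (choose_com b)"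
    "exec M (calls_of M D) (choose_com b) (\<mu>, snd s) tc (\<mu>1, snd s)"
    using exec_run[OF ch(1) k(1) M(3) W2, of "calls_of M D" "snd s"] unfolding \<mu>1_def by blast
  have sub: "G' \<subseteq> all_edges N"
    using play_inv_step(2)[OF inv mis N(2,3,1)] unfolding uv G'_def .
  have uvN: "u < N \<and> v < N" if "u \<noteq> v"
  proof -
    have "{u, v} \<in> all_edges N" using sub that by (simp add: G'_def next_graph_def)
    then show ?thesis using all_edges_less by blast
  qed
  have test: "tval \<mu>1 (new_edge_expr b) \<noteq> 0 \<longleftrightarrow> G' \<noteq> G"
    using tval_new_edge_expr[where W = W and \<mu> = \<mu>1, OF pr1 uv1 uvN] next_graph_eq_iff[of u v G]
    unfolding G'_def by blast
  have sm1: "small_memory W b \<mu>1" using pr1 by (simp add: private_inv_def)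
  have small: "small W \<mu>1 (new_edge_expr b)"
    using small_memoryD[OF sm1] W6 by (simp add: new_edge_expr_def)
  note cond = exec_cond_run[OF small k(2) M(3) W2]
  {
    assume "G' = G"
    with test have "exec M (calls_of M D) (Cond (new_edge_expr b) (Seq (present_com b) (Call Update)) Skip)
        (\<mu>1, snd s) (1 + 1) (\<mu>1, snd s)"
      by (intro cond) (simp add: exec.Skip del: One_nat_def)
    from exec.Seq[OF tc(2) this]
    have "exec M (calls_of M D) (play_com b) (\<mu>, snd s) (tc + (1 + 1)) (\<mu>1, snd s)"
      unfolding play_com_def .
    moreover have "tc + (1 + 1) \<le> cost (play_com b)" using tc(1) by (simp add: play_com_def)
    ultimately show "\<exists>t \<mu>'. t \<le> cost (play_com b) \<and>
      exec M (calls_of M D) (play_com b) (\<mu>, snd s) t (\<mu>', snd s) \<and>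
      private_inv W b N n A B \<tau> G' R' \<mu>' \<and> (\<forall>a<b. \<mu>' a = fst s a)"
      using pr1 s1 \<open>G' = G\<close> by blast
  }
  assume ne: "G' \<noteq> G" and D: "exec MD no_calls (update_proc D) (present_edge u v s) t1 s'"
  then have uv': "u \<noteq> v" "{u, v} \<notin> G" using next_graph_eq_iff[of u v G] unfolding G'_def by blast+
  then have G': "G' = insert {u, v} G" by (simp add: G'_def next_graph_def)
  define \<mu>2 where "\<mu>2 = run (present_com b) \<mu>1"
  have uvN': "u < N" "v < N" using uvN uv' by blast+
  note pres = run_present_com[where \<mu> = \<mu>1, OF b(1) pr1 uv1 uvN' W6 s1]
  obtain tp where tp: "tp \<le> cost (present_com b)"
    "exec M (calls_of M D) (present_com b) (\<mu>1, snd s) tp (\<mu>2, snd s)"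
    using exec_run[OF pres(1) k(3) M(3) W2, of "calls_of M D" "snd s"] unfolding \<mu>2_def by blast
  \<comment> \<open>Below \<open>b\<close> the memory already is what the update expects, so framing
    the algorithm's own run with the private arrays gives a run from \<open>\<mu>2\<close>.\<close>
  have "join b (fst (present_edge u v s)) \<mu>2 = \<mu>2"
    using pres(3) unfolding \<mu>2_def join_def by (auto simp: fun_eq_iff)
  moreover have "snd (present_edge u v s) = snd s" by (simp add: present_edge_def)
  ultimately have "exec MD no_calls (update_proc D) (\<mu>2, snd s) t1 (join b (fst s') \<mu>2, snd s')"
    using exec_join[OF D b(2), of \<mu>2] by simp
  then have "calls_of M D Update (\<mu>2, snd s) t1 (join b (fst s') \<mu>2, snd s')"
    using exec_mono[OF _ M(1)] by (simp add: calls_of_def)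
  from exec.Seq[OF tp(2) exec.Call[where Q = "calls_of M D" and p = Update, OF this]] ne test
  have "exec M (calls_of M D) (Cond (new_edge_expr b) (Seq (present_com b) (Call Update)) Skip)
        (\<mu>1, snd s) (1 + (tp + t1)) (join b (fst s') \<mu>2, snd s')"
    by (intro cond) simp
  from exec.Seq[OF tc(2) this]
  have "exec M (calls_of M D) (play_com b) (\<mu>, snd s) ((tc + 1 + tp) + t1) (join b (fst s') \<mu>2, snd s')"
    unfolding play_com_def by (simp add: add.assoc)
  moreover have "tc + 1 + tp \<le> cost (play_com b)" using tc(1) tp(1) by (simp add: play_com_def)
  moreover have "private_inv W b N n A B \<tau> G' R' (join b (fst s') \<mu>2)"
    by (rule private_inv_cong[where \<mu> = \<mu>2]) (use pres(2) in \<open>simp_all add: G' \<mu>2_def join_def\<close>)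
  moreover have "\<forall>a<b. join b (fst s') \<mu>2 a = fst s' a" by (simp add: join_def)
  ultimately show "\<exists>t \<mu>'. t \<le> cost (play_com b) \<and>
      exec M (calls_of M D) (play_com b) (\<mu>, snd s) (t + t1) (\<mu>', snd s') \<and>
      private_inv W b N n A B \<tau> G' R' \<mu>' \<and> (\<forall>a<b. \<mu>' a = fst s' a)" by blast
qed

text \<open>Couples the program with the abstract interaction: \<open>d\<close> and \<open>m\<close>
  are the time and the number of updates still to come. The last clause says that after history
  \<open>h\<close> the adversary continues like the remaining rounds. It must hold for all
  extensions \<open>h'\<close>, because the adversary is one fixed function that replays the whole
  history at every update.\<close>

definition loop_inv where
  "loop_inv MD D W b N n A B m0 \<tau> d \<sigma> \<longleftrightarrow> (\<exists>s G R h m.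
     snd s = snd \<sigma> \<and> (\<forall>a<b. fst \<sigma> a = fst s a) \<and> private_inv W b N n A B \<tau> G R (fst \<sigma>) \<and>
     play_inv N n (mat_restrict n A) (mat_restrict n B) \<tau> G R \<and> reports_MIS N G s \<and>
     (let adv = play N (mat_restrict n A) (mat_restrict n B) (3 * (N * N)) {} in
      serves MD D N adv G h s d m \<and> m + card G = m0 \<and>
      (\<forall>h'. adv (h @ h') = play N (mat_restrict n A) (mat_restrict n B) (3 * (N * N) - \<tau>) G
         (set (out_list s) # h'))))"

lemma exec_increment:
  assumes "private_inv W b N n A B \<tau> G R \<mu>" "Suc \<tau> \<le> W" "3 \<le> k" "W ^ k < M" "2 \<le> W"
  shows "\<exists>\<mu>'. exec M Q (increment b) (\<mu>, \<omega>) 1 (\<mu>', \<omega>) \<and>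
    private_inv W b N n A B (Suc \<tau>) G R \<mu>' \<and> (\<forall>a<b. \<mu>' a = \<mu> a)"
proof -
  let ?c = "increment b"
  have sm: "small_memory W b \<mu>" "\<mu> b 0 = \<tau>" using assms(1) by (simp_all add: private_inv_def)
  have safe: "safe W ?c \<mu>" using small_memoryD[OF sm(1)] assms(5) by simp
  obtain t where "t \<le> cost ?c" "exec M Q ?c (\<mu>, \<omega>) t (run ?c \<mu>, \<omega>)"
    using exec_run[OF safe _ assms(4,5), of Q \<omega>] assms(3) by auto
  moreover from this(2) have "t = 1" by (cases rule: exec.cases) simp_all
  moreover have "small_memory W b (run ?c \<mu>)"
    using small_memoryD[OF sm(1), of b] assms(2) sm(2) by (auto intro!: small_memory_upd[OF sm(1)])
  then have "private_inv W b N n A B (Suc \<tau>) G R (run ?c \<mu>)"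
    using assms(1) by (simp add: private_inv_def)
  moreover have "\<forall>a<b. run ?c \<mu> a = \<mu> a" by simp
  ultimately show ?thesis by metis
qed

text \<open>If the round produces a new edge, the adversary answers with this very edge, so the
  given derivation of \<open>serves\<close> must be an insertion of it. Its time moves from the
  budget \<open>d\<close> to the time of the program.\<close>

lemma loop_step:
  assumes b: "4 \<le> b" "arrays (update_proc D) \<subseteq> {..<b}"
    and M: "MD \<le> M" "com_weight (play_com b) \<le> k" "3 \<le> k" "W ^ k < M" "3 * (N * N) + 6 * N + 6 \<le> W"
    and N: "6 * n \<le> N" "\<tau> < 3 * (N * N)"
    and inv: "loop_inv MD D W b N n A B m0 \<tau> d \<sigma>"
  shows "\<exists>t \<sigma>' d'. exec M (calls_of M D)
      (Seq (play_com b) (increment b)) \<sigma> t \<sigma>' \<and>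
    loop_inv MD D W b N n A B m0 (Suc \<tau>) d' \<sigma>' \<and> t + d' \<le> d + (cost (play_com b) + 1)"
proof -
  define A' B' where "A' = mat_restrict n A" and "B' = mat_restrict n B"
  define adv where "adv = play N A' B' (3 * (N * N)) {}"
  obtain \<mu> \<omega> where \<sigma>: "\<sigma> = (\<mu>, \<omega>)" by fastforce
  from inv obtain s G R h m where
    s: "snd s = \<omega>" "\<forall>a<b. \<mu> a = fst s a" and pr: "private_inv W b N n A B \<tau> G R \<mu>" and
    pl: "play_inv N n A' B' \<tau> G R" and rep: "reports_MIS N G s" and
    sv: "serves MD D N adv G h s d m" and m: "m + card G = m0" and
    adv: "\<And>h'. adv (h @ h') = play N A' B' (3 * (N * N) - \<tau>) G (set (out_list s) # h')"
    unfolding loop_inv_def Let_def A'_def[symmetric] B'_def[symmetric] adv_def[symmetric] \<sigma> fst_conv snd_conv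
    by blast
  let ?I = "set (out_list s)"
  obtain u v where uv: "pick N A' B' \<tau> ?I = (u, v)" by fastforce
  define G' where "G' = next_graph (u, v) G"
  define R' where "R' = next_found N \<tau> ?I R"
  have fits: "\<forall>i k. A' i k \<longrightarrow> 6 * k + 5 < N" using N(1) by (auto simp: A'_def mat_restrict_def)
  have mis: "is_MIS N G ?I" using rep by (simp add: reports_MIS_def)
  note pl' = play_inv_step[OF pl mis N(2) fits N(1), unfolded uv, folded G'_def R'_def]
  have W2: "2 \<le> W" and W\<tau>: "Suc \<tau> \<le> W" using M(5) N(2) by simp_all
  \<comment> \<open>The program counts rounds upwards while \<open>play\<close> counts the remaining
    ones downwards; \<open>f\<close> translates between them.\<close>
  define f where "f = 3 * (N * N) - Suc \<tau>"
  have f: "3 * (N * N) - \<tau> = Suc f" "3 * (N * N) - Suc f = \<tau>" using N(2) by (simp_all add: f_def)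
  note play = exec_play_com[OF b M(1,2,4,5) N fits A'_def B'_def pr s(2) pl rep uv, folded G'_def R'_def]
  show ?thesis
  proof (cases "G' = G")
    case True
    obtain t \<mu>1 where 1: "t \<le> cost (play_com b)" "exec M (calls_of M D) (play_com b) (\<mu>, \<omega>) t (\<mu>1, \<omega>)"
      "private_inv W b N n A B \<tau> G R' \<mu>1" "\<forall>a<b. \<mu>1 a = fst s a"
      using play(1)[OF True] s(1) True by auto
    obtain \<mu>2 where 2: "exec M (calls_of M D) (increment b) (\<mu>1, \<omega>) 1 (\<mu>2, \<omega>)"
      "private_inv W b N n A B (Suc \<tau>) G R' \<mu>2" "\<forall>a<b. \<mu>2 a = \<mu>1 a"
      using exec_increment[OF 1(3) W\<tau> M(3,4) W2] by blast
    have "adv (h @ h') = play N A' B' (3 * (N * N) - Suc \<tau>) G (?I # h')" for h'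
      using adv[of h'] True unfolding f by (simp add: f(2)[simplified] uv G'_def f_def[symmetric] Let_def)
    moreover have "play_inv N n A' B' (Suc \<tau>) G R'" using pl'(1) True by simp
    moreover have "\<forall>a<b. \<mu>2 a = fst s a" using 2(3) 1(4) by simp
    ultimately have "loop_inv MD D W b N n A B m0 (Suc \<tau>) d (\<mu>2, \<omega>)"
      unfolding loop_inv_def Let_def A'_def[symmetric] B'_def[symmetric] adv_def[symmetric] fst_conv snd_conv
      using s(1) 2(2) rep sv m by blast
    moreover have "exec M (calls_of M D) (Seq (play_com b) (increment b))
        \<sigma> (t + 1) (\<mu>2, \<omega>)"
      unfolding \<sigma> by (rule exec.Seq[OF 1(2) 2(1)])
    moreover have "t + 1 + d \<le> d + (cost (play_com b) + 1)" using 1(1) by simp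
    ultimately show ?thesis by blast
  next
    case False
    then have ne: "u \<noteq> v" "{u, v} \<notin> G" using next_graph_eq_iff[of u v G] unfolding G'_def by blast+
    have G': "G' = insert {u, v} G" using ne by (simp add: G'_def next_graph_def)
    have new: "{u, v} \<in> all_edges N - G" using pl'(2) ne(2) unfolding G' by blast
    have "adv h = Some (u, v)"
      using adv[of "[]"] False unfolding f by (simp add: f(2)[simplified] uv G'_def Let_def)
    then have nxt: "next_edge N adv G h = Some (u, v)" using new by (simp add: next_edge_def)
    from sv obtain t1 s' t2 m' where
      D: "exec MD no_calls (update_proc D) (present_edge u v s) t1 s'" and
      rep': "reports_MIS N (insert {u, v} G) s'" and
      sv': "serves MD D N adv (insert {u, v} G) (h @ [set (out_list s')]) s' t2 m'" and
      d: "d = t1 + t2" "m = Suc m'"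
      by (cases rule: serves.cases) (use nxt in auto)
    obtain t \<mu>1 where 1: "t \<le> cost (play_com b)"
      "exec M (calls_of M D) (play_com b) (\<mu>, \<omega>) (t + t1) (\<mu>1, snd s')"
      "private_inv W b N n A B \<tau> G' R' \<mu>1" "\<forall>a<b. \<mu>1 a = fst s' a"
      using play(2)[OF False D] s(1) by auto
    obtain \<mu>2 where 2: "exec M (calls_of M D) (increment b) (\<mu>1, snd s') 1 (\<mu>2, snd s')"
      "private_inv W b N n A B (Suc \<tau>) G' R' \<mu>2" "\<forall>a<b. \<mu>2 a = \<mu>1 a"
      using exec_increment[OF 1(3) W\<tau> M(3,4) W2] by blast
    have "adv ((h @ [set (out_list s')]) @ h') = play N A' B' (3 * (N * N) - Suc \<tau>) G' (set (out_list s') # h')" for h'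
      using adv[of "set (out_list s') # h'"] False unfolding f
      by (simp add: f(2)[simplified] uv G'_def f_def[symmetric] Let_def)
    moreover have "m' + card G' = m0"
    proof -
      have "finite G" using finite_subset[OF _ finite_all_edges, of G N] pl'(2) unfolding G' by simp
      then show ?thesis using m d(2) ne(2) by (simp add: G')
    qed
    moreover have "\<forall>a<b. \<mu>2 a = fst s' a" using 2(3) 1(4) by simp
    ultimately have "loop_inv MD D W b N n A B m0 (Suc \<tau>) t2 (\<mu>2, snd s')"
      unfolding loop_inv_def Let_def A'_def[symmetric] B'_def[symmetric] adv_def[symmetric] fst_conv snd_conv
      using 2(2) pl'(1) rep'[folded G'] sv'[folded G'] by blast
    moreover have "exec M (calls_of M D) (Seq (play_com b) (increment b))
        \<sigma> (t + t1 + 1) (\<mu>2, snd s')"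
      unfolding \<sigma> by (rule exec.Seq[OF 1(2) 2(1)])
    moreover have "t + t1 + 1 + t2 \<le> d + (cost (play_com b) + 1)" using 1(1) d(1) by simp
    ultimately show ?thesis by blast
  qed
qed

lemma exec_counter_test:
  assumes "small W \<mu> e" "weight e + 1 \<le> k" "W ^ k < M" "2 \<le> W" "\<mu> b 0 \<le> W"
  shows "aval M \<mu> (Op LessThan (counter b) e) = Some (of_bool (\<mu> b 0 < tval \<mu> e))"
  using aval_tval[of W \<mu> "Op LessThan (counter b) e" M] assms weight_bound[OF assms(3,4,2)] by simp

lemma loop_inv_private: "loop_inv MD D W b N n A B m0 \<tau> d \<sigma> \<Longrightarrow> \<exists>G R. private_inv W b N n A B \<tau> G R (fst \<sigma>)"
  unfolding loop_inv_def by blast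

lemma play_loop:
  assumes b: "4 \<le> b" "arrays (update_proc D) \<subseteq> {..<b}"
    and M: "MD \<le> M" "com_weight (play_com b) \<le> k" "4 \<le> k" "W ^ k < M" "3 * (N * N) + 6 * N + 6 \<le> W"
    and N: "6 * n \<le> N"
    and inv: "loop_inv MD D W b N n A B m0 0 d \<sigma>"
  shows "\<exists>t \<sigma>' d'. exec M (calls_of M D)
      (counting_loop b (Op Times (Lit 3) (square (order_N b))) (play_com b)) \<sigma> t \<sigma>' \<and>
    loop_inv MD D W b N n A B m0 (3 * (N * N)) d' \<sigma>' \<and>
    t + d' \<le> d + 3 * (N * N) * (cost (play_com b) + 2) + 1"
proof -
  have cond: "aval M (fst \<sigma>) (Op LessThan (counter b) (Op Times (Lit 3) (square (order_N b)))) =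
      Some (of_bool (\<tau> < 3 * (N * N)))"
    if li: "loop_inv MD D W b N n A B m0 \<tau> d \<sigma>" and le: "\<tau> \<le> 3 * (N * N)" for \<tau> d \<sigma>
  proof -
    obtain G R where pr: "private_inv W b N n A B \<tau> G R (fst \<sigma>)" using loop_inv_private[OF li] by blast
    then have sm: "small_memory W b (fst \<sigma>)" and mem: "fst \<sigma> b 0 = \<tau>" "fst \<sigma> b 1 = N"
      by (simp_all add: private_inv_def)
    have small: "small W (fst \<sigma>) (Op Times (Lit 3) (square (order_N b)))"
      using small_memoryD[OF sm] M(5) by simp
    from exec_counter_test[OF small _ M(4), of b] show ?thesis
      using M(3,5) mem le by simp
  qed
  have "3 \<le> k" using M(3) by simp
  note step = loop_step[OF b M(1,2) this M(4,5) N]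
  show ?thesis unfolding counting_loop_def
    using exec_counting_loop[where P = "loop_inv MD D W b N n A B m0" and i = 0 and X = "3 * (N * N)" and
        K = "cost (play_com b) + 1", OF step cond inv] by simp
qed

section \<open>Copying the input and writing the output\<close>

definition copy_inv :: "nat \<Rightarrow> nat \<Rightarrow> nat \<Rightarrow> bool_matrix \<Rightarrow> bool_matrix \<Rightarrow> nat \<Rightarrow> memory \<Rightarrow> bool" where
  "copy_inv b N n A B i \<mu> \<longleftrightarrow> \<mu> b 0 = i \<and> \<mu> b 1 = N \<and> \<mu> b 2 = n \<and> (\<forall>j>2. \<mu> b j = 0) \<and>
     \<mu> (b + 1) = (\<lambda>j. if j < i then mat_array n A j else 0) \<and>
     \<mu> (b + 2) = (\<lambda>j. if j < i then mat_array n B j else 0) \<and>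
     \<mu> 1 = (\<lambda>j. if j < i then 0 else mat_array n A j) \<and>
     \<mu> 2 = (\<lambda>j. if j < i then 0 else mat_array n B j) \<and>
     \<mu> 0 = (\<lambda>j. if j = 0 then n else 0) \<and>
     (\<forall>a. a \<notin> {0, 1, 2, b, b + 1, b + 2} \<longrightarrow> \<mu> a = (\<lambda>j. 0))"

lemma copy_inv_small:
  assumes "copy_inv b N n A B i \<mu>" "i \<le> W" "N \<le> W" "n \<le> N" "1 \<le> W" "4 \<le> b"
  shows "\<mu> a j \<le> W"
proof -
  have mat: "mat_array n A j \<le> W" "mat_array n B j \<le> W"
    using mat_array_le[of n A j] mat_array_le[of n B j] assms(5) by linarith+
  have row: "\<mu> b j \<le> W"
  proof -
    consider "j = 0" | "j = 1" | "j = 2" | "j > 2" by linarith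
    then show ?thesis using assms by cases (auto simp: copy_inv_def)
  qed
  consider "a = 0" | "a = 1" | "a = 2" | "a = b" | "a = b + 1" | "a = b + 2" |
    "a \<notin> {0, 1, 2, b, b + 1, b + 2}" by blast
  then show ?thesis by cases (use assms mat row in \<open>simp_all add: copy_inv_def\<close>)
qed

lemma copy_step:
  assumes b: "4 \<le> b" and inv: "copy_inv b N n A B i \<mu>" and i: "i < n * n"
    and W: "n * n \<le> W" "N \<le> W" "n \<le> N" "2 \<le> W"
    and k: "com_weight (copy_com b) + 4 \<le> k" "W ^ k < M"
  shows "\<exists>t \<mu>'. exec M Q (Seq (copy_com b) (increment b)) (\<mu>, \<omega>) t (\<mu>', \<omega>) \<and>
    copy_inv b N n A B (Suc i) \<mu>' \<and> t \<le> cost (copy_com b) + 1"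
proof -
  let ?c = "Seq (copy_com b) (increment b)"
  have iW: "i \<le> W" and W1: "1 \<le> W" using i W by linarith+
  note sm = copy_inv_small[OF inv iW W(2,3) W1 b]
  have mem: "\<mu> b 0 = i" "\<mu> 1 i = mat_array n A i" "\<mu> 2 i = mat_array n B i"
    using inv by (simp_all add: copy_inv_def)
  have safe: "safe W ?c \<mu>"
    using b sm W1 mem sm[of 1 i] sm[of 2 i] iW by (simp add: copy_com_def)
  have w: "com_weight ?c \<le> k" using k(1) by simp
  obtain t where t: "t \<le> cost ?c" "exec M Q ?c (\<mu>, \<omega>) t (run ?c \<mu>, \<omega>)"
    using exec_run[OF safe w k(2) W(4), of Q \<omega>] by blast
  have run: "run ?c \<mu> = \<mu>(b + 1 := (\<mu> (b + 1))(i := mat_array n A i), b + 2 := (\<mu> (b + 2))(i := mat_array n B i),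
      1 := (\<mu> 1)(i := 0), 2 := (\<mu> 2)(i := 0), b := (\<mu> b)(0 := Suc i))"
    using b mem by (simp add: copy_com_def fun_eq_iff)
  have "copy_inv b N n A B (Suc i) (run ?c \<mu>)"
    using inv b unfolding run copy_inv_def by (simp add: fun_eq_iff less_Suc_eq)
  with t show ?thesis by (intro exI[of _ t] exI[of _ "run ?c \<mu>"]) simp
qed

lemma copy_loop:
  assumes b: "4 \<le> b" and inv: "copy_inv b N n A B 0 \<mu>"
    and W: "n * n \<le> W" "N \<le> W" "n \<le> N" "2 \<le> W"
    and k: "com_weight (copy_com b) + 4 \<le> k" "W ^ k < M"
  shows "\<exists>t \<mu>'. exec M Q (counting_loop b (square (dim_n b)) (copy_com b)) (\<mu>, \<omega>) t (\<mu>', \<omega>) \<and>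
    copy_inv b N n A B (n * n) \<mu>' \<and> t \<le> n * n * (cost (copy_com b) + 2) + 1"
proof -
  define P where "P i d \<sigma> \<longleftrightarrow> d = 0 \<and> snd \<sigma> = \<omega> \<and> copy_inv b N n A B i (fst \<sigma>)" for i d :: nat and \<sigma> :: state
  have W1: "1 \<le> W" using W(4) by simp
  have "\<exists>t \<sigma>' d'. exec M Q (While (Op LessThan (counter b) (square (dim_n b)))
      (Seq (copy_com b) (increment b))) (\<mu>, \<omega>) t \<sigma>' \<and> P (n * n) d' \<sigma>' \<and>
      t + d' \<le> 0 + (n * n - 0) * ((cost (copy_com b) + 1) + 1) + 1"
  proof (rule exec_counting_loop)
    fix i d \<sigma> assume i: "i < n * n" and "P i d \<sigma>"
    then have \<sigma>: "\<sigma> = (fst \<sigma>, \<omega>)" "copy_inv b N n A B i (fst \<sigma>)" "d = 0" by (auto simp: P_def)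
    from copy_step[OF b \<sigma>(2) i W k, of Q \<omega>] obtain t \<mu>' where
      "exec M Q (Seq (copy_com b) (increment b)) \<sigma> t (\<mu>', \<omega>)"
      "copy_inv b N n A B (Suc i) \<mu>'" "t \<le> cost (copy_com b) + 1"
      using \<sigma>(1) by metis
    then show "\<exists>t \<sigma>' d'. exec M Q (Seq (copy_com b) (increment b)) \<sigma> t \<sigma>' \<and>
        P (Suc i) d' \<sigma>' \<and> t + d' \<le> d + (cost (copy_com b) + 1)"
      by (intro exI[of _ t] exI[of _ "(\<mu>', \<omega>)"] exI[of _ 0]) (simp add: P_def)
  next
    fix i d \<sigma> assume P: "P i d \<sigma>" and i: "i \<le> n * n"
    then have inv: "copy_inv b N n A B i (fst \<sigma>)" by (simp add: P_def)
    have iW: "i \<le> W" using i W(1) by simp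
    note sm = copy_inv_small[OF inv iW W(2,3) W1 b]
    have small: "small W (fst \<sigma>) (square (dim_n b))" using sm W(4) by simp
    have "weight (square (dim_n b)) + 1 \<le> k" using k(1) by simp
    from exec_counter_test[OF small this k(2) W(4) sm]
    show "aval M (fst \<sigma>) (Op LessThan (counter b) (square (dim_n b))) = Some (of_bool (i < n * n))"
      using inv by (simp add: copy_inv_def)
  qed (use inv in \<open>simp_all add: P_def\<close>)
  then obtain t \<sigma>' d' where r: "exec M Q (While (Op LessThan (counter b) (square (dim_n b)))
      (Seq (copy_com b) (increment b))) (\<mu>, \<omega>) t \<sigma>'" "P (n * n) d' \<sigma>'"
      "t + d' \<le> 0 + (n * n - 0) * ((cost (copy_com b) + 1) + 1) + 1" by blast
  then have "\<sigma>' = (fst \<sigma>', \<omega>)" "copy_inv b N n A B (n * n) (fst \<sigma>')" by (auto simp: P_def)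
  moreover have "t \<le> n * n * (cost (copy_com b) + 2) + 1" using r(3) by simp
  ultimately show ?thesis using r(1) unfolding counting_loop_def by metis
qed

definition output_inv where
  "output_inv W b N n A B G R i \<mu> \<longleftrightarrow> private_inv W b N n A B i G R \<mu> \<and>
     (\<forall>j<i. \<mu> 3 j = of_bool ((j div n, j mod n) \<in> R))"

lemma output_step:
  assumes b: "4 \<le> b" and inv: "output_inv W b N n A B G R i \<mu>" and i: "i < n * n"
    and W: "n * n \<le> W" "n \<le> N" "2 \<le> W"
    and k: "com_weight (output_com b) + 4 \<le> k" "W ^ k < M"
  shows "\<exists>t \<mu>'. exec M Q (Seq (output_com b) (increment b)) (\<mu>, \<omega>) t (\<mu>', \<omega>) \<and>
    output_inv W b N n A B G R (Suc i) \<mu>' \<and> t \<le> 2"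
proof -
  have pr: "private_inv W b N n A B i G R \<mu>" using inv by (simp add: output_inv_def)
  then have mem: "\<mu> b 0 = i" "\<mu> b 1 = N" "\<mu> b 2 = n" "encodes_found N (\<mu> (b + 5)) R" and
    sm: "small_memory W b \<mu>" by (simp_all add: private_inv_def)
  have n: "0 < n" using i by (cases n) auto
  have ij: "i div n < N" "i mod n < N" using i n W(2) less_mult_imp_div_less[of i n n]
    mod_less_divisor[OF n, of i] by linarith+
  define x where "x = \<mu> (b + 5) (i div n * N + i mod n)"
  have x: "x = of_bool ((i div n, i mod n) \<in> R)"
    using mem(4) ij by (simp add: encodes_found_def x_def)
  define \<mu>1 where "\<mu>1 = \<mu>(3 := (\<mu> 3)(i := x))"
  have run: "run (output_com b) \<mu> = \<mu>1"
    using mem by (simp add: output_com_def \<mu>1_def x_def)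
  have "safe W (output_com b) \<mu>" using small_memoryD[OF sm] W(3) by (simp add: output_com_def)
  then obtain t1 where t1: "t1 \<le> 1" "exec M Q (output_com b) (\<mu>, \<omega>) t1 (\<mu>1, \<omega>)"
    using exec_run[of W "output_com b" \<mu> k M Q \<omega>] k W(3) unfolding run by (auto simp: output_com_def)
  have pr1: "private_inv W b N n A B i G R \<mu>1"
    by (rule private_inv_cong[OF pr]) (use b in \<open>simp add: \<mu>1_def\<close>)
  have "Suc i \<le> W" "3 \<le> k" using i W(1) k(1) by simp_all
  from exec_increment[OF pr1 this k(2) W(3), of Q \<omega>] obtain \<mu>2 where
    2: "exec M Q (increment b) (\<mu>1, \<omega>) 1 (\<mu>2, \<omega>)"
    "private_inv W b N n A B (Suc i) G R \<mu>2" "\<forall>a<b. \<mu>2 a = \<mu>1 a" by blast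
  have "\<mu>2 3 = \<mu>1 3" using 2(3) b by simp
  then have "output_inv W b N n A B G R (Suc i) \<mu>2"
    using inv 2(2) x by (simp add: output_inv_def \<mu>1_def less_Suc_eq)
  with exec.Seq[OF t1(2) 2(1)] t1(1) show ?thesis by (intro exI[of _ "t1 + 1"] exI[of _ \<mu>2]) simp
qed

lemma output_loop:
  assumes b: "4 \<le> b" and pr: "private_inv W b N n A B 0 G R \<mu>"
    and W: "n * n \<le> W" "n \<le> N" "2 \<le> W"
    and k: "com_weight (output_com b) + 4 \<le> k" "W ^ k < M"
  shows "\<exists>t \<mu>'. exec M Q (counting_loop b (square (dim_n b)) (output_com b)) (\<mu>, \<omega>) t (\<mu>', \<omega>) \<and>
    (\<forall>j<n * n. \<mu>' 3 j = of_bool ((j div n, j mod n) \<in> R)) \<and> t \<le> n * n * 3 + 1"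
proof -
  define P where "P i d \<sigma> \<longleftrightarrow> d = 0 \<and> snd \<sigma> = \<omega> \<and> output_inv W b N n A B G R i (fst \<sigma>)"
    for i d :: nat and \<sigma> :: state
  have "\<exists>t \<sigma>' d'. exec M Q (While (Op LessThan (counter b) (square (dim_n b)))
      (Seq (output_com b) (increment b))) (\<mu>, \<omega>) t \<sigma>' \<and> P (n * n) d' \<sigma>' \<and>
      t + d' \<le> 0 + (n * n - 0) * (2 + 1) + 1"
  proof (rule exec_counting_loop)
    fix i d \<sigma> assume i: "i < n * n" and "P i d \<sigma>"
    then have \<sigma>: "\<sigma> = (fst \<sigma>, \<omega>)" "output_inv W b N n A B G R i (fst \<sigma>)" "d = 0" by (auto simp: P_def)
    from output_step[OF b \<sigma>(2) i W k, of Q \<omega>] obtain t \<mu>' where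
      "exec M Q (Seq (output_com b) (increment b)) \<sigma> t (\<mu>', \<omega>)"
      "output_inv W b N n A B G R (Suc i) \<mu>'" "t \<le> 2"
      using \<sigma>(1) by metis
    then show "\<exists>t \<sigma>' d'. exec M Q (Seq (output_com b) (increment b)) \<sigma> t \<sigma>' \<and>
        P (Suc i) d' \<sigma>' \<and> t + d' \<le> d + 2"
      by (intro exI[of _ t] exI[of _ "(\<mu>', \<omega>)"] exI[of _ 0]) (simp add: P_def)
  next
    fix i d \<sigma> assume P: "P i d \<sigma>" and i: "i \<le> n * n"
    then have pr: "private_inv W b N n A B i G R (fst \<sigma>)" by (simp add: P_def output_inv_def)
    then have sm: "small_memory W b (fst \<sigma>)" by (simp add: private_inv_def)
    have small: "small W (fst \<sigma>) (square (dim_n b))" using small_memoryD[OF sm] W(3) by simp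
    have w: "weight (square (dim_n b)) + 1 \<le> k" using k(1) by simp
    from exec_counter_test[OF small w k(2) W(3) small_memoryD[OF sm order.refl]]
    show "aval M (fst \<sigma>) (Op LessThan (counter b) (square (dim_n b))) = Some (of_bool (i < n * n))"
      using pr by (simp add: private_inv_def)
  qed (use pr in \<open>simp_all add: P_def output_inv_def\<close>)
  then obtain t \<sigma>' d' where r: "exec M Q (While (Op LessThan (counter b) (square (dim_n b)))
      (Seq (output_com b) (increment b))) (\<mu>, \<omega>) t \<sigma>'" "P (n * n) d' \<sigma>'"
      "t + d' \<le> 0 + (n * n - 0) * (2 + 1) + 1" by blast
  then have "\<sigma>' = (fst \<sigma>', \<omega>)" "\<forall>j<n * n. fst \<sigma>' 3 j = of_bool ((j div n, j mod n) \<in> R)"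
    by (auto simp: P_def output_inv_def)
  moreover have "t \<le> n * n * 3 + 1" using r(3) by simp
  ultimately show ?thesis using r(1) unfolding counting_loop_def by metis
qed

lemma exec_reset:
  assumes "private_inv W b N n A B \<tau> G R \<mu>" "2 \<le> M"
  shows "\<exists>\<mu>'. exec M Q (reset_com b) (\<mu>, \<omega>) 1 (\<mu>', \<omega>) \<and>
    private_inv W b N n A B 0 G R \<mu>' \<and> (\<forall>a<b. \<mu>' a = \<mu> a)"
proof (intro exI conjI)
  let ?\<mu> = "\<mu>(b := (\<mu> b)(0 := 0))"
  show "exec M Q (reset_com b) (\<mu>, \<omega>) 1 (?\<mu>, \<omega>)" unfolding reset_com_def
    by (rule exec.Store) (use assms(2) in \<open>simp_all add: word_def\<close>)
  have sm: "small_memory W b \<mu>" using assms(1) by (simp add: private_inv_def)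
  have "small_memory W b ?\<mu>" using small_memoryD[OF sm, of b] by (auto intro!: small_memory_upd[OF sm])
  then show "private_inv W b N n A B 0 G R ?\<mu>" using assms(1) by (simp add: private_inv_def)
  show "\<forall>a<b. ?\<mu> a = \<mu> a" by simp
qed

text \<open>The coefficients of \<open>N * N\<close> in the three loops:
  \<open>cost (copy_com b) + 2\<close> for copying, \<open>3 * (cost (play_com b) + 2)\<close> for
  playing and 3 for the output.\<close>

definition overhead :: "nat \<Rightarrow> nat" where
  "overhead b = cost (copy_com b) + 3 * cost (play_com b) + 11"

lemma copy_inv_setup:
  assumes b: "4 \<le> b" and W: "6 * n + r \<le> W" "6 \<le> W" and k: "com_weight (setup_com r b) \<le> k" "W ^ k < M"
  shows "\<exists>t \<mu>. exec M Q (setup_com r b) (bmm_input n A B, \<omega>) t (\<mu>, \<omega>) \<and> t \<le> 3 \<and>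
    copy_inv b (6 * n + r) n A B 0 \<mu>"
proof -
  let ?\<mu> = "bmm_input n A B"
  have le: "?\<mu> a i \<le> W" for a i using W by (simp add: bmm_input_def)
  have n: "?\<mu> 0 0 = n" by (simp add: bmm_input_def)
  have safe: "safe W (setup_com r b) ?\<mu>"
    using le W b n by (simp add: setup_com_def)
  have W2: "2 \<le> W" using W by simp
  obtain t where t: "t \<le> cost (setup_com r b)" "exec M Q (setup_com r b) (?\<mu>, \<omega>) t (run (setup_com r b) ?\<mu>, \<omega>)"
    using exec_run[OF safe k W2, of Q \<omega>] by blast
  have run: "run (setup_com r b) ?\<mu> = ?\<mu>(b := (?\<mu> b)(0 := 0, 1 := 6 * n + r, 2 := n))"
    using b n by (simp add: setup_com_def fun_eq_iff)
  have zero: "?\<mu> a = (\<lambda>j. 0)" if "a \<notin> {0, 1, 2}" for a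
    using that by (simp add: bmm_input_def fun_eq_iff)
  have "?\<mu> 1 = mat_array n A" "?\<mu> 2 = mat_array n B" "?\<mu> 0 = (\<lambda>j. if j = 0 then n else 0)"
    by (auto simp: bmm_input_def mat_array_def fun_eq_iff)
  moreover have "?\<mu> b = (\<lambda>j. 0)" "?\<mu> (b + 1) = (\<lambda>j. 0)" "?\<mu> (b + 2) = (\<lambda>j. 0)"
    using b by (intro zero; simp)+
  ultimately have "copy_inv b (6 * n + r) n A B 0 (run (setup_com r b) ?\<mu>)"
    unfolding run copy_inv_def using b zero by simp
  moreover have "t \<le> 3" using t(1) by (simp add: setup_com_def)
  ultimately show ?thesis using t(2) by blast
qed

lemma mis_input_after_copy:
  assumes b: "4 \<le> b" and inv: "copy_inv b N n A B (n * n) \<mu>" and a: "a < b"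
  shows "(\<mu>(0 := (\<mu> 0)(0 := N))) a = mis_input N {} a"
proof -
  have z: "(if j < n * n then 0 else mat_array n C j) = 0" for C j by (simp add: mat_array_def)
  have "\<mu> 1 = (\<lambda>j. 0)" "\<mu> 2 = (\<lambda>j. 0)" "\<mu> 0 = (\<lambda>j. if j = 0 then n else 0)"
    using inv unfolding copy_inv_def z by blast+
  moreover have "\<mu> a = (\<lambda>j. 0)" if "a \<notin> {0, 1, 2}"
    using inv that a unfolding copy_inv_def by simp
  moreover consider "a = 0" | "a = 1" | "a = 2" | "a \<notin> {0, 1, 2}" by blast
  ultimately show ?thesis unfolding mis_input_def
    by (cases "a \<in> {0, 1, 2}") (auto simp: fun_eq_iff)
qed

lemma output_correct:
  assumes "\<forall>j<n * n. \<mu> 3 j = of_bool ((j div n, j mod n) \<in> R)"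
    and "sound (mat_restrict n A) (mat_restrict n B) R"
    and "complete n (mat_restrict n A) (mat_restrict n B) R"
  shows "bmm_output_correct n A B \<mu>"
  unfolding bmm_output_correct_def
proof (intro allI impI)
  fix i j assume ij: "i < n" "j < n"
  have "\<mu> 3 (i * n + j) = of_bool ((i, j) \<in> R)"
    using assms(1)[rule_format, OF index_pair_less[OF ij]] ij by simp
  moreover have "(i, j) \<in> R \<longleftrightarrow> true_pair (mat_restrict n A) (mat_restrict n B) i j"
    using assms(2,3) ij unfolding sound_def complete_def by blast
  moreover have "true_pair (mat_restrict n A) (mat_restrict n B) i j \<longleftrightarrow> (\<exists>k<n. A i k \<and> B k j)"
    using ij unfolding true_pair_def mat_restrict_def by blast
  ultimately show "\<mu> 3 (i * n + j) = of_bool (\<exists>k<n. A i k \<and> B k j)" by simp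
qed

text \<open>Follows one successful interaction through the program on the same coin tosses. The
  number of updates is forced, because the graph grows from empty to complete by one edge per
  update.\<close>

lemma reduction_correct:
  fixes n r :: nat and A B :: "nat \<Rightarrow> nat \<Rightarrow> bool"
  defines "N \<equiv> 6 * n + r"
  assumes b: "4 \<le> b" "arrays (init_proc D) \<subseteq> {..<b}" "arrays (update_proc D) \<subseteq> {..<b}"
    and M: "MD \<le> M" "com_weight (reduction r b) \<le> k" "W ^ k < M" "3 * (N * N) + 6 * N + 6 \<le> W"
    and run: "maintains_MIS MD D N {}
      (play N (mat_restrict n A) (mat_restrict n B) (3 * (N * N)) {}) \<omega> t m"
  shows "m = card (all_edges N)"
    and "\<exists>t' s'. exec M no_calls (link D (reduction r b)) (bmm_input n A B, \<omega>) t' s' \<and>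
      bmm_output_correct n A B (fst s') \<and> t' \<le> t + overhead b * (N * N + 1)"
proof -
  let ?A = "mat_restrict n A" and ?B = "mat_restrict n B"
  let ?adv = "play N ?A ?B (3 * (N * N)) {}"
  let ?Q = "calls_of M D"
  from run obtain t0 t1 s where D: "exec MD no_calls (init_proc D) (mis_input N {}, \<omega>) t0 s" and
    rep: "reports_MIS N {} s" and sv: "serves MD D N ?adv {} [set (out_list s)] s t1 m" and t: "t = t0 + t1"
    unfolding maintains_MIS_def by blast
  have nN: "n \<le> N" "6 * n \<le> N" by (simp_all add: N_def)
  have nn: "n * n \<le> N * N" using nN(1) by (intro mult_le_mono)
  have W: "n * n \<le> W" "N \<le> W" "6 * n + r \<le> W" "6 \<le> W" "2 \<le> W" using M(4) nn nN by (simp_all add: N_def)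
  have k: "com_weight (setup_com r b) \<le> k" "com_weight (copy_com b) + 4 \<le> k" "com_weight (play_com b) \<le> k"
    "com_weight (output_com b) + 4 \<le> k" "4 \<le> k" "2 \<le> k"
    using M(2) by (simp_all add: reduction_def counting_loop_def)
  have M2: "2 \<le> M"
  proof -
    have "W ^ 1 \<le> W ^ k" using W(5) k(6) by (intro power_increasing) simp_all
    then show ?thesis using M(3) W(5) by simp
  qed
  obtain ta \<mu>0 where e0: "exec M ?Q (setup_com r b) (bmm_input n A B, \<omega>) ta (\<mu>0, \<omega>)" "ta \<le> 3"
    "copy_inv b N n A B 0 \<mu>0"
    using copy_inv_setup[OF b(1) W(3,4) k(1) M(3), of ?Q A B \<omega>] unfolding N_def by blast
  obtain tb \<mu>1 where e1: "exec M ?Q (counting_loop b (square (dim_n b)) (copy_com b)) (\<mu>0, \<omega>) tb (\<mu>1, \<omega>)"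
    "copy_inv b N n A B (n * n) \<mu>1" "tb \<le> n * n * (cost (copy_com b) + 2) + 1"
    using copy_loop[OF b(1) e0(3) W(1,2) nN(1) W(5) k(2) M(3), of ?Q \<omega>] by blast
  have mem1: "\<mu>1 b 1 = N" using e1(2) by (simp add: copy_inv_def)
  have W1: "1 \<le> W" using W(5) by simp
  note sm1 = copy_inv_small[OF e1(2) W(1,2) nN(1) W1 b(1)]
  define \<mu>2 where "\<mu>2 = \<mu>1(0 := (\<mu>1 0)(0 := N))"
  have e2: "exec M ?Q (Store 0 (Lit 0) (order_N b)) (\<mu>1, \<omega>) 1 (\<mu>2, \<omega>)"
  proof -
    have "W ^ 1 \<le> W ^ k" using W(5) k(6) by (intro power_increasing) simp_all
    then have "N < M" using M(3) W(2) by simp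
    then show ?thesis unfolding \<mu>2_def using M2 mem1 by (intro exec.Store) (simp_all add: word_def)
  qed
  have "join b (mis_input N {}) \<mu>2 = \<mu>2"
  proof
    fix a show "join b (mis_input N {}) \<mu>2 a = \<mu>2 a"
      using mis_input_after_copy[OF b(1) e1(2), of a] unfolding join_def \<mu>2_def
      by (simp del: fun_upd_apply)
  qed
  then have "exec MD no_calls (init_proc D) (\<mu>2, \<omega>) t0 (join b (fst s) \<mu>2, snd s)"
    using exec_join[OF D b(2), of \<mu>2] by simp
  then have "calls_of M D Init (\<mu>2, \<omega>) t0 (join b (fst s) \<mu>2, snd s)"
    using exec_mono[OF _ M(1)] by (simp add: calls_of_def)
  then have e3: "exec M ?Q (Call Init) (\<mu>2, \<omega>) t0 (join b (fst s) \<mu>2, snd s)" by (rule exec.Call)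
  define \<mu>3 where "\<mu>3 = join b (fst s) \<mu>2"
  have high3: "\<mu>3 a = \<mu>1 a" if "b \<le> a" for a
    using that b(1) by (simp add: \<mu>3_def join_def \<mu>2_def)
  have pr3: "private_inv W b N n A B (n * n) {} {} \<mu>3"
  proof -
    have "(\<lambda>j. if j < n * n then mat_array n C j else 0) = mat_array n C" for C
      by (auto simp: mat_array_def fun_eq_iff)
    then have "private_inv W b N n A B (n * n) {} {} \<mu>1"
      using e1(2) sm1 b(1)
      by (simp add: copy_inv_def private_inv_def encodes_found_def edge_pairs_def small_memory_def)
    then show ?thesis by (rule private_inv_cong) (rule high3)
  qed
  obtain \<mu>4 where e4: "exec M ?Q (reset_com b) (\<mu>3, snd s) 1 (\<mu>4, snd s)"
    "private_inv W b N n A B 0 {} {} \<mu>4" "\<forall>a<b. \<mu>4 a = \<mu>3 a"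
    using exec_reset[OF pr3 M2, of ?Q "snd s"] by blast
  have low4: "\<forall>a<b. \<mu>4 a = fst s a" using e4(3) by (simp add: \<mu>3_def join_def)
  have fits: "\<forall>i k. ?A i k \<longrightarrow> 6 * k + 5 < N" using nN(2) by (auto simp: mat_restrict_def)
  have pl: "play_inv N n ?A ?B 0 {} {}"
    using play_invI0[OF fits nN(2), of 0 ?B] by (simp add: wanted_edges_0)
  have li: "loop_inv MD D W b N n A B m 0 t1 (\<mu>4, snd s)"
    unfolding loop_inv_def Let_def fst_conv snd_conv
    by (intro exI[of _ s] exI[of _ "{}"] exI[of _ "[set (out_list s)]"] exI[of _ m] conjI)
      (use low4 e4(2) pl rep sv in simp_all)
  obtain te \<sigma> d' where e5: "exec M ?Q (counting_loop b (Op Times (Lit 3) (square (order_N b))) (play_com b))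
      (\<mu>4, snd s) te \<sigma>" "loop_inv MD D W b N n A B m (3 * (N * N)) d' \<sigma>"
      "te + d' \<le> t1 + 3 * (N * N) * (cost (play_com b) + 2) + 1"
    using play_loop[OF b(1,3) M(1) k(3,5) M(3,4) nN(2) li] by blast
  obtain s5 G R h m5 where 5: "private_inv W b N n A B (3 * (N * N)) G R (fst \<sigma>)"
     "play_inv N n ?A ?B (3 * (N * N)) G R" "serves MD D N ?adv G h s5 d' m5" "m5 + card G = m"
     "\<forall>h'. ?adv (h @ h') = play N ?A ?B (3 * (N * N) - 3 * (N * N)) G (set (out_list s5) # h')"
    using e5(2) unfolding loop_inv_def Let_def by blast
  note final = play_inv_final[OF 5(2)]
  \<comment> \<open>With all rounds used up, \<open>play\<close> has no fuel left, so no update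
    remains.\<close>
  have "?adv h = None" using 5(5)[rule_format, of "[]"] by simp
  then have "next_edge N ?adv G h = None" by (simp add: next_edge_def)
  with 5(3) have "m5 = 0" by (cases rule: serves.cases) simp_all
  with 5(4) final(1) show "m = card (all_edges N)" by simp
  obtain \<mu>5 \<omega>5 where \<sigma>: "\<sigma> = (\<mu>5, \<omega>5)" by fastforce
  have pr5: "private_inv W b N n A B (3 * (N * N)) G R \<mu>5" using 5(1) \<sigma> by simp
  obtain \<mu>6 where e6: "exec M ?Q (reset_com b) (\<mu>5, \<omega>5) 1 (\<mu>6, \<omega>5)"
    "private_inv W b N n A B 0 G R \<mu>6"
    using exec_reset[OF pr5 M2, of ?Q \<omega>5] by blast
  obtain tg \<mu>7 where e7: "exec M ?Q (counting_loop b (square (dim_n b)) (output_com b)) (\<mu>6, \<omega>5) tg (\<mu>7, \<omega>5)"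
    "\<forall>j<n * n. \<mu>7 3 j = of_bool ((j div n, j mod n) \<in> R)" "tg \<le> n * n * 3 + 1"
    using output_loop[OF b(1) e6(2) W(1) nN(1) W(5) k(4) M(3), of ?Q \<omega>5] by blast
  let ?t = "ta + (tb + (1 + (t0 + (1 + (te + (1 + tg))))))"
  have "exec M ?Q (reduction r b) (bmm_input n A B, \<omega>) ?t (\<mu>7, \<omega>5)"
    unfolding reduction_def
    by (rule exec.Seq[OF e0(1) exec.Seq[OF e1(1) exec.Seq[OF e2 exec.Seq[OF e3[folded \<mu>3_def]
        exec.Seq[OF e4(1) exec.Seq[OF e5(1)[unfolded \<sigma>] exec.Seq[OF e6(1) e7(1)]]]]]]])
  then have "exec M no_calls (link D (reduction r b)) (bmm_input n A B, \<omega>) ?t (\<mu>7, \<omega>5)"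
    by (rule exec_link)
  moreover have "bmm_output_correct n A B \<mu>7" by (rule output_correct[where \<mu> = \<mu>7 and R = R and n = n and A = A and B = B, OF e7(2) final(2,3)])
  moreover have "?t \<le> t + overhead b * (N * N + 1)"
  proof -
    have "n * n * (cost (copy_com b) + 2) \<le> N * N * (cost (copy_com b) + 2)"
      using nn by (rule mult_right_mono) simp
    moreover have "n * n * 3 \<le> N * N * 3" using nn by simp
    ultimately have "?t \<le> t + N * N * (cost (copy_com b) + 2) + 3 * (N * N) * (cost (play_com b) + 2) + N * N * 3 + 9"
      using e0(2) e1(3) e5(3) e7(3) t by linarith
    also have "\<dots> \<le> t + overhead b * (N * N + 1)"
      by (simp add: overhead_def algebra_simps)
    finally show ?thesis .
  qed
  ultimately show "\<exists>t' s'. exec M no_calls (link D (reduction r b)) (bmm_input n A B, \<omega>) t' s' \<and>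
      bmm_output_correct n A B (fst s') \<and> t' \<le> t + overhead b * (N * N + 1)" by fastforce
qed

section \<open>Linear running time of the reduction\<close>

lemma aval_eq_tval: "aval M \<mu> e = Some v \<Longrightarrow> v = tval \<mu> e"
  by (induction e arbitrary: v) (auto simp: word_def bind_eq_Some_conv split: if_splits)

lemma exec_SeqE:
  assumes "exec M Q (Seq c1 c2) s t s'"
  obtains t1 s1 t2 where "exec M Q c1 s t1 s1" "exec M Q c2 s1 t2 s'" "t = t1 + t2"
  using assms by (cases rule: exec.cases) auto

lemma exec_StoreD:
  assumes "exec M Q (Store a e1 e2) s t s'"
  shows "t = 1" "fst s' = (fst s)(a := (fst s a)(tval (fst s) e1 := tval (fst s) e2))"
  using assms by (cases rule: exec.cases; auto dest: aval_eq_tval)+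

lemma exec_CallD:
  assumes "exec M arbitrary_calls (Call p) s t s'" "b \<notin> interface"
  shows "t = 1" "fst s' b = fst s b"
  using assms by (cases rule: exec.cases; simp add: arbitrary_calls_def)+

lemma loop_free_clear_slots: "loop_free (clear_slots b k)"
  by (induction k) simp_all

lemma loop_free_load_slots: "loop_free (load_slots b k)"
  by (induction k) (simp_all add: loop_free_clear_slots load_slot_def)

lemma writes_load_slots: "writes (load_slots b k) \<subseteq> {b + 4}"
proof -
  have "writes (clear_slots b j) \<subseteq> {b + 4}" for j by (induction j) simp_all
  then show ?thesis by (induction k) (auto simp: load_slot_def)
qed

lemma arrays_load_slots: "arrays (load_slots b k) \<subseteq> {3, b + 4}"
proof -
  have "arrays (clear_slots b j) \<subseteq> {3, b + 4}" for j by (induction j) simp_all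
  then show ?thesis by (induction k) (auto simp: load_slot_def)
qed

lemmas play_com_defs = play_com_def choose_com_def game_com_def record_found_def slots_pick_com_def
  side_pick_com_def set_pred_pair_def set_pair_def present_com_def

lemma loop_free_play_com: "loop_free (play_com b)"
  by (simp add: play_com_defs loop_free_load_slots)

lemma writes_play_com:
  assumes "4 \<le> b" shows "b \<notin> writes (play_com b)"
proof -
  have "b \<notin> writes (load_slots b 6)" using writes_load_slots[of b 6] by auto
  then show ?thesis using assms by (simp add: play_com_defs)
qed

lemma arrays_reduction: "arrays (reduction r b) \<subseteq> interface \<union> {b..b + 6}"
proof -
  have "arrays (load_slots b 6) \<subseteq> interface \<union> {b..b + 6}"
    using arrays_load_slots[of b 6] by (auto simp: interface_def)
  then show ?thesis
    by (simp add: reduction_def setup_com_def counting_loop_def copy_com_def reset_com_def output_com_def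
        play_com_defs wanted_expr_def matrix_expr_def new_edge_expr_def Let_def)
      (simp add: interface_def)
qed

text \<open>Calls may leave arbitrary values in the interface, but the loop bounds are read from
  array \<open>b\<close>. It lies outside the interface, and after the set-up only its counter cell
  changes, so \<open>N\<close> and \<open>n\<close> persist.\<close>

lemma reduction_linear_time:
  assumes b: "4 \<le> b" and ex: "exec M arbitrary_calls (reduction r b) (bmm_input n A B, \<omega>) t s'"
  shows "t \<le> n * n * (cost (copy_com b) + 2) + 3 * ((6 * n + r) * (6 * n + r)) * (cost (play_com b) + 2) + n * n * 3 + 10"
proof -
  have bi: "b \<notin> interface" using b by (simp add: interface_def)
  let ?s = "(bmm_input n A B, \<omega>)"
  from ex obtain t1 s1 t2 s2 t3 s3 t4 s4 t5 s5 t6 s6 t7 s7 t8 where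
    e1: "exec M arbitrary_calls (setup_com r b) ?s t1 s1" and
    e2: "exec M arbitrary_calls (counting_loop b (square (dim_n b)) (copy_com b)) s1 t2 s2" and
    e3: "exec M arbitrary_calls (Store 0 (Lit 0) (order_N b)) s2 t3 s3" and
    e4: "exec M arbitrary_calls (Call Init) s3 t4 s4" and
    e5: "exec M arbitrary_calls (reset_com b) s4 t5 s5" and
    e6: "exec M arbitrary_calls (counting_loop b (Op Times (Lit 3) (square (order_N b))) (play_com b)) s5 t6 s6" and
    e7: "exec M arbitrary_calls (reset_com b) s6 t7 s7" and
    e8: "exec M arbitrary_calls (counting_loop b (square (dim_n b)) (output_com b)) s7 t8 s'" and
    t: "t = t1 + (t2 + (t3 + (t4 + (t5 + (t6 + (t7 + t8))))))"
    unfolding reduction_def by (elim exec_SeqE) blast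
  have 1: "t1 = 3" "fst s1 b 1 = 6 * n + r" "fst s1 b 2 = n"
  proof -
    obtain ta sa tb sb tc where
      a: "exec M arbitrary_calls (Store b (Lit 0) (Lit 0)) ?s ta sa" and
      b': "exec M arbitrary_calls (Store b (Lit 1) (Op Plus (Op Times (Lit 6) (Read 0 (Lit 0))) (Lit r))) sa tb sb" and
      c: "exec M arbitrary_calls (Store b (Lit 2) (Read 0 (Lit 0))) sb tc s1" and tt: "t1 = ta + (tb + tc)"
      using e1 unfolding setup_com_def by (elim exec_SeqE) blast
    have "fst ?s 0 0 = n" by (simp add: bmm_input_def)
    then show "t1 = 3" "fst s1 b 1 = 6 * n + r" "fst s1 b 2 = n"
      using exec_StoreD[OF a] exec_StoreD[OF b'] exec_StoreD[OF c] tt b by simp_all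
  qed
  define row where "row s \<longleftrightarrow> (\<exists>k. fst s b = (fst s1 b)(0 := k))" for s :: state
  have sq: "v \<le> n * n" if "fst s b = (fst s1 b)(0 := k)" "aval M (fst s) (square (dim_n b)) = Some v" for s k v
    using aval_eq_tval[OF that(2)] that(1) 1 by simp
  have sqN: "v \<le> 3 * ((6 * n + r) * (6 * n + r))" if "fst s b = (fst s1 b)(0 := k)"
    "aval M (fst s) (Op Times (Lit 3) (square (order_N b))) = Some v" for s k v
    using aval_eq_tval[OF that(2)] that(1) 1 by simp
  have reset: "row s'' \<and> t'' = 1" if "exec M arbitrary_calls (reset_com b) s t'' s''" "row s" for s t'' s''
    using exec_StoreD[OF that(1)[unfolded reset_com_def]] that(2) unfolding row_def by auto
  have r1: "row s1" unfolding row_def by (rule exI[of _ "fst s1 b 0"]) simp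
  have lf: "loop_free (copy_com b)" "loop_free (output_com b)"
    and wr: "b \<notin> writes (copy_com b)" "b \<notin> writes (output_com b)"
    using b by (simp_all add: copy_com_def output_com_def)
  have 2: "t2 \<le> (n * n - fst s1 b 0) * (cost (copy_com b) + 2) + 1 \<and> row s2" unfolding row_def
    by (rule counting_loop_cost[OF e2[unfolded counting_loop_def] sq lf(1) wr(1) bi r1[unfolded row_def]])
  have 3: "t3 = 1" "row s3" using exec_StoreD[OF e3] 2 b by (simp_all add: row_def)
  have 4: "t4 = 1" "row s4" using exec_CallD[OF e4 bi] 3 by (simp_all add: row_def)
  have 5: "row s5" "t5 = 1" using reset[OF e5 4(2)] by simp_all
  have 6: "t6 \<le> (3 * ((6 * n + r) * (6 * n + r)) - fst s5 b 0) * (cost (play_com b) + 2) + 1 \<and> row s6" unfolding row_def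
    by (rule counting_loop_cost[OF e6[unfolded counting_loop_def] sqN loop_free_play_com writes_play_com[OF b] bi
          5(1)[unfolded row_def]])
  then have 7: "row s7" "t7 = 1" using reset[OF e7] by simp_all
  have 8: "t8 \<le> (n * n - fst s7 b 0) * (cost (output_com b) + 2) + 1 \<and> row s'" unfolding row_def
    by (rule counting_loop_cost[OF e8[unfolded counting_loop_def] sq lf(2) wr(2) bi 7(1)[unfolded row_def]])
  have "(n * n - x) * y \<le> n * n * y" "(3 * ((6 * n + r) * (6 * n + r)) - x) * y \<le> 3 * ((6 * n + r) * (6 * n + r)) * y" for x y :: nat
    by (intro mult_right_mono; simp)+
  then have "t2 \<le> n * n * (cost (copy_com b) + 2) + 1" "t8 \<le> n * n * (cost (output_com b) + 2) + 1"
    "t6 \<le> 3 * ((6 * n + r) * (6 * n + r)) * (cost (play_com b) + 2) + 1"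
    using 2 6 8 by (meson add_le_mono order.refl order.trans)+
  moreover have "cost (output_com b) + 2 = 3" by (simp add: output_com_def)
  ultimately show ?thesis using t 1(1) 3(1) 4(1) 5(2) 7(2) by simp
qed

lemma linear_reduction_reduction:
  assumes b: "4 \<le> b" "arrays (init_proc D) \<subseteq> {..<b}" "arrays (update_proc D) \<subseteq> {..<b}"
  shows "linear_reduction D (reduction r b)"
proof -
  have "arrays (reduction r b) \<inter> (arrays (init_proc D) \<union> arrays (update_proc D)) \<subseteq> interface"
    using arrays_reduction[of r b] b(2,3) by fastforce
  moreover have "t \<le> (2 * overhead b * (6 + r) * (6 + r)) * (n + 1)\<^sup>2"
    if ex: "exec M arbitrary_calls (reduction r b) (bmm_input n A B, \<omega>) t s'" for M n A B \<omega> t s'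
  proof -
    let ?N = "6 * n + r" and ?X = "((6 + r) * (n + 1)) * ((6 + r) * (n + 1))"
    have "?N \<le> (6 + r) * (n + 1)" by (simp add: algebra_simps)
    then have N: "?N * ?N \<le> ?X" by (intro mult_le_mono)
    have "n \<le> (6 + r) * (n + 1)" by (simp add: algebra_simps)
    then have n: "n * n \<le> ?X" by (intro mult_le_mono)
    have X: "1 \<le> ?X" by simp
    have "t \<le> n * n * (cost (copy_com b) + 2) + 3 * (?N * ?N) * (cost (play_com b) + 2) + n * n * 3 + 10"
      by (rule reduction_linear_time[OF b(1) ex])
    also have "\<dots> \<le> ?X * (cost (copy_com b) + 2) + 3 * ?X * (cost (play_com b) + 2) + ?X * 3 + 10 * ?X"
    proof (intro add_mono)
      show "n * n * (cost (copy_com b) + 2) \<le> ?X * (cost (copy_com b) + 2)"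
        by (rule mult_right_mono[OF n]) simp
      show "3 * (?N * ?N) * (cost (play_com b) + 2) \<le> 3 * ?X * (cost (play_com b) + 2)"
        by (rule mult_right_mono[OF mult_left_mono[OF N]]) simp_all
      show "n * n * 3 \<le> ?X * 3" by (rule mult_right_mono[OF n]) simp
    qed simp
    also have "\<dots> = ?X * (cost (copy_com b) + 3 * cost (play_com b) + 21)" by (simp add: algebra_simps)
    \<comment> \<open>The constant 21 is \<open>2 + 6 + 3 + 10\<close>, covered by twice the 11 in
      \<open>overhead\<close>.\<close>
    also have "\<dots> \<le> ?X * (2 * overhead b)"
      by (intro mult_left_mono) (simp_all add: overhead_def)
    finally have "t \<le> ?X * (2 * overhead b)" .
    then show ?thesis by (simp only: power2_eq_square mult_ac)
  qed
  ultimately show ?thesis unfolding linear_reduction_def by blast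
qed

section \<open>Lower bounds\<close>

text \<open>Trades the null sequence for fixed losses \<open>\<epsilon>\<close>, which are easier to
  combine. In one direction half of \<open>\<epsilon>\<close> pays for the null sequence and half
  for the constant factor.\<close>

lemma almost_Omega_iff:
  "almost_Omega T e \<longleftrightarrow> (\<forall>\<epsilon>>0. eventually (\<lambda>n. real n powr (e - \<epsilon>) \<le> \<bar>T n\<bar>) sequentially)"
proof
  assume "almost_Omega T e"
  then obtain \<delta> :: "nat \<Rightarrow> real" where \<delta>: "\<delta> \<in> o(\<lambda>_. 1)" and T: "T \<in> \<Omega>(\<lambda>n. real n powr (e - \<delta> n))"
    unfolding almost_Omega_def by blast
  have lim: "\<delta> \<longlonglongrightarrow> 0" using smalloD_tendsto[OF \<delta>] by simp
  obtain c where c: "c > 0" "eventually (\<lambda>n. c * norm (real n powr (e - \<delta> n)) \<le> norm (T n)) sequentially"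
    using T by (elim landau_omega.bigE)
  show "\<forall>\<epsilon>>0. eventually (\<lambda>n. real n powr (e - \<epsilon>) \<le> \<bar>T n\<bar>) sequentially"
  proof (intro allI impI)
    fix \<epsilon> :: real assume \<epsilon>: "\<epsilon> > 0"
    have ev1: "eventually (\<lambda>n. \<delta> n < \<epsilon> / 2) sequentially"
      using order_tendstoD(2)[OF lim, of "\<epsilon> / 2"] \<epsilon> by simp
    have ev2: "eventually (\<lambda>n. 1 / c \<le> real n powr (\<epsilon> / 2)) sequentially"
      using \<epsilon> by real_asymp
    show "eventually (\<lambda>n. real n powr (e - \<epsilon>) \<le> \<bar>T n\<bar>) sequentially"
      using c(2) ev1 ev2 eventually_ge_at_top[of 1]
    proof eventually_elim
      case (elim n)
      have "real n powr (e - \<epsilon>) = 1 * real n powr (e - \<epsilon>)" by simp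
      also have "\<dots> \<le> (c * real n powr (\<epsilon> / 2)) * real n powr (e - \<epsilon>)"
        using elim(3) c(1) by (intro mult_right_mono) (simp_all add: field_simps)
      also have "\<dots> = c * real n powr (e - \<epsilon> / 2)" by (simp add: powr_add[symmetric])
      also have "\<dots> \<le> c * real n powr (e - \<delta> n)"
        using elim(2,4) c(1) by (intro mult_left_mono powr_mono) simp_all
      also have "\<dots> \<le> \<bar>T n\<bar>" using elim(1) by simp
      finally show ?case .
    qed
  qed
next
  assume *: "\<forall>\<epsilon>>0. eventually (\<lambda>n. real n powr (e - \<epsilon>) \<le> \<bar>T n\<bar>) sequentially"
  \<comment> \<open>By how much the actual exponent of \<open>T n\<close> to base \<open>n\<close>
    falls short of \<open>e\<close>; cut off at 0, since \<open>T\<close> may also grow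
    faster.\<close>
  define \<delta> where "\<delta> n = max 0 (e - ln \<bar>T n\<bar> / ln (real n))" for n
  have bound: "\<bar>T n\<bar> = real n powr (ln \<bar>T n\<bar> / ln (real n))" if "n \<ge> 2" "T n \<noteq> 0" for n
    using that by (simp add: powr_def)
  have nz: "eventually (\<lambda>n. n \<ge> 2 \<and> T n \<noteq> 0) sequentially"
    using *[rule_format, of 1, OF zero_less_one] eventually_ge_at_top[of 2]
  proof eventually_elim
    case (elim n)
    have "0 < real n powr (e - 1)" using elim(2) by simp
    with elim show ?case by auto
  qed
  have "\<delta> \<longlonglongrightarrow> 0"
  proof (rule LIMSEQ_I)
    fix \<epsilon> :: real assume "\<epsilon> > 0"
    then have "\<epsilon> / 2 > 0" by simp
    from *[rule_format, OF this] nz have "eventually (\<lambda>n. norm (\<delta> n - 0) < \<epsilon>) sequentially"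
    proof eventually_elim
      case (elim n)
      have ln: "ln (real n) > 0" using elim(2) by simp
      have "ln (real n powr (e - \<epsilon> / 2)) \<le> ln \<bar>T n\<bar>"
        using elim by (subst ln_le_cancel_iff) simp_all
      then have "(e - \<epsilon> / 2) * ln (real n) \<le> ln \<bar>T n\<bar>" using elim(2) by (simp add: ln_powr)
      then have "e - \<epsilon> / 2 \<le> ln \<bar>T n\<bar> / ln (real n)" using ln by (simp add: pos_le_divide_eq)
      then show ?case using \<open>\<epsilon> > 0\<close> by (simp add: \<delta>_def)
    qed
    then show "\<exists>no. \<forall>n\<ge>no. norm (\<delta> n - 0) < \<epsilon>" by (simp add: eventually_sequentially)
  qed
  then have "\<delta> \<in> o(\<lambda>_. 1)" by (intro smalloI_tendsto) simp_all
  moreover have "T \<in> \<Omega>(\<lambda>n. real n powr (e - \<delta> n))"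
  proof (rule landau_omega.bigI[of 1])
    show "eventually (\<lambda>n. 1 * norm (real n powr (e - \<delta> n)) \<le> norm (T n)) sequentially"
      using nz
    proof eventually_elim
      case (elim n)
      have "real n powr (e - \<delta> n) \<le> real n powr (ln \<bar>T n\<bar> / ln (real n))"
        using elim by (intro powr_mono) (auto simp: \<delta>_def)
      also have "\<dots> = \<bar>T n\<bar>" using bound[of n] elim by simp
      finally show ?case by simp
    qed
  qed simp
  ultimately show "almost_Omega T e" unfolding almost_Omega_def by blast
qed

text \<open>Every \<open>N \<ge> r0\<close> is \<open>6 * n + r\<close> with \<open>r\<close> among
  six consecutive values. Being finitely many, the six lower bounds share a threshold, and the
  factors \<open>C\<close> are absorbed by half of \<open>\<epsilon>\<close>.\<close>

lemma almost_Omega_residues: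
  fixes U :: "nat \<Rightarrow> real"
  assumes "\<And>r. r0 \<le> r \<Longrightarrow> r < r0 + 6 \<Longrightarrow> \<exists>C>0. almost_Omega (\<lambda>n. C * U (6 * n + r)) e"
  shows "almost_Omega U e"
  unfolding almost_Omega_iff
proof (intro allI impI)
  fix \<epsilon> :: real assume \<epsilon>: "\<epsilon> > 0"
  define a where "a = e - \<epsilon> / 2"
  \<comment> \<open>For \<open>r \<le> 6 * n\<close> one has \<open>6 * n + r \<le> 12 * n\<close>,
    whence the 12. The minimum with 1 handles a negative exponent \<open>a\<close>, where the larger
    base already gives the smaller power.\<close>
  define K :: real where "K = min 1 ((1 / 12) powr a)"
  have K: "0 < K" by (simp add: K_def)
  have low: "K * real (6 * n + r) powr a \<le> real n powr a" if "1 \<le> n" "r \<le> 6 * n" for n r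
  proof (cases "a \<ge> 0")
    case True
    have "K * real (6 * n + r) powr a \<le> (1 / 12) powr a * real (6 * n + r) powr a"
      by (intro mult_right_mono) (simp_all add: K_def)
    also have "\<dots> = ((1 / 12) * real (6 * n + r)) powr a" by (subst powr_mult) simp_all
    also have "\<dots> \<le> real n powr a" using that True by (intro powr_mono2) simp_all
    finally show ?thesis .
  next
    case False
    have "K * real (6 * n + r) powr a \<le> 1 * real (6 * n + r) powr a"
      by (intro mult_right_mono) (simp_all add: K_def)
    also have "\<dots> \<le> real n powr a" using that False by (simp add: powr_mono2')
    finally show ?thesis .
  qed
  have res: "eventually (\<lambda>n. real (6 * n + r) powr (e - \<epsilon>) \<le> \<bar>U (6 * n + r)\<bar>) sequentially"
    if r: "r0 \<le> r" "r < r0 + 6" for r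
  proof -
    obtain C where C: "C > 0" "almost_Omega (\<lambda>n. C * U (6 * n + r)) e" using assms[OF r] by blast
    have ev1: "eventually (\<lambda>n. real n powr a \<le> \<bar>C * U (6 * n + r)\<bar>) sequentially"
      using C(2) \<epsilon> unfolding almost_Omega_iff a_def by simp
    have ev2: "eventually (\<lambda>n. C / K \<le> real (6 * n + r) powr (\<epsilon> / 2)) sequentially"
      using \<epsilon> by real_asymp
    show ?thesis using ev1 ev2 eventually_ge_at_top[of "Suc r"]
    proof eventually_elim
      case (elim n)
      let ?N = "real (6 * n + r)"
      have "C * ?N powr (e - \<epsilon>) = K * (C / K * ?N powr (e - \<epsilon>))" using K by simp
      also have "\<dots> \<le> K * (?N powr (\<epsilon> / 2) * ?N powr (e - \<epsilon>))"
        using elim(2) K by (intro mult_left_mono mult_right_mono) simp_all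
      also have "\<dots> = K * ?N powr a" by (simp add: powr_add[symmetric] a_def)
      also have "\<dots> \<le> real n powr a" using low[of n r] elim(3) by simp
      also have "\<dots> \<le> C * \<bar>U (6 * n + r)\<bar>" using elim(1) C(1) by (simp add: abs_mult)
      finally show ?case using C(1) by simp
    qed
  qed
  have "eventually (\<lambda>n. \<forall>r\<in>{r0..<r0 + 6}. real (6 * n + r) powr (e - \<epsilon>) \<le> \<bar>U (6 * n + r)\<bar>) sequentially"
    using res by (intro eventually_ball_finite) auto
  then obtain n0 where n0: "\<And>n r. n0 \<le> n \<Longrightarrow> r0 \<le> r \<Longrightarrow> r < r0 + 6 \<Longrightarrow>
      real (6 * n + r) powr (e - \<epsilon>) \<le> \<bar>U (6 * n + r)\<bar>"
    unfolding eventually_sequentially by fastforce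
  show "eventually (\<lambda>N. real N powr (e - \<epsilon>) \<le> \<bar>U N\<bar>) sequentially"
    unfolding eventually_sequentially
  proof (intro exI[of _ "6 * n0 + r0"] allI impI)
    fix N assume N: "6 * n0 + r0 \<le> N"
    define n r where "n = (N - r0) div 6" and "r = r0 + (N - r0) mod 6"
    have "N = 6 * n + r" using N by (simp add: n_def r_def)
    moreover have "n0 \<le> n" using N unfolding n_def by (simp add: less_eq_div_iff_mult_less_eq)
    moreover have "r0 \<le> r" "r < r0 + 6" by (simp_all add: r_def)
    ultimately show "real N powr (e - \<epsilon>) \<le> \<bar>U N\<bar>" using n0 by blast
  qed
qed

lemma almost_Omega_divide_square:
  assumes "almost_Omega (\<lambda>N. T N * real (card (all_edges N))) e"
  shows "almost_Omega T (e - 2)"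
  unfolding almost_Omega_iff
proof (intro allI impI)
  fix \<epsilon> :: real assume "\<epsilon> > 0"
  then have "eventually (\<lambda>n. real n powr (e - \<epsilon>) \<le> \<bar>T n * real (card (all_edges n))\<bar>) sequentially"
    using assms unfolding almost_Omega_iff by blast
  then show "eventually (\<lambda>n. real n powr (e - 2 - \<epsilon>) \<le> \<bar>T n\<bar>) sequentially"
    using eventually_ge_at_top[of 1]
  proof eventually_elim
    case (elim n)
    have "n * (n - 1) \<le> n * n" by (rule mult_left_mono) simp_all
    then have "2 * card (all_edges n) \<le> 2 * (n * n)" unfolding card_all_edges by linarith
    then have c: "real (card (all_edges n)) \<le> real n powr 2" using elim(2)
      by (simp add: powr_numeral power2_eq_square flip: of_nat_mult)
    have "real n powr (e - 2 - \<epsilon>) * real n powr 2 = real n powr (e - \<epsilon>)"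
      unfolding powr_add[symmetric] by (rule arg_cong) simp
    also have "\<dots> \<le> \<bar>T n\<bar> * real (card (all_edges n))" using elim(1) by (simp add: abs_mult)
    also have "\<dots> \<le> \<bar>T n\<bar> * real n powr 2" using c by (intro mult_left_mono) simp_all
    finally show ?case using elim(2) by simp
  qed
qed

section \<open>From dynamic algorithms to matrix multiplication\<close>

lemma serves_time: "serves M D N adv E h s t m \<Longrightarrow> m \<le> t"
  by (induction rule: serves.induct) (auto dest: exec_pos)

text \<open>A polynomial word bound in \<open>N\<close> becomes one in \<open>n\<close>, with a
  larger constant exponent.\<close>

lemma reduction_word_bound: "6 * n + r + 2 \<le> (n + 2) ^ (r + 7)" for n r :: nat
proof -
  have "6 * n + r + 2 \<le> (r + 6) * (n + 2)" by (simp add: algebra_simps)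
  also have "r + 6 \<le> 2 ^ (r + 6)" by (rule less_imp_le[OF less_exp])
  then have "(r + 6) * (n + 2) \<le> (n + 2) ^ (r + 6) * (n + 2)"
    by (intro mult_right_mono) (auto intro: order.trans power_mono)
  also have "\<dots> = (n + 2) ^ (r + 7)" by (simp add: eval_nat_numeral)
  finally show ?thesis .
qed

text \<open>Beyond the interface arrays 0 to 3 and all arrays that occur in
  \<open>D\<close>.\<close>

definition base_array :: "dyn_alg \<Rightarrow> nat" where
  "base_array D = (SOME b. 4 \<le> b \<and> arrays (init_proc D) \<subseteq> {..<b} \<and> arrays (update_proc D) \<subseteq> {..<b})"

lemma finite_arrays: "finite (arrays c)"
proof -
  have "finite (arrays_aexp e)" for e by (induction e) auto
  then show ?thesis by (induction c) auto
qed

lemma base_array: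
  "4 \<le> base_array D" "arrays (init_proc D) \<subseteq> {..<base_array D}" "arrays (update_proc D) \<subseteq> {..<base_array D}"
proof -
  have "finite (arrays (init_proc D) \<union> arrays (update_proc D))" by (simp add: finite_arrays)
  then obtain k where "\<forall>a\<in>arrays (init_proc D) \<union> arrays (update_proc D). a < k"
    using finite_nat_set_iff_bounded by blast
  then have "\<exists>b. 4 \<le> b \<and> arrays (init_proc D) \<subseteq> {..<b} \<and> arrays (update_proc D) \<subseteq> {..<b}"
    by (intro exI[of _ "k + 4"]) (auto intro: trans_less_add1)
  from someI_ex[OF this] show "4 \<le> base_array D" "arrays (init_proc D) \<subseteq> {..<base_array D}"
    "arrays (update_proc D) \<subseteq> {..<base_array D}" unfolding base_array_def by blast+
qed

text \<open>The predicate \<open>P\<close> stands for either notion of time bound. It is evaluated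
  at the one possible number of updates, so an amortized bound turns into a total one.
  \<open>2 \<le> r\<close> ensures that there are updates to pay for the overhead even at
  \<open>n = 0\<close>.\<close>

lemma reduction_solves_BMM:
  assumes r: "2 \<le> r"
    and alg: "\<And>n adv. coin_prob (\<lambda>\<omega>. \<exists>t m. maintains_MIS (word_bound c (6 * n + r)) D (6 * n + r) {} adv \<omega> t m \<and>
      P (6 * n + r) t m) \<ge> 2 / 3"
    and P: "\<And>n t. P (6 * n + r) t (card (all_edges (6 * n + r))) \<Longrightarrow> real t \<le> S (6 * n + r)"
  shows "\<exists>C>0. solves_BMM (link D (reduction r (base_array D))) (\<lambda>n. C * S (6 * n + r))"
proof -
  define b where "b = base_array D"
  note b = base_array[of D, folded b_def]
  define k where "k = com_weight (reduction r b)"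
  define q where "q = r + 7"
  have q: "6 * n + r + 2 \<le> (n + 2) ^ q" for n unfolding q_def by (rule reduction_word_bound)
  \<comment> \<open>\<open>q * c\<close> accommodates the algorithm's words and
    \<open>(3 + 2 * q) * k\<close> the bound \<open>W ^ k\<close> with
    \<open>W = 6 * (N + 2)^2\<close>, where 6 is at most \<open>(n + 2) ^ 3\<close>; the final 1
    makes the inequality strict.\<close>
  define c' where "c' = q * c + (3 + 2 * q) * k + 1"
  define C where "C = 1 + 5 * real (overhead b)"
  have "coin_prob (\<lambda>\<omega>. \<exists>t s'. exec (word_bound c' n) no_calls (link D (reduction r b)) (bmm_input n A B, \<omega>) t s' \<and>
        (bmm_output_correct n A B (fst s') \<and> real t \<le> C * S (6 * n + r))) \<ge> 2 / 3" for n A B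
  proof -
    define N where "N = 6 * n + r"
    define W where "W = 6 * ((N + 2) * (N + 2))"
    let ?adv = "play N (mat_restrict n A) (mat_restrict n B) (3 * (N * N)) {}"
    let ?M = "word_bound c' n" and ?MD = "word_bound c N"
    have N2: "N + 2 \<le> (n + 2) ^ q" using q[of n] by (simp add: N_def)
    have "?MD \<le> (n + 2) ^ (q * c)" using power_mono[OF N2, of c] by (simp add: word_bound_def power_mult)
    also have "\<dots> \<le> ?M" unfolding word_bound_def by (rule power_increasing) (simp_all add: c'_def)
    finally have MD: "?MD \<le> ?M" .
    have "6 \<le> (2::nat) ^ 3" by simp
    also have "\<dots> \<le> (n + 2) ^ 3" by (rule power_mono) simp_all
    finally have "W \<le> (n + 2) ^ 3 * ((n + 2) ^ q * (n + 2) ^ q)"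
      unfolding W_def using N2 by (intro mult_le_mono)
    also have "\<dots> = (n + 2) ^ (3 + 2 * q)" by (simp only: power_add mult_2)
    finally have "W ^ k \<le> ((n + 2) ^ (3 + 2 * q)) ^ k" by (rule power_mono) simp
    also have "\<dots> = (n + 2) ^ ((3 + 2 * q) * k)" by (simp add: power_mult)
    also have "\<dots> < ?M" unfolding word_bound_def by (rule power_strict_increasing) (simp_all add: c'_def)
    finally have Wk: "W ^ k < ?M" .
    have W: "3 * (N * N) + 6 * N + 6 \<le> W" by (simp add: W_def algebra_simps)
    have kk: "com_weight (reduction r b) \<le> k" by (simp add: k_def)
    note correct = reduction_correct[where n = n and r = r, folded N_def, OF b MD kk Wk W]
    have time: "\<exists>t' s'. exec ?M no_calls (link D (reduction r b)) (bmm_input n A B, \<omega>) t' s' \<and>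
        (bmm_output_correct n A B (fst s') \<and> real t' \<le> C * S N)"
      if run: "maintains_MIS ?MD D N {} ?adv \<omega> t m" and t: "P N t m" for \<omega> t m
    proof -
      have m: "m = card (all_edges N)" by (rule correct(1)[OF run])
      obtain t' s' where t': "exec ?M no_calls (link D (reduction r b)) (bmm_input n A B, \<omega>) t' s'"
        "bmm_output_correct n A B (fst s')" "t' \<le> t + overhead b * (N * N + 1)"
        using correct(2)[OF run] by blast
      obtain t0 t1 s where "serves ?MD D N ?adv {} [set (out_list s)] s t1 m" "t = t0 + t1"
        using run unfolding maintains_MIS_def by blast
      then have "m \<le> t" using serves_time trans_le_add2 by blast
      have "N \<ge> 2" using r by (simp add: N_def)
      then obtain p where p: "N = p + 2" using le_Suc_ex[of 2 N] by auto
      \<comment> \<open>For \<open>N = 2\<close> both sides are 10, so 5 is the least possible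
        factor.\<close>
      have "2 * (N * N + 1) \<le> 5 * (2 * card (all_edges N))" unfolding card_all_edges p
        by (simp add: algebra_simps)
      then have "N * N + 1 \<le> 5 * t" using m \<open>m \<le> t\<close> by simp
      then have "overhead b * (N * N + 1) \<le> overhead b * (5 * t)" by (rule mult_left_mono) simp
      with t'(3) have "t' \<le> t + overhead b * (5 * t)" by linarith
      then have "real t' \<le> real (t + overhead b * (5 * t))" by (simp only: of_nat_le_iff)
      also have "\<dots> = C * real t" by (simp add: C_def algebra_simps)
      also have "\<dots> \<le> C * S N" using P[of n t] t m by (intro mult_left_mono) (simp_all add: C_def N_def)
      finally show ?thesis using t' by blast
    qed
    have "2 / 3 \<le> coin_prob (\<lambda>\<omega>. \<exists>t m. maintains_MIS ?MD D N {} ?adv \<omega> t m \<and>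
        P N t m)"
      using alg[of n ?adv] by (simp add: N_def)
    also have "\<dots> \<le> coin_prob (\<lambda>\<omega>. \<exists>t s'. exec ?M no_calls (link D (reduction r b)) (bmm_input n A B, \<omega>) t s' \<and>
        (bmm_output_correct n A B (fst s') \<and> real t \<le> C * S N))"
      by (rule coin_prob_exec_mono) (use time in blast)
    finally show ?thesis by (simp only: N_def)
  qed
  then have "solves_BMM (link D (reduction r b)) (\<lambda>n. C * S (6 * n + r))"
    unfolding solves_BMM_def by blast
  moreover have "C > 0" by (simp add: C_def add_pos_nonneg)
  ultimately show ?thesis unfolding b_def by blast
qed

text \<open>The six paddings start at \<open>l\<close>, so \<open>6 * n + r \<ge> l\<close> holds
  for every \<open>n\<close> and the bound from \<open>P\<close> is available at all
  dimensions.\<close>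

lemma reduction_lower_bound:
  assumes l: "2 \<le> l"
    and alg: "\<And>N adv. coin_prob (\<lambda>\<omega>. \<exists>t m. maintains_MIS (word_bound c N) D N {} adv \<omega> t m \<and> P N t m) \<ge> 2 / 3"
    and P: "\<And>N t. l \<le> N \<Longrightarrow> P N t (card (all_edges N)) \<Longrightarrow> real t \<le> S N"
    and lb: "\<And>r T. solves_BMM (link D (reduction r (base_array D))) T \<Longrightarrow> almost_Omega T e"
  shows "almost_Omega S e"
proof (rule almost_Omega_residues)
  fix r assume r: "l \<le> r"
  have "\<exists>C>0. solves_BMM (link D (reduction r (base_array D))) (\<lambda>n. C * S (6 * n + r))"
    by (rule reduction_solves_BMM[where P = P, OF order.trans[OF l r] alg P]) (use r in simp_all)
  then show "\<exists>C>0. almost_Omega (\<lambda>n. C * S (6 * n + r)) e" using lb by blast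
qed

lemma total_time_lower_bound:
  assumes "MIS_total_time D T"
    and lb: "\<And>r T. solves_BMM (link D (reduction r (base_array D))) T \<Longrightarrow> almost_Omega T e"
  shows "almost_Omega T e"
proof -
  obtain c where c: "\<And>N E adv. E \<subseteq> all_edges N \<Longrightarrow> coin_prob (\<lambda>\<omega>. \<exists>t m.
      maintains_MIS (word_bound c N) D N E adv \<omega> t m \<and> real t \<le> T N) \<ge> 2 / 3"
    using assms(1) unfolding MIS_total_time_def by blast
  show ?thesis
    by (rule reduction_lower_bound[where P = "\<lambda>N t m. real t \<le> T N" and c = c, OF order.refl c _ lb]) simp_all
qed

text \<open>The complete graph has about half of \<open>N^2\<close> edges, so for
  \<open>\<kappa> < 1 / 2\<close> and large \<open>N\<close> the run is long enough for the
  amortized bound to apply. Multiplying by the number of updates gives a total time, and dividing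
  again costs 2 in the exponent.\<close>

lemma amortized_time_lower_bound:
  assumes \<kappa>: "\<kappa> < 1 / 2" and "MIS_amortized_time \<kappa> D T"
    and lb: "\<And>r T. solves_BMM (link D (reduction r (base_array D))) T \<Longrightarrow> almost_Omega T e"
  shows "almost_Omega T (e - 2)"
proof -
  obtain c where c: "\<And>N E adv. E \<subseteq> all_edges N \<Longrightarrow> coin_prob (\<lambda>\<omega>. \<exists>t m.
      maintains_MIS (word_bound c N) D N E adv \<omega> t m \<and>
      (real m \<ge> \<kappa> * (real N)\<^sup>2 \<and> m > 0 \<longrightarrow> real t / real m \<le> T N)) \<ge> 2 / 3"
    using assms(2) unfolding MIS_amortized_time_def by blast
  \<comment> \<open>The inequality \<open>N * (N - 1) / 2 \<ge> \<kappa> * N^2\<close> amounts to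
    \<open>N * (1 - 2 * \<kappa>) \<ge> 1\<close> for positive \<open>N\<close>.\<close>
  define r0 where "r0 = 2 + nat \<lceil>1 / (1 - 2 * \<kappa>)\<rceil>"
  have bound: "real t \<le> T N * real (card (all_edges N))"
    if N: "r0 \<le> N" and t: "real (card (all_edges N)) \<ge> \<kappa> * (real N)\<^sup>2 \<and> card (all_edges N) > 0 \<longrightarrow>
      real t / real (card (all_edges N)) \<le> T N" for N t
  proof -
    have N2: "2 \<le> N" using N by (simp add: r0_def)
    have "1 / (1 - 2 * \<kappa>) \<le> real r0" unfolding r0_def by linarith
    also have "\<dots> \<le> real N" using N by simp
    finally have "1 \<le> real N * (1 - 2 * \<kappa>)" using \<kappa> by (simp add: field_simps)
    then have "real N * 1 \<le> real N * (real N * (1 - 2 * \<kappa>))" by (intro mult_left_mono) simp_all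
    moreover have card: "2 * real (card (all_edges N)) = real N * (real N - 1)"
      using arg_cong[OF card_all_edges[of N], of real] N2 by (simp add: of_nat_diff)
    ultimately have "real (card (all_edges N)) \<ge> \<kappa> * (real N)\<^sup>2"
      by (simp add: algebra_simps power2_eq_square)
    moreover have "0 < real N * (real N - 1)" using N2 by simp
    then have "card (all_edges N) > 0" unfolding card[symmetric] by simp
    ultimately show ?thesis using t by (simp add: pos_divide_le_eq)
  qed
  have "almost_Omega (\<lambda>N. T N * real (card (all_edges N))) e"
  proof (rule reduction_lower_bound[where c = c and l = r0 and D = D and
      P = "\<lambda>N t m. real m \<ge> \<kappa> * (real N)\<^sup>2 \<and> m > 0 \<longrightarrow> real t / real m \<le> T N"])
    show "2 \<le> r0" by (simp add: r0_def)
  qed (use c bound lb in \<open>simp_all only: empty_subsetI\<close>)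
  then show ?thesis by (rule almost_Omega_divide_square)
qed

theorem theorem1p1:
  shows "(BMM_hypothesis \<longrightarrow>
            (\<forall>D T. MIS_total_time D T \<longrightarrow> almost_Omega T mm_exponent) \<and>
            (\<forall>\<kappa> D T. 0 < \<kappa> \<and> \<kappa> < 1 / 2 \<and> MIS_amortized_time \<kappa> D T \<longrightarrow>
               almost_Omega T (mm_exponent - 2))) \<and>
         (\<forall>(\<B> :: com set) (\<D> :: dyn_alg set).
            combinatorial_classes \<B> \<D> \<and> Combinatorial_BMM_hypothesis \<B> \<longrightarrow>
            (\<forall>\<kappa> T. \<forall>D\<in>\<D>. 0 < \<kappa> \<and> \<kappa> < 1 / 2 \<and> MIS_amortized_time \<kappa> D T \<longrightarrow>
               almost_Omega T 1))"
proof (intro conjI impI allI ballI)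
  fix D T
  assume "BMM_hypothesis"
  then have lb: "solves_BMM p T \<Longrightarrow> almost_Omega T mm_exponent" for p T
    by (simp add: BMM_hypothesis_def BMM_lower_bound_def)
  show "almost_Omega T mm_exponent" if "MIS_total_time D T"
    by (rule total_time_lower_bound[OF that]) (rule lb)
  fix \<kappa>
  show "almost_Omega T (mm_exponent - 2)" if "0 < \<kappa> \<and> \<kappa> < 1 / 2 \<and> MIS_amortized_time \<kappa> D T"
    by (rule amortized_time_lower_bound[of \<kappa> D]) (use that lb in auto)
next
  fix \<B> \<D> \<kappa> T D
  assume hyp: "combinatorial_classes \<B> \<D> \<and> Combinatorial_BMM_hypothesis \<B>" and D: "D \<in> \<D>"
    and T: "0 < \<kappa> \<and> \<kappa> < 1 / 2 \<and> MIS_amortized_time \<kappa> D T"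
  have "link D (reduction r (base_array D)) \<in> \<B>" for r
    using hyp D linear_reduction_reduction[OF base_array] unfolding combinatorial_classes_def by blast
  then have lb: "almost_Omega T' 3" if "solves_BMM (link D (reduction r (base_array D))) T'" for r T'
    using hyp that unfolding Combinatorial_BMM_hypothesis_def BMM_lower_bound_def by blast
  have "almost_Omega T (3 - 2)"
    by (rule amortized_time_lower_bound[of \<kappa> D]) (use T lb in auto)
  then show "almost_Omega T 1" by simp
qed

end
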